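(* Let $\bar p=(p_1,p_2,\dots)$ be a sequence of reals with $0\le p_i<1$ for all $i\ge 1$, and let $j\in\{1,2,3\}$. Then $\bar p$ $j$-hereditarily satisfies the 0-1 law for $L$ if and only if $$\lim_{n\to\infty}\frac{\log\left(\prod_{i=1}^n(1-p_i)\right)}{\log n}=0.$$ Moreover, the same equivalence holds if "0-1 law" is replaced by "convergence law" or by "weak convergence law".
   Context: For a sequence $\bar p=(p_1,p_2,\dots)$ of probabilities (reals in $[0,1]$), $M^n_{\bar p}$ is the random graph with vertex set $[n]=\{1,\dots,n\}$ in which, for $i\ne j$, the pair $\{i,j\}$ is an edge with probability $p_{|i-j|}$, all edges drawn independently. $L$ is first-order logic in the vocabulary consisting of a single binary (adjacency) relation, interpreted in graphs. $M^n_{\bar p}$ satisfies the 0-1 law for $L$ if for every $L$-sentence $\psi$ the limit $\lim_{n\to\infty}\Pr[M^n_{\bar p}\models\psi]$ exists and lies in $\{0,1\}$; the convergence law if this limit exists for every $\psi$; the weak convergence law if for every $\psi$, $\limsup_n\Pr[M^n_{\bar p}\models\psi]-\liminf_n\Pr[M^n_{\bar p}\models\psi]<1$. $Gen_1(\bar p)$ is the set of sequences $\bar q$ obtained from $\bar p$ by inserting zeros: $\bar q\in Gen_1(\bar p)$ iff for some strictly increasing $f:\{1,2,\dots\}\to\{1,2,\dots\}$ we have $q_{f(i)}=p_i$ for all $i$ and $q_l=0$ for $l\notin\mathrm{Im}(f)$. $Gen_2(\bar p)=\{\bar q: q_l\in[0,p_l]\text{ for all }l\ge1\}$. $Gen_3(\bar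 p)=\{\bar q: q_l\in\{0,p_l\}\text{ for all }l\ge 1\}$. For $j\in\{1,2,3\}$, $\bar p$ $j$-hereditarily satisfies the 0-1 law (resp. convergence law, weak convergence law) for $L$ if for every $\bar q\in Gen_j(\bar p)$, $M^n_{\bar q}$ satisfies the 0-1 law (resp. convergence law, weak convergence law) for $L$. *)

theory Defs
  imports "HOL-Probability.Probability"
begin

text \<open>First-order logic (with equality) over one binary relation symbol. Variables are natural
  numbers; the remaining connectives and the universal quantifier are definable.\<close>

datatype fol =
    Adj nat nat
  | Equal nat nat
  | Neg fol
  | Conj fol fol
  | Exists nat fol

primrec free_vars :: "fol \<Rightarrow> nat set" where
  "free_vars (Adj x y) = {x, y}"
| "free_vars (Equal x y) = {x, y}"
| "free_vars (Neg \<phi>) = free_vars \<phi>"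
| "free_vars (Conj \<phi> \<psi>) = free_vars \<phi> \<union> free_vars \<psi>"
| "free_vars (Exists x \<phi>) = free_vars \<phi> - {x}"

definition sentence :: "fol \<Rightarrow> bool" where
  "sentence \<psi> \<longleftrightarrow> free_vars \<psi> = {}"

primrec sat :: "'a set \<Rightarrow> 'a rel \<Rightarrow> (nat \<Rightarrow> 'a) \<Rightarrow> fol \<Rightarrow> bool" where
  "sat V R s (Adj x y) \<longleftrightarrow> (s x, s y) \<in> R"
| "sat V R s (Equal x y) \<longleftrightarrow> s x = s y"
| "sat V R s (Neg \<phi>) \<longleftrightarrow> \<not> sat V R s \<phi>"
| "sat V R s (Conj \<phi> \<psi>) \<longleftrightarrow> sat V R s \<phi> \<and> sat V R s \<psi>"
| "sat V R s (Exists x \<phi>) \<longleftrightarrow> (\<exists>a\<in>V. sat V R (s(x := a)) \<phi>)"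

text \<open>Only used for sentences, whose truth value does not depend on the assignment.\<close>

definition models :: "'a set \<Rightarrow> 'a rel \<Rightarrow> fol \<Rightarrow> bool" where
  "models V R \<psi> \<longleftrightarrow> (\<forall>s. sat V R s \<psi>)"

text \<open>The random graph on the vertex set \<open>{1..n}\<close>, given by its adjacency relation. There is one
  independent coin for each unordered pair, represented as \<open>(i, j)\<close> with \<open>i < j\<close>; all other values
  of the sampled function are \<open>False\<close>, so the relation is symmetric and irreflexive. A sequence
  \<open>(p\<^sub>1, p\<^sub>2, \<dots>)\<close> is a function on \<open>nat\<close> whose value at \<open>0\<close> is never used.\<close>

definition random_graph :: "(nat \<Rightarrow> real) \<Rightarrow> nat \<Rightarrow> nat rel pmf" where
  "random_graph p n =
     map_pmf (\<lambda>c. {(i, j). c (i, j) \<or> c (j, i)})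
       (Pi_pmf {(i, j). 1 \<le> i \<and> i < j \<and> j \<le> n} False (\<lambda>(i, j). bernoulli_pmf (p (j - i))))"

definition prob_models :: "(nat \<Rightarrow> real) \<Rightarrow> fol \<Rightarrow> nat \<Rightarrow> real" where
  "prob_models p \<psi> n = measure_pmf.prob (random_graph p n) {R. models {1..n} R \<psi>}"

definition zero_one_law :: "(nat \<Rightarrow> real) \<Rightarrow> bool" where
  "zero_one_law p \<longleftrightarrow>
     (\<forall>\<psi>. sentence \<psi> \<longrightarrow> (\<exists>c\<in>{0, 1}. prob_models p \<psi> \<longlonglongrightarrow> c))"

definition convergence_law :: "(nat \<Rightarrow> real) \<Rightarrow> bool" where
  "convergence_law p \<longleftrightarrow> (\<forall>\<psi>. sentence \<psi> \<longrightarrow> convergent (prob_models p \<psi>))"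

definition weak_convergence_law :: "(nat \<Rightarrow> real) \<Rightarrow> bool" where
  "weak_convergence_law p \<longleftrightarrow>
     (\<forall>\<psi>. sentence \<psi> \<longrightarrow>
        limsup (\<lambda>n. ereal (prob_models p \<psi> n)) - liminf (\<lambda>n. ereal (prob_models p \<psi> n)) < 1)"

definition Gen1 :: "(nat \<Rightarrow> real) \<Rightarrow> (nat \<Rightarrow> real) set" where
  "Gen1 p = {q. \<exists>f. f ` {1..} \<subseteq> {1..} \<and> strict_mono_on {1..} f \<and>
                    (\<forall>i\<ge>1. q (f i) = p i) \<and> (\<forall>l\<ge>1. l \<notin> f ` {1..} \<longrightarrow> q l = 0)}"

definition Gen2 :: "(nat \<Rightarrow> real) \<Rightarrow> (nat \<Rightarrow> real) set" where
  "Gen2 p = {q. \<forall>l\<ge>1. q l \<in> {0..p l}}"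

definition Gen3 :: "(nat \<Rightarrow> real) \<Rightarrow> (nat \<Rightarrow> real) set" where
  "Gen3 p = {q. \<forall>l\<ge>1. q l \<in> {0, p l}}"

definition hereditarily ::
  "((nat \<Rightarrow> real) \<Rightarrow> (nat \<Rightarrow> real) set) \<Rightarrow> ((nat \<Rightarrow> real) \<Rightarrow> bool) \<Rightarrow> (nat \<Rightarrow> real) \<Rightarrow> bool" where
  "hereditarily Gen law p \<longleftrightarrow> (\<forall>q\<in>Gen p. law q)"

end

theory Submission
  imports Defs "HOL-Real_Asymp.Real_Asymp"
begin

text \<open>Write \<open>P n\<close> for the product of the \<open>1 - p i\<close> with \<open>i \<le> n\<close>. Suppose \<open>P n\<close> is at least \<open>n\<close> to the power \<open>- \<delta>\<close>
  eventually, for every \<open>\<delta> > 0\<close>. Then any fixed finite graph all of whose edges have lengths \<open>d\<close> with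
  \<open>p d > 0\<close> occurs with high probability as a union of components on a block of consecutive vertices:
  a given block is right with probability at least a constant times a power of \<open>P n\<close>, and there are
  polynomially many almost independent blocks. The Ehrenfeucht-Fraisse types of rank \<open>k\<close> of such graphs
  form a finite commutative monoid under disjoint union in which the multiples of each element
  are eventually constant, hence it has a zero. Once a graph representing the zero occurs as a union of
  components, the type of the whole random graph is determined.

  Conversely, suppose \<open>P n\<close> is at most \<open>n\<close> to the power \<open>- \<epsilon>\<close> infinitely often. The sentence ``some vertex
  has \<open>K\<close> neighbours of degree one'' then has vanishing probability along such \<open>n\<close> when \<open>K\<close> is large
  in terms of \<open>\<epsilon>\<close>, because each leaf costs a power of \<open>P n\<close>. Whenever a long enough stretch of zeros
  follows, the sequence behaves like a finitely supported one, for which the sentence has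
  probability close to one. Alternating the two regimes makes the probability oscillate between
  \<open>0\<close> and \<open>1\<close>.\<close>

section \<open>Ehrenfeucht-Fraisse types\<close>

text \<open>Since \<open>p l < 1\<close>, every finite product is positive, so a fixed pattern with
  edges of positive probability has a constant price and only its isolation becomes dearer with
  \<open>n\<close>. Isolating \<open>m\<close> vertices costs at most \<open>2 * m\<close> full
  products, one for each vertex and side. Attempts on different blocks interfere only through edges
  between blocks, and a good common spacing makes these unlikely. The limit is \<open>0\<close> or
  \<open>1\<close> because the zero type depends on the sentence and on the set of lengths of
  positive probability, not on \<open>n\<close>.

  Two obstacles shape the converse. A single \<open>p d\<close> close to \<open>1\<close> can make
  the product small while leaves at distance \<open>d\<close> stay cheap; such leaves are set aside.
  A vertex near an end does not see all distances; hence \<open>2 * n\<close> vertices are used when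
  the lengths in \<open>{n<..2 * n}\<close> are inactive, so that each vertex sees all distances up
  to \<open>n\<close> on one side. One construction with a set \<open>A\<close> of active positions
  serves all families: \<open>p\<close> is restricted to \<open>A\<close> for \<open>Gen3\<close>,
  whose members lie in \<open>Gen2\<close>, and spread along \<open>A\<close> for
  \<open>Gen1\<close>.\<close>

definition atoms :: "'a rel \<Rightarrow> 'a option list \<Rightarrow> nat" where
  "atoms R as = prod_encode
     (set_encode (prod_encode ` {(i, j). i < length as \<and> j < length as \<and>
        (\<exists>u v. as ! i = Some u \<and> as ! j = Some v \<and> (u, v) \<in> R)}),
      set_encode (prod_encode ` {(i, j). i < length as \<and> j < length as \<and>
        (\<exists>u. as ! i = Some u \<and> as ! j = Some u)}))"

text \<open>A code of the rank-\<open>k\<close> Ehrenfeucht-Fraisse type of a pebbled structure. An entry \<open>None\<close> is a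
  pebble that is not on the board; such moves allow a game on a disjoint union to be played as two
  games on the parts, each of which sees the pebbles in the other part as \<open>None\<close>.\<close>

primrec tp :: "nat \<Rightarrow> 'a set \<Rightarrow> 'a rel \<Rightarrow> 'a option list \<Rightarrow> nat" where
  "tp 0 V R as = atoms R as"
| "tp (Suc k) V R as = prod_encode (atoms R as,
     prod_encode (tp k V R (None # as), set_encode ((\<lambda>a. tp k V R (Some a # as)) ` V)))"

primrec qrank :: "fol \<Rightarrow> nat" where
  "qrank (Adj x y) = 0"
| "qrank (Equal x y) = 0"
| "qrank (Neg \<phi>) = qrank \<phi>"
| "qrank (Conj \<phi> \<psi>) = max (qrank \<phi>) (qrank \<psi>)"
| "qrank (Exists x \<phi>) = Suc (qrank \<phi>)"

section \<open>Types determine the truth of formulas\<close>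

lemma finite_index_pairs: "finite {(i, j). i < (n::nat) \<and> j < n \<and> P i j}"
  by (rule finite_subset[of _ "{..<n} \<times> {..<n}"]) auto

text \<open>Both encodings are injective on finite sets of index pairs. Only positions are encoded,
  never vertices, which allows codes over different carrier types to be compared.\<close>

lemma atoms_eq_iff:
  assumes "length as = length bs"
  shows "atoms R as = atoms S bs \<longleftrightarrow> (\<forall>i<length as. \<forall>j<length as.
    ((\<exists>u v. as ! i = Some u \<and> as ! j = Some v \<and> (u, v) \<in> R) \<longleftrightarrow>
     (\<exists>u v. bs ! i = Some u \<and> bs ! j = Some v \<and> (u, v) \<in> S)) \<and>
    ((\<exists>u. as ! i = Some u \<and> as ! j = Some u) \<longleftrightarrow>
     (\<exists>u. bs ! i = Some u \<and> bs ! j = Some u)))"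
proof -
  have enc: "set_encode (prod_encode ` {(i, j). i < n \<and> j < n \<and> P i j}) =
      set_encode (prod_encode ` {(i, j). i < n \<and> j < n \<and> Q i j}) \<longleftrightarrow>
      (\<forall>i<n. \<forall>j<n. P i j \<longleftrightarrow> Q i j)" for n P Q
  proof -
    have "set_encode (prod_encode ` {(i, j). i < n \<and> j < n \<and> P i j}) =
      set_encode (prod_encode ` {(i, j). i < n \<and> j < n \<and> Q i j}) \<longleftrightarrow>
      prod_encode ` {(i, j). i < n \<and> j < n \<and> P i j} =
      prod_encode ` {(i, j). i < n \<and> j < n \<and> Q i j}"
      by (rule set_encode_eq) (intro finite_imageI finite_index_pairs)+
    also have "\<dots> \<longleftrightarrow> {(i, j). i < n \<and> j < n \<and> P i j} = {(i, j). i < n \<and> j < n \<and> Q i j}"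
      by (rule inj_image_eq_iff) (rule inj_prod_encode)
    also have "\<dots> \<longleftrightarrow> (\<forall>i<n. \<forall>j<n. P i j \<longleftrightarrow> Q i j)"
      by (auto simp: set_eq_iff)
    finally show ?thesis .
  qed
  show ?thesis
    unfolding atoms_def assms[symmetric] prod_encode_eq prod.inject enc by blast
qed

lemma tp_Suc_eq_iff:
  assumes "finite V" "finite W"
  shows "tp (Suc k) V R as = tp (Suc k) W S bs \<longleftrightarrow>
    atoms R as = atoms S bs \<and> tp k V R (None # as) = tp k W S (None # bs) \<and>
    (\<lambda>a. tp k V R (Some a # as)) ` V = (\<lambda>b. tp k W S (Some b # bs)) ` W"
  using assms by (simp add: prod_encode_eq set_encode_eq)

lemma tp_eq_imp_atoms_eq: "tp k V R as = tp k W S bs \<Longrightarrow> atoms R as = atoms S bs"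
  by (cases k) (auto simp: prod_encode_eq)

lemma image_eq_imageD:
  assumes "f ` A = g ` B"
  shows "a \<in> A \<Longrightarrow> \<exists>b\<in>B. f a = g b" "b \<in> B \<Longrightarrow> \<exists>a\<in>A. f a = g b"
  using assms by (metis imageE imageI)+

text \<open>Each quantifier pushes a new pebble to the front, and \<open>h\<close> records which
  pebble currently carries the value of a variable. A variable that is bound again simply abandons
  its former pebble, so nothing is asked of pebbles outside the range of \<open>h\<close>.\<close>

lemma tp_eq_imp_sat_iff:
  assumes "qrank \<phi> \<le> k" "tp k V R as = tp k W S bs" "length as = length bs"
    and "finite V" "finite W"
    and "\<forall>x\<in>free_vars \<phi>. h x < length as \<and> as ! h x = Some (s x) \<and> bs ! h x = Some (t x)"
  shows "sat V R s \<phi> \<longleftrightarrow> sat W S t \<phi>"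
  using assms
proof (induction \<phi> arbitrary: k as bs s t h)
  case (Adj x y)
  have "atoms R as = atoms S bs" using Adj.prems(2) by (rule tp_eq_imp_atoms_eq)
  note this[unfolded atoms_eq_iff[OF Adj.prems(3)], rule_format, of "h x" "h y"]
  then show ?case using Adj.prems(6) by auto
next
  case (Equal x y)
  have "atoms R as = atoms S bs" using Equal.prems(2) by (rule tp_eq_imp_atoms_eq)
  note atoms = this[unfolded atoms_eq_iff[OF Equal.prems(3)], rule_format, of "h x" "h y"]
  have eq: "(\<exists>u. cs ! h x = Some u \<and> cs ! h y = Some u) \<longleftrightarrow> r x = r y"
    if "cs ! h x = Some (r x)" "cs ! h y = Some (r y)" for cs :: "'c option list" and r
    using that by auto
  have eq2: "(\<exists>u. cs ! h x = Some u \<and> cs ! h y = Some u) \<longleftrightarrow> r x = r y"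
    if "cs ! h x = Some (r x)" "cs ! h y = Some (r y)" for cs :: "'b option list" and r
    using that by auto
  have h: "h x < length as" "h y < length as" "as ! h x = Some (s x)" "as ! h y = Some (s y)"
    "bs ! h x = Some (t x)" "bs ! h y = Some (t y)" using Equal.prems(6) by auto
  show ?case unfolding sat.simps
    using atoms[OF h(1,2), THEN conjunct2] eq[OF h(3,4)] eq2[OF h(5,6)] by argo
next
  case (Neg \<phi>)
  have "sat V R s \<phi> \<longleftrightarrow> sat W S t \<phi>"
    by (rule Neg.IH[OF _ Neg.prems(2-5)]) (use Neg.prems in auto)
  then show ?case by simp
next
  case (Conj \<phi> \<psi>)
  have "sat V R s \<phi> \<longleftrightarrow> sat W S t \<phi>"
    by (rule Conj.IH(1)[OF _ Conj.prems(2-5)]) (use Conj.prems in auto)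
  moreover have "sat V R s \<psi> \<longleftrightarrow> sat W S t \<psi>"
    by (rule Conj.IH(2)[OF _ Conj.prems(2-5)]) (use Conj.prems in auto)
  ultimately show ?case by simp
next
  case (Exists x \<phi>)
  from Exists.prems(1) obtain l where k: "k = Suc l" and l: "qrank \<phi> \<le> l"
    by (cases k) auto
  have ext: "sat V R (s(x := a)) \<phi> \<longleftrightarrow> sat W S (t(x := b)) \<phi>"
    if "tp l V R (Some a # as) = tp l W S (Some b # bs)" for a b
    by (rule Exists.IH[where h = "\<lambda>y. if y = x then 0 else Suc (h y)", OF l that])
      (use Exists.prems in auto)
  have eq: "(\<lambda>a. tp l V R (Some a # as)) ` V = (\<lambda>b. tp l W S (Some b # bs)) ` W"
    using Exists.prems(2) tp_Suc_eq_iff[OF Exists.prems(4,5)] unfolding k by blast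
  have "\<exists>b\<in>W. tp l V R (Some a # as) = tp l W S (Some b # bs)" if "a \<in> V" for a
    by (rule image_eq_imageD(1)[OF eq that])
  moreover have "\<exists>a\<in>V. tp l V R (Some a # as) = tp l W S (Some b # bs)" if "b \<in> W" for b
    by (rule image_eq_imageD(2)[OF eq that])
  ultimately show ?case using ext unfolding sat.simps by meson
qed

lemma tp_eq_imp_models_iff:
  assumes "sentence \<psi>" "finite V" "finite W"
    and "tp (qrank \<psi>) V R [] = tp (qrank \<psi>) W S []"
  shows "models V R \<psi> \<longleftrightarrow> models W S \<psi>"
proof -
  have "sat V R s \<psi> \<longleftrightarrow> sat W S t \<psi>" for s t
    by (rule tp_eq_imp_sat_iff[OF order_refl assms(4)])
      (use assms in \<open>auto simp: sentence_def\<close>)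
  then show ?thesis unfolding models_def by blast
qed

section \<open>Finiteness and isomorphism invariance of types\<close>

text \<open>A type of rank \<open>Suc k\<close> with \<open>m\<close> pebbles is coded by its atoms,
  one type and a set of types of rank \<open>k\<close> with \<open>Suc m\<close> pebbles. Hence the
  induction has to treat all \<open>m\<close> at once.\<close>

lemma finite_tp_range:
  "finite {tp k V R as | (V :: 'a set) R as. finite V \<and> length as = m}"
proof (induction k arbitrary: m)
  have fin_at: "finite {atoms R as | (R :: 'a rel) as. length as = m}" for m
  proof -
    let ?T = "set_encode ` Pow (prod_encode ` ({..<m} \<times> {..<m}))"
    have "{atoms R as | (R :: 'a rel) as. length as = m} \<subseteq> prod_encode ` (?T \<times> ?T)"
    proof
      fix c assume "c \<in> {atoms R as | (R :: 'a rel) as. length as = m}"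
      then obtain R :: "'a rel" and as where c: "c = atoms R as" "length as = m" by blast
      show "c \<in> prod_encode ` (?T \<times> ?T)"
        unfolding c(1) atoms_def c(2) by (intro imageI SigmaI) auto
    qed
    then show ?thesis by (rule finite_subset) auto
  qed
  {
    case 0
    have "{tp 0 V R as | (V :: 'a set) R as. finite V \<and> length as = m} \<subseteq>
        {atoms R as | (R :: 'a rel) as. length as = m}"
      by auto
    then show ?case using fin_at by (rule finite_subset)
  next
    case (Suc k)
    let ?A = "{atoms R as | (R :: 'a rel) as. length as = m}"
    let ?S = "{tp k V R as | (V :: 'a set) R as. finite V \<and> length as = Suc m}"
    have "{tp (Suc k) V R as | (V :: 'a set) R as. finite V \<and> length as = m} \<subseteq>
        prod_encode ` (?A \<times> prod_encode ` (?S \<times> set_encode ` Pow ?S))"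
    proof
      fix c assume "c \<in> {tp (Suc k) V R as | (V :: 'a set) R as. finite V \<and> length as = m}"
      then obtain V :: "'a set" and R as
        where c: "c = tp (Suc k) V R as" "finite V" "length as = m" by blast
      have "tp k V R (x # as) \<in> ?S" for x
        by (intro CollectI exI[of _ V] exI[of _ R] exI[of _ "x # as"]) (simp add: c)
      then show "c \<in> prod_encode ` (?A \<times> prod_encode ` (?S \<times> set_encode ` Pow ?S))"
        unfolding c(1) tp.simps by (intro imageI SigmaI) (use c in auto)
    qed
    then show ?case by (rule finite_subset) (use Suc[of "Suc m"] fin_at in auto)
  }
qed

lemma tp_image:
  assumes "inj_on f V" "\<forall>u\<in>V. \<forall>v\<in>V. (f u, f v) \<in> S \<longleftrightarrow> (u, v) \<in> R"
    and "set as \<subseteq> insert None (Some ` V)"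
  shows "tp k (f ` V) S (map (map_option f) as) = tp k V R as"
  using assms(3)
proof (induction k arbitrary: as)
  have at: "atoms S (map (map_option f) as) = atoms R as"
    if as: "set as \<subseteq> insert None (Some ` V)" for as
  proof -
    have mem: "u \<in> V" if "i < length as" "as ! i = Some u" for i u
      using that as nth_mem[of i as] by auto
    show ?thesis
      by (subst atoms_eq_iff) (use mem assms(1,2) in \<open>auto simp: inj_on_eq_iff\<close>)
  qed
  {
    case 0
    then show ?case using at by simp
  next
    case (Suc k)
    have 1: "tp k (f ` V) S (map (map_option f) (x # as)) = tp k V R (x # as)"
      if "x \<in> insert None (Some ` V)" for x
      by (rule Suc.IH) (use Suc.prems that in auto)
    have "(\<lambda>a. tp k (f ` V) S (Some a # map (map_option f) as)) ` f ` V =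
        (\<lambda>a. tp k V R (Some a # as)) ` V"
      using 1[of "Some _"] by (auto simp: image_image)
    then show ?case using 1[of None] at[OF Suc.prems] by simp
  }
qed

text \<open>With \<open>f = id\<close> this says that only the part of the relation inside
  \<open>V\<close> matters; edges leaving a vertex set are discarded in this way later on.\<close>

lemma tp_Nil_image:
  assumes "inj_on f V" "\<forall>u\<in>V. \<forall>v\<in>V. (f u, f v) \<in> S \<longleftrightarrow> (u, v) \<in> R"
  shows "tp k (f ` V) S [] = tp k V R []"
  using tp_image[OF assms, of "[]"] by simp

section \<open>Types of disjoint unions and of repeated parts\<close>

definition restr :: "'a set \<Rightarrow> 'a option \<Rightarrow> 'a option" where
  "restr A x = (case x of Some a \<Rightarrow> if a \<in> A then Some a else None | None \<Rightarrow> None)"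

lemma restr_simps [simp]:
  "restr A None = None" "a \<in> A \<Longrightarrow> restr A (Some a) = Some a" "a \<notin> A \<Longrightarrow> restr A (Some a) = None"
  by (simp_all add: restr_def)

lemma restr_eq_Some_iff: "restr A x = Some a \<longleftrightarrow> x = Some a \<and> a \<in> A"
  by (cases x) (auto simp: restr_def)

lemma restr_split:
  assumes "A \<inter> B = {}" "R \<inter> (A \<union> B) \<times> (A \<union> B) \<subseteq> A \<times> A \<union> B \<times> B"
    and as: "set as \<subseteq> insert None (Some ` (A \<union> B))" and ij: "i < length as" "j < length as"
  shows "(\<exists>u v. as ! i = Some u \<and> as ! j = Some v \<and> (u, v) \<in> R) \<longleftrightarrow>
      (\<exists>u v. map (restr A) as ! i = Some u \<and> map (restr A) as ! j = Some v \<and> (u, v) \<in> R) \<or>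
      (\<exists>u v. map (restr B) as ! i = Some u \<and> map (restr B) as ! j = Some v \<and> (u, v) \<in> R)"
proof -
  have mem: "u \<in> A \<union> B" if "l < length as" "as ! l = Some u" for l u
    using that as nth_mem[of l as] by auto
  show ?thesis
    using ij mem[of i] mem[of j] assms(2) by (simp add: restr_eq_Some_iff) blast
qed

lemma atoms_Un:
  assumes R: "R \<inter> (A \<union> B) \<times> (A \<union> B) \<subseteq> A \<times> A \<union> B \<times> B"
    and S: "S \<inter> (C \<union> D) \<times> (C \<union> D) \<subseteq> C \<times> C \<union> D \<times> D"
    and disj: "A \<inter> B = {}" "C \<inter> D = {}"
    and len: "length as = length bs"
    and as: "set as \<subseteq> insert None (Some ` (A \<union> B))" and bs: "set bs \<subseteq> insert None (Some ` (C \<union> D))"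
    and eq: "atoms R (map (restr A) as) = atoms S (map (restr C) bs)"
      "atoms R (map (restr B) as) = atoms S (map (restr D) bs)"
  shows "atoms R as = atoms S bs"
proof -
  \<comment> \<open>Equality of pebbles is the relation \<open>Id\<close>, which never joins two
    disjoint parts, so one splitting rule covers both edges and equalities.\<close>
  have Id: "(\<exists>u. cs ! i = Some u \<and> cs ! j = Some u) \<longleftrightarrow>
      (\<exists>u v. cs ! i = Some u \<and> cs ! j = Some v \<and> (u, v) \<in> Id)" for cs :: "'c option list" and i j
    by auto
  have IdA: "Id \<inter> (A \<union> B) \<times> (A \<union> B) \<subseteq> A \<times> A \<union> B \<times> B"
    and IdC: "Id \<inter> (C \<union> D) \<times> (C \<union> D) \<subseteq> C \<times> C \<union> D \<times> D" by auto
  have lens: "length (map (restr A) as) = length (map (restr C) bs)"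
    "length (map (restr B) as) = length (map (restr D) bs)" using len by auto
  note 1 = eq(1)[unfolded atoms_eq_iff[OF lens(1)] Id, unfolded length_map, rule_format]
  note 2 = eq(2)[unfolded atoms_eq_iff[OF lens(2)] Id, unfolded length_map, rule_format]
  show ?thesis
    unfolding atoms_eq_iff[OF len] Id
  proof (intro allI impI)
    fix i j assume ij: "i < length as" "j < length as"
    note ij' = ij[unfolded len]
    show "((\<exists>u v. as ! i = Some u \<and> as ! j = Some v \<and> (u, v) \<in> R) \<longleftrightarrow>
       (\<exists>u v. bs ! i = Some u \<and> bs ! j = Some v \<and> (u, v) \<in> S)) \<and>
      ((\<exists>u v. as ! i = Some u \<and> as ! j = Some v \<and> (u, v) \<in> Id) \<longleftrightarrow>
       (\<exists>u v. bs ! i = Some u \<and> bs ! j = Some v \<and> (u, v) \<in> Id))"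
      unfolding restr_split[OF disj(1) R as ij] restr_split[OF disj(2) S bs ij']
        restr_split[OF disj(1) IdA as ij] restr_split[OF disj(2) IdC bs ij']
      using 1[OF ij] 2[OF ij] by argo
  qed
qed

lemma image_eq_transfer:
  assumes "f ` A = g ` B" "\<And>a b. a \<in> A \<Longrightarrow> b \<in> B \<Longrightarrow> f a = g b \<Longrightarrow> F a = G b"
  shows "F ` A = G ` B"
proof -
  note image_eq_imageD[OF assms(1)]
  then show ?thesis
    by (intro equalityI image_subsetI) (metis assms(2) imageI)+
qed

text \<open>A move is answered in the part where it was made, while the game on the other part
  advances by a \<open>None\<close> move. Both games thus lose one round together.\<close>

lemma tp_Un:
  assumes R: "R \<inter> (A \<union> B) \<times> (A \<union> B) \<subseteq> A \<times> A \<union> B \<times> B"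
    and S: "S \<inter> (C \<union> D) \<times> (C \<union> D) \<subseteq> C \<times> C \<union> D \<times> D"
    and disj: "A \<inter> B = {}" "C \<inter> D = {}"
    and fin: "finite A" "finite B" "finite C" "finite D"
    and "length as = length bs"
    and "set as \<subseteq> insert None (Some ` (A \<union> B))" "set bs \<subseteq> insert None (Some ` (C \<union> D))"
    and "tp k A R (map (restr A) as) = tp k C S (map (restr C) bs)"
      "tp k B R (map (restr B) as) = tp k D S (map (restr D) bs)"
  shows "tp k (A \<union> B) R as = tp k (C \<union> D) S bs"
  using assms(9-)
proof (induction k arbitrary: as bs)
  case 0
  then show ?case using atoms_Un[OF R S disj 0(1-3)] by simp
next
  case (Suc k)
  note as = Suc.prems(2) and bs = Suc.prems(3)
  note 1 = Suc.prems(4)[unfolded tp_Suc_eq_iff[OF fin(1,3)]]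
  note 2 = Suc.prems(5)[unfolded tp_Suc_eq_iff[OF fin(2,4)]]
  have at: "atoms R as = atoms S bs"
    by (rule atoms_Un[OF R S disj Suc.prems(1-3)]) (use 1 2 in auto)
  have IH: "tp k (A \<union> B) R (x # as) = tp k (C \<union> D) S (y # bs)"
    if "x \<in> insert None (Some ` (A \<union> B))" "y \<in> insert None (Some ` (C \<union> D))"
      "tp k A R (restr A x # map (restr A) as) = tp k C S (restr C y # map (restr C) bs)"
      "tp k B R (restr B x # map (restr B) as) = tp k D S (restr D y # map (restr D) bs)" for x y
    by (rule Suc.IH) (use Suc.prems that in auto)
  have none: "tp k (A \<union> B) R (None # as) = tp k (C \<union> D) S (None # bs)"
    by (rule IH) (use 1 2 in auto)
  have A: "tp k (A \<union> B) R (Some a # as) = tp k (C \<union> D) S (Some c # bs)"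
    if "a \<in> A" "c \<in> C" "tp k A R (Some a # map (restr A) as) = tp k C S (Some c # map (restr C) bs)"
    for a c
  proof -
    have "a \<notin> B" "c \<notin> D" using disj that by auto
    then show ?thesis by (intro IH) (use 1 2 that in auto)
  qed
  have B: "tp k (A \<union> B) R (Some a # as) = tp k (C \<union> D) S (Some c # bs)"
    if "a \<in> B" "c \<in> D" "tp k B R (Some a # map (restr B) as) = tp k D S (Some c # map (restr D) bs)"
    for a c
  proof -
    have "a \<notin> A" "c \<notin> C" using disj that by auto
    then show ?thesis by (intro IH) (use 1 2 that in auto)
  qed
  have "(\<lambda>a. tp k (A \<union> B) R (Some a # as)) ` A = (\<lambda>c. tp k (C \<union> D) S (Some c # bs)) ` C"
    by (rule image_eq_transfer[OF 1[THEN conjunct2, THEN conjunct2] A])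
  moreover have "(\<lambda>a. tp k (A \<union> B) R (Some a # as)) ` B = (\<lambda>c. tp k (C \<union> D) S (Some c # bs)) ` D"
    by (rule image_eq_transfer[OF 2[THEN conjunct2, THEN conjunct2] B])
  ultimately have "(\<lambda>a. tp k (A \<union> B) R (Some a # as)) ` (A \<union> B) =
      (\<lambda>c. tp k (C \<union> D) S (Some c # bs)) ` (C \<union> D)"
    by (simp only: image_Un)
  then show ?case using at none by (simp only: tp_Suc_eq_iff fin finite_Un simp_thms)
qed

text \<open>With more than \<open>k\<close> interchangeable copies that carry no pebble, a move into a copy can be
  answered in any other untouched copy, so one copy can be deleted.\<close>

lemma tp_remove_copy:
  assumes fin: "finite V"
    and swap: "\<And>C D. C \<in> \<C> \<Longrightarrow> D \<in> \<C> \<Longrightarrow> C \<noteq> D \<Longrightarrow> \<exists>f. bij_betw f V V \<and>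
      (\<forall>u\<in>V. \<forall>v\<in>V. (f u, f v) \<in> R \<longleftrightarrow> (u, v) \<in> R) \<and> f ` C \<subseteq> D \<and> (\<forall>x\<in>V - C - D. f x = x)"
    and "C \<in> \<C>" "finite \<C>" "k < card \<C>" "disjoint \<C>" "\<Union>\<C> \<subseteq> V"
    and "set as \<subseteq> insert None (Some ` (V - \<Union>\<C>))"
  shows "tp k V R as = tp k (V - C) R as"
  using assms(2-)
proof (induction k arbitrary: as \<C>)
  case 0
  then show ?case by simp
next
  case (Suc k)
  have none: "tp k V R (None # as) = tp k (V - C) R (None # as)"
    by (rule Suc.IH[of \<C>]) (use Suc.prems in auto)
  \<comment> \<open>A pebble entering a copy \<open>D\<close> other than \<open>C\<close> spoils
    \<open>D\<close> for later swaps. Dropping \<open>D\<close> lowers the number of copies by one,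
    in step with the rank.\<close>
  have out: "tp k V R (Some a # as) = tp k (V - C) R (Some a # as)" if a: "a \<in> V - C" for a
  proof (cases "a \<in> \<Union>\<C>")
    case True
    then obtain D where D: "D \<in> \<C>" "a \<in> D" by blast
    then have DC: "D \<noteq> C" using a by auto
    have "a \<notin> \<Union>(\<C> - {D})" using D \<open>disjoint \<C>\<close> by (auto simp: disjoint_def)
    then show ?thesis
      by (intro Suc.IH[of "\<C> - {D}"]) (use Suc.prems DC D a in \<open>auto simp: disjoint_def\<close>)
  next
    case False
    then show ?thesis by (intro Suc.IH[of \<C>]) (use Suc.prems a in auto)
  qed
  \<comment> \<open>No vertex of \<open>C\<close> is left in \<open>V - C\<close> to answer with.
    The automorphism \<open>f\<close> takes \<open>C\<close> into another copy and moves no pebble,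
    so \<open>f a\<close> has the type of \<open>a\<close> and falls under the previous
    case.\<close>
  have inn: "\<exists>b\<in>V - C. tp k V R (Some a # as) = tp k (V - C) R (Some b # as)" if a: "a \<in> C" for a
  proof -
    have "\<exists>D. D \<in> \<C> - {C}"
    proof (rule ccontr)
      assume "\<nexists>D. D \<in> \<C> - {C}"
      then have "\<C> \<subseteq> {C}" by auto
      then have "card \<C> \<le> 1" using card_mono[of "{C}" \<C>] by simp
      then show False using Suc.prems by simp
    qed
    then obtain D where D: "D \<in> \<C>" "D \<noteq> C" by auto
    obtain f where f: "bij_betw f V V" "\<forall>u\<in>V. \<forall>v\<in>V. (f u, f v) \<in> R \<longleftrightarrow> (u, v) \<in> R"
      "f ` C \<subseteq> D" "\<forall>x\<in>V - C - D. f x = x"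
      using Suc.prems(1)[OF \<open>C \<in> \<C>\<close> D(1)] D by blast
    have fa: "f a \<in> D" using f a by auto
    have "C \<inter> D = {}" using disjointD[OF \<open>disjoint \<C>\<close> \<open>C \<in> \<C>\<close> D(1)] D(2) by simp
    then have "f a \<in> V - C" using \<open>\<Union>\<C> \<subseteq> V\<close> D fa by auto
    have as: "set as \<subseteq> insert None (Some ` V)" using Suc.prems(7) by auto
    have "map (map_option f) as = as"
      using Suc.prems(7) f(4) Suc.prems(2) D by (intro map_idI) (auto 0 3)
    then have fa_eq: "tp k V R (Some (f a) # as) = tp k V R (Some a # as)"
      using tp_image[OF _ f(2), of "Some a # as" k] f(1) as a \<open>C \<in> \<C>\<close> \<open>\<Union>\<C> \<subseteq> V\<close>
      by (auto simp: bij_betw_def)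
    with \<open>f a \<in> V - C\<close> show ?thesis using out by metis
  qed
  have "(\<lambda>a. tp k V R (Some a # as)) ` V = (\<lambda>a. tp k (V - C) R (Some a # as)) ` (V - C)"
  proof (intro equalityI image_subsetI)
    fix a assume "a \<in> V"
    then show "tp k V R (Some a # as) \<in> (\<lambda>a. tp k (V - C) R (Some a # as)) ` (V - C)"
      using out inn by (cases "a \<in> C") (auto simp: image_iff)
  next
    fix a assume "a \<in> V - C"
    then show "tp k (V - C) R (Some a # as) \<in> (\<lambda>a. tp k V R (Some a # as)) ` V"
      by (intro image_eqI[of _ _ a]) (use out[of a] in auto)
  qed
  then show ?case using none by simp
qed

section \<open>A universal distance graph\<close>

definition distance_graph :: "nat set \<Rightarrow> nat set \<Rightarrow> nat rel \<Rightarrow> bool" where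
  "distance_graph D V R \<longleftrightarrow> finite V \<and> R \<subseteq> V \<times> V \<and> sym R \<and> irrefl R \<and>
     (\<forall>i j. (i, j) \<in> R \<and> i < j \<longrightarrow> j - i \<in> D)"

definition shift_rel :: "nat \<Rightarrow> nat rel \<Rightarrow> nat rel" where
  "shift_rel a R = map_prod ((+) a) ((+) a) ` R"

lemma in_shift_rel_iff [simp]: "(a + i, a + j) \<in> shift_rel a R \<longleftrightarrow> (i, j) \<in> R"
  by (force simp: shift_rel_def)

lemma distance_graph_shift:
  assumes "distance_graph D V R"
  shows "distance_graph D ((+) a ` V) (shift_rel a R)"
  using assms unfolding distance_graph_def shift_rel_def sym_def irrefl_def by fastforce

lemma tp_shift: "tp k ((+) a ` V) (shift_rel a R) [] = tp k V R []"
  by (rule tp_Nil_image) auto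

lemma distance_graph_Un:
  assumes "distance_graph D V R" "distance_graph D W S"
  shows "distance_graph D (V \<union> W) (R \<union> S)"
  using assms unfolding distance_graph_def irrefl_def by (fastforce intro: sym_Un)

lemma tp_graph_Un:
  assumes "R \<subseteq> V \<times> V" "S \<subseteq> W \<times> W" "R' \<subseteq> V' \<times> V'" "S' \<subseteq> W' \<times> W'"
    and "V \<inter> W = {}" "V' \<inter> W' = {}" "finite V" "finite W" "finite V'" "finite W'"
    and "tp k V R [] = tp k V' R' []" "tp k W S [] = tp k W' S' []"
  shows "tp k (V \<union> W) (R \<union> S) [] = tp k (V' \<union> W') (R' \<union> S') []"
proof (rule tp_Un)
  have restrict: "tp k A (B \<union> C) [] = tp k A B []"
    if "C \<subseteq> A' \<times> A'" "A \<inter> A' = {}" for A A' :: "'c set" and B C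
    using tp_Nil_image[of id A "B \<union> C" B k] that by auto
  show "tp k V (R \<union> S) (map (restr V) []) = tp k V' (R' \<union> S') (map (restr V') [])"
    using restrict[of S W V R] restrict[of S' W' V' R'] assms by simp
  show "tp k W (R \<union> S) (map (restr W) []) = tp k W' (R' \<union> S') (map (restr W') [])"
    using restrict[of R V W S] restrict[of R' V' W' S'] assms by (simp add: Un_commute Int_commute)
qed (use assms in auto)

section \<open>The commutative monoid of realised types\<close>

definition classes :: "nat set \<Rightarrow> nat \<Rightarrow> nat set" where
  "classes D k = {tp k V R [] | V R. distance_graph D V R}"

lemma finite_classes: "finite (classes D k)"
proof (rule finite_subset)
  show "finite {tp k V R as | (V :: nat set) R as. finite V \<and> length as = 0}"
    by (rule finite_tp_range)
qed (auto simp: classes_def distance_graph_def)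

text \<open>The operation goes through representatives, hence the description operator. Uniqueness
  is \<open>tp_graph_Un\<close>; existence for realised types comes from moving one representative
  away from the other.\<close>

definition join :: "nat set \<Rightarrow> nat \<Rightarrow> nat \<Rightarrow> nat \<Rightarrow> nat" where
  "join D k c d = (THE e. \<exists>V R W S. distance_graph D V R \<and> distance_graph D W S \<and> V \<inter> W = {} \<and>
     tp k V R [] = c \<and> tp k W S [] = d \<and> tp k (V \<union> W) (R \<union> S) [] = e)"

lemma join_tp:
  assumes "distance_graph D V R" "distance_graph D W S" "V \<inter> W = {}"
  shows "join D k (tp k V R []) (tp k W S []) = tp k (V \<union> W) (R \<union> S) []"
  unfolding join_def
proof (rule the_equality)
  fix e
  assume "\<exists>V' R' W' S'. distance_graph D V' R' \<and> distance_graph D W' S' \<and> V' \<inter> W' = {} \<and>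
     tp k V' R' [] = tp k V R [] \<and> tp k W' S' [] = tp k W S [] \<and> tp k (V' \<union> W') (R' \<union> S') [] = e"
  then show "e = tp k (V \<union> W) (R \<union> S) []"
    using assms unfolding distance_graph_def by (metis tp_graph_Un)
qed (use assms in blast)

text \<open>Translation changes neither the type nor the edge lengths, so a representative can be
  pushed beyond any finite set.\<close>

lemma classes_disjoint_rep:
  assumes "c \<in> classes D k" "finite W"
  obtains V R where "distance_graph D V R" "V \<inter> W = {}" "tp k V R [] = c"
proof -
  obtain V R where VR: "distance_graph D V R" "tp k V R [] = c"
    using assms(1) by (auto simp: classes_def)
  obtain a where "W \<subseteq> {..<a}" using finite_nat_iff_bounded assms(2) by auto
  then have "(+) a ` V \<inter> W = {}" by auto
  then show thesis using that[OF distance_graph_shift[OF VR(1), of a]] VR(2) tp_shift by metis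
qed

lemma join_rep2:
  assumes "c \<in> classes D k" "d \<in> classes D k"
  obtains V R W S where "distance_graph D V R" "distance_graph D W S" "V \<inter> W = {}"
    "tp k V R [] = c" "tp k W S [] = d"
proof -
  obtain V R where VR: "distance_graph D V R" "tp k V R [] = c"
    using assms(1) by (auto simp: classes_def)
  obtain W S where "distance_graph D W S" "W \<inter> V = {}" "tp k W S [] = d"
    using classes_disjoint_rep[OF assms(2), of V] VR(1) by (auto simp: distance_graph_def)
  then show thesis using that VR by blast
qed

lemma join_closed:
  assumes "c \<in> classes D k" "d \<in> classes D k"
  shows "join D k c d \<in> classes D k"
proof -
  obtain V R W S where *: "distance_graph D V R" "distance_graph D W S" "V \<inter> W = {}"
    "tp k V R [] = c" "tp k W S [] = d"
    using join_rep2[OF assms] .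
  then have "join D k c d = tp k (V \<union> W) (R \<union> S) []" using join_tp[OF *(1-3), of k] by simp
  then show ?thesis using distance_graph_Un[OF *(1,2)] by (auto simp: classes_def)
qed

lemma join_commute:
  assumes "c \<in> classes D k" "d \<in> classes D k"
  shows "join D k c d = join D k d c"
proof -
  obtain V R W S where *: "distance_graph D V R" "distance_graph D W S" "V \<inter> W = {}"
    "tp k V R [] = c" "tp k W S [] = d"
    using join_rep2[OF assms] .
  then show ?thesis
    using join_tp[OF *(1-3), of k] join_tp[OF *(2,1), of k] by (simp add: Int_commute Un_commute)
qed

lemma join_assoc:
  assumes "c \<in> classes D k" "d \<in> classes D k" "e \<in> classes D k"
  shows "join D k (join D k c d) e = join D k c (join D k d e)"
proof -
  obtain V R W S where 1: "distance_graph D V R" "distance_graph D W S" "V \<inter> W = {}"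
    "tp k V R [] = c" "tp k W S [] = d"
    using join_rep2[OF assms(1,2)] .
  have "finite (V \<union> W)" using 1 by (simp add: distance_graph_def)
  then obtain X T where 2: "distance_graph D X T" "X \<inter> (V \<union> W) = {}" "tp k X T [] = e"
    using classes_disjoint_rep[OF assms(3)] by metis
  have "join D k (join D k c d) e = tp k ((V \<union> W) \<union> X) ((R \<union> S) \<union> T) []"
    using join_tp[OF 1(1-3), of k] join_tp[OF distance_graph_Un[OF 1(1,2)] 2(1), of k] 1 2
    by (simp add: Int_commute)
  moreover have "join D k c (join D k d e) = tp k (V \<union> (W \<union> X)) (R \<union> (S \<union> T)) []"
    using join_tp[OF 1(2) 2(1), of k] join_tp[OF 1(1) distance_graph_Un[OF 1(2) 2(1)], of k] 1 2
    by (simp add: Int_Un_distrib Int_commute)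
  ultimately show ?thesis by (simp add: Un_assoc)
qed

section \<open>Repeated copies and the zero of the monoid\<close>

text \<open>Copy number \<open>x div L\<close> occupies an interval of length \<open>L\<close>, and
  \<open>x mod L\<close> is the position inside it. Swapping two copies then becomes arithmetic on
  quotients.\<close>

definition copies_verts :: "nat \<Rightarrow> nat \<Rightarrow> nat set \<Rightarrow> nat set" where
  "copies_verts n L V = {x. x div L < n \<and> x mod L \<in> V}"

definition copies_rel :: "nat \<Rightarrow> nat \<Rightarrow> nat rel \<Rightarrow> nat rel" where
  "copies_rel n L R = {(x, y). x div L = y div L \<and> x div L < n \<and> (x mod L, y mod L) \<in> R}"

lemma copies_Suc:
  assumes V: "V \<subseteq> {..<L}" and R: "R \<subseteq> V \<times> V"
  shows "copies_verts (Suc n) L V = copies_verts n L V \<union> (+) (n * L) ` V"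
    and "copies_rel (Suc n) L R = copies_rel n L R \<union> shift_rel (n * L) R"
    and "copies_verts n L V \<inter> (+) (n * L) ` V = {}"
    and "(+) (n * L) ` V = {x \<in> copies_verts (Suc n) L V. x div L = n}"
proof -
  have lt: "i < L" if "i \<in> V" for i using V that by auto
  have dm: "(n * L + i) div L = n" "(n * L + i) mod L = i" if "i \<in> V" for i
  proof -
    have "L \<noteq> 0" using lt[OF that] by simp
    then show "(n * L + i) div L = n" "(n * L + i) mod L = i" using lt[OF that] by simp_all
  qed
  have im: "(+) (n * L) ` V = {x. x div L = n \<and> x mod L \<in> V}"
  proof (intro equalityI subsetI)
    fix x assume "x \<in> {x. x div L = n \<and> x mod L \<in> V}"
    then show "x \<in> (+) (n * L) ` V"
      by (intro image_eqI[of _ _ "x mod L"]) (auto simp: mult.commute)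
  qed (use dm in auto)
  then show "copies_verts (Suc n) L V = copies_verts n L V \<union> (+) (n * L) ` V"
    "copies_verts n L V \<inter> (+) (n * L) ` V = {}"
    "(+) (n * L) ` V = {x \<in> copies_verts (Suc n) L V. x div L = n}"
    by (auto simp: copies_verts_def less_Suc_eq)
  have "shift_rel (n * L) R = {(x, y). x div L = n \<and> y div L = n \<and> (x mod L, y mod L) \<in> R}"
  proof (intro equalityI subsetI)
    fix z assume "z \<in> {(x, y). x div L = n \<and> y div L = n \<and> (x mod L, y mod L) \<in> R}"
    then obtain x y where z: "z = (x, y)" "x div L = n" "y div L = n" "(x mod L, y mod L) \<in> R"
      by auto
    have "x = n * L + x mod L" "y = n * L + y mod L"
      using z(2,3) div_mult_mod_eq[of x L] div_mult_mod_eq[of y L] by auto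
    then show "z \<in> shift_rel (n * L) R" using z(1,4) in_shift_rel_iff[of "n * L"] by metis
  qed (use dm R in \<open>fastforce simp: shift_rel_def\<close>)
  then show "copies_rel (Suc n) L R = copies_rel n L R \<union> shift_rel (n * L) R"
    by (auto simp: copies_rel_def less_Suc_eq)
qed

lemma distance_graph_copies:
  assumes "distance_graph D V R" "V \<subseteq> {..<L}"
  shows "distance_graph D (copies_verts n L V) (copies_rel n L R)"
proof (induction n)
  case 0
  then show ?case
    by (simp add: distance_graph_def copies_verts_def copies_rel_def sym_def irrefl_def)
next
  case (Suc n)
  have R: "R \<subseteq> V \<times> V" using assms(1) by (simp add: distance_graph_def)
  show ?case
    unfolding copies_Suc(1,2)[OF assms(2) R]
    by (rule distance_graph_Un[OF Suc distance_graph_shift[OF assms(1)]])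
qed

lemma bij_betw_involution:
  assumes "\<And>x. x \<in> V \<Longrightarrow> f x \<in> V" "\<And>x. x \<in> V \<Longrightarrow> f (f x) = x"
  shows "bij_betw f V V"
  by (rule bij_betw_byWitness[of _ f]) (use assms in auto)

text \<open>Exchanging two copies is an automorphism, so \<open>tp_remove_copy\<close> deletes the
  last one. Copies are counted as distinct sets of vertices, hence the separate treatment of the
  empty graph.\<close>

lemma tp_copies_Suc:
  assumes "distance_graph D V R" "V \<subseteq> {..<L}" "k < Suc n"
  shows "tp k (copies_verts (Suc n) L V) (copies_rel (Suc n) L R) [] =
    tp k (copies_verts n L V) (copies_rel n L R) []"
proof (cases "V = {}")
  case True
  then have "R = {}" using assms(1) by (auto simp: distance_graph_def)
  with True show ?thesis by (simp add: copies_verts_def copies_rel_def)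
next
  case False
  then have L: "L > 0" using assms(2) by auto
  have R: "R \<subseteq> V \<times> V" using assms(1) by (simp add: distance_graph_def)
  let ?V = "copies_verts (Suc n) L V" and ?R = "copies_rel (Suc n) L R"
  define B where "B i = {x \<in> ?V. x div L = i}" for i
  have mem: "i * L + v \<in> B i" if "i \<le> n" "v \<in> V" for i v
    using that assms(2) by (auto simp: B_def copies_verts_def)
  have neB: "B i \<noteq> {}" if "i \<le> n" for i using mem[OF that] False by blast
  have inj: "inj_on B {..n}"
    using neB by (intro inj_onI) (auto simp: B_def)
  have "tp k ?V ?R [] = tp k (?V - B n) ?R []"
  proof (rule tp_remove_copy[where \<C> = "B ` {..n}"])
    show "finite ?V" using distance_graph_copies[OF assms(1,2)] by (simp add: distance_graph_def)
    show "k < card (B ` {..n})" using assms(3) card_image[OF inj] by simp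
    show "disjoint (B ` {..n})" by (auto simp: disjoint_def B_def)
    fix C E assume "C \<in> B ` {..n}" "E \<in> B ` {..n}" "C \<noteq> E"
    then obtain i j where ij: "i \<le> n" "j \<le> n" "i \<noteq> j" "C = B i" "E = B j" by auto
    define f where "f x = (if x div L = i then j * L + x mod L
      else if x div L = j then i * L + x mod L else x)" for x
    have f_div: "f x div L = (if x div L = i then j else if x div L = j then i else x div L)"
      and f_mod: "f x mod L = x mod L" for x
      using L by (auto simp: f_def)
    have f_V: "f x \<in> ?V" if "x \<in> ?V" for x
      using that ij by (auto simp: copies_verts_def f_div f_mod)
    have f_f: "f (f x) = x" for x
    proof -
      have "f (f x) div L = x div L" "f (f x) mod L = x mod L" by (auto simp: f_div f_mod)
      then show ?thesis by (metis div_mult_mod_eq)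
    qed
    show "\<exists>f. bij_betw f ?V ?V \<and> (\<forall>u\<in>?V. \<forall>v\<in>?V. (f u, f v) \<in> ?R \<longleftrightarrow> (u, v) \<in> ?R) \<and>
        f ` C \<subseteq> E \<and> (\<forall>x\<in>?V - C - E. f x = x)"
    proof (intro exI[of _ f] conjI ballI)
      show "bij_betw f ?V ?V" by (rule bij_betw_involution) (use f_V f_f in auto)
      show "(f u, f v) \<in> ?R \<longleftrightarrow> (u, v) \<in> ?R" if "u \<in> ?V" "v \<in> ?V" for u v
        using ij by (auto simp: copies_rel_def f_div f_mod split: if_splits)
      show "f ` C \<subseteq> E" using f_V by (auto simp: ij B_def f_div)
      show "f x = x" if "x \<in> ?V - C - E" for x using that by (auto simp: ij B_def f_def)
    qed
  qed (auto simp: B_def)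
  also have "?V - B n = copies_verts n L V"
    by (auto simp: B_def copies_verts_def)
  also have "tp k (copies_verts n L V) ?R [] = tp k (copies_verts n L V) (copies_rel n L R) []"
    using tp_Nil_image[of id "copies_verts n L V" ?R "copies_rel n L R" k]
    by (auto simp: copies_verts_def copies_rel_def)
  finally show ?thesis .
qed

text \<open>The witness is the type of \<open>k\<close> copies of a representative of
  \<open>d\<close>: at rank \<open>k\<close>, \<open>k\<close> copies and \<open>k + 1\<close>
  copies look alike.\<close>

lemma join_copies_absorb:
  assumes "d \<in> classes D k"
  obtains b where "b \<in> classes D k" "join D k b d = b"
proof -
  obtain V R where VR: "distance_graph D V R" "tp k V R [] = d"
    using assms by (auto simp: classes_def)
  have R: "R \<subseteq> V \<times> V" using VR by (simp add: distance_graph_def)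
  obtain L where L: "V \<subseteq> {..<L}" using VR finite_nat_iff_bounded by (auto simp: distance_graph_def)
  let ?b = "tp k (copies_verts k L V) (copies_rel k L R) []"
  have "join D k ?b d =
      join D k ?b (tp k ((+) (k * L) ` V) (shift_rel (k * L) R) [])"
    by (simp add: VR tp_shift)
  also have "\<dots> = tp k (copies_verts (Suc k) L V) (copies_rel (Suc k) L R) []"
    unfolding copies_Suc(1,2)[OF L R]
    by (rule join_tp[OF distance_graph_copies[OF VR(1) L] distance_graph_shift[OF VR(1)]])
      (rule copies_Suc(3)[OF L R])
  also have "\<dots> = ?b" by (rule tp_copies_Suc[OF VR(1) L]) simp
  finally have "join D k ?b d = ?b" .
  moreover have "?b \<in> classes D k"
    using distance_graph_copies[OF VR(1) L] by (auto simp: classes_def)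
  ultimately show thesis using that by blast
qed

text \<open>The types of \<open>k\<close>-fold copies absorb one more copy, so the product of these over all types is a
  zero of the finite commutative monoid of types under disjoint union.\<close>

lemma join_zero:
  "\<exists>z\<in>classes D k. \<forall>d\<in>classes D k. join D k z d = z"
proof -
  have "\<exists>z\<in>classes D k. \<forall>d\<in>F. join D k z d = z" if "F \<subseteq> classes D k" "finite F" for F
    using that(2,1)
  proof induction
    case empty
    have "tp k ({} :: nat set) {} [] \<in> classes D k"
      unfolding classes_def by (auto intro!: exI[of _ "{}"] simp: distance_graph_def sym_def irrefl_def)
    then show ?case by auto
  next
    case (insert d F)
    then obtain z where z: "z \<in> classes D k" "\<forall>e\<in>F. join D k z e = z" by auto
    obtain b where b: "b \<in> classes D k" "join D k b d = b"
      using insert.prems by (auto elim: join_copies_absorb)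
    have "join D k (join D k z b) e = join D k z b" if e: "e \<in> insert d F" for e
    proof (cases "e = d")
      case True
      then show ?thesis using join_assoc[of z D k b d] z b insert.prems by simp
    next
      case False
      then have "e \<in> F" "e \<in> classes D k" using e insert.prems by auto
      then show ?thesis
        using join_assoc[of z D k b e] join_assoc[of z D k e b] join_commute[of b D k e] z b by simp
    qed
    then show ?case using join_closed[OF z(1) b(1)] by auto
  qed
  from this[OF order_refl finite_classes] show ?thesis .
qed

text \<open>\<open>H\<close> represents the zero. The shift \<open>a\<close> is left free because
  the place where a copy of \<open>H\<close> appears in the random graph is itself random.\<close>

lemma universal_distance_graph:
  obtains H T where "distance_graph D H T"
    "\<And>a V R. distance_graph D V R \<Longrightarrow> (+) a ` H \<inter> V = {} \<Longrightarrow>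
      tp k ((+) a ` H \<union> V) (shift_rel a T \<union> R) [] = tp k H T []"
proof -
  obtain z where z: "z \<in> classes D k" "\<forall>d\<in>classes D k. join D k z d = z" using join_zero by blast
  then obtain H T where H: "distance_graph D H T" "z = tp k H T []" by (auto simp: classes_def)
  have "tp k ((+) a ` H \<union> V) (shift_rel a T \<union> R) [] = tp k H T []"
    if V: "distance_graph D V R" "(+) a ` H \<inter> V = {}" for a V R
  proof -
    have "tp k V R [] \<in> classes D k" using V by (auto simp: classes_def)
    then have "join D k (tp k H T []) (tp k V R []) = tp k H T []" using z H by auto
    then show ?thesis
      using join_tp[OF distance_graph_shift[OF H(1), of a] V, of k] by (simp add: tp_shift)
  qed
  then show thesis using that H(1) by blast
qed

section \<open>Isolated copies in the random graph\<close>

lemma prob_Pi_pmf_cylinder: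
  assumes "finite A" "T \<subseteq> A" "\<And>e. e \<in> A \<Longrightarrow> 0 \<le> w e \<and> w e \<le> 1"
  shows "measure_pmf.prob (Pi_pmf A False (\<lambda>e. bernoulli_pmf (w e))) {c. \<forall>e\<in>T. c e = h e} =
    (\<Prod>e\<in>T. if h e then w e else 1 - w e)"
proof -
  let ?M = "Pi_pmf A False (\<lambda>e. bernoulli_pmf (w e))"
  have "measure_pmf.prob ?M {c. \<forall>e\<in>T. c e = h e} =
      measure_pmf.prob ?M (Pi A (\<lambda>e. if e \<in> T then {h e} else UNIV))"
    using assms(2) by (intro arg_cong[where f = "measure_pmf.prob ?M"]) (auto simp: Pi_def)
  also have "\<dots> = (\<Prod>e\<in>A. measure_pmf.prob (bernoulli_pmf (w e)) (if e \<in> T then {h e} else UNIV))"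
    by (rule measure_Pi_pmf_Pi[OF assms(1)])
  also have "\<dots> = (\<Prod>e\<in>A. if e \<in> T then (if h e then w e else 1 - w e) else 1)"
    by (intro prod.cong refl) (use assms(3) in \<open>auto simp: measure_pmf_single\<close>)
  also have "\<dots> = (\<Prod>e\<in>T. if h e then w e else 1 - w e)"
    using assms(1,2) by (simp add: prod.If_cases Int_absorb1)
  finally show ?thesis .
qed

text \<open>Adding one more set to be avoided turns the event into a difference of two events of the
  same shape, the second with that set adjoined to \<open>U\<close>. The induction therefore needs
  \<open>U\<close> arbitrary.\<close>

lemma prob_Pi_pmf_cylinder_avoid:
  assumes "finite A" "\<And>e. e \<in> A \<Longrightarrow> 0 \<le> w e \<and> w e \<le> 1"
    and "finite S" "U \<subseteq> A" "\<And>s. s \<in> S \<Longrightarrow> T s \<subseteq> A" "disjoint_family_on T S"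
    and "\<And>s. s \<in> S \<Longrightarrow> T s \<inter> U = {}"
  shows "measure_pmf.prob (Pi_pmf A False (\<lambda>e. bernoulli_pmf (w e)))
      {c. (\<forall>e\<in>U. c e = h e) \<and> (\<forall>s\<in>S. \<exists>e\<in>T s. c e \<noteq> h e)} =
    (\<Prod>e\<in>U. if h e then w e else 1 - w e) * (\<Prod>s\<in>S. 1 - (\<Prod>e\<in>T s. if h e then w e else 1 - w e))"
  using assms(3-)
proof (induction S arbitrary: U)
  case empty
  then show ?case using prob_Pi_pmf_cylinder[OF assms(1) _ assms(2), where T = U] by simp
next
  case (insert s S)
  let ?M = "Pi_pmf A False (\<lambda>e. bernoulli_pmf (w e))" and ?v = "\<lambda>e. if h e then w e else 1 - w e"
  let ?E = "\<lambda>U S. {c. (\<forall>e\<in>U. c e = h e) \<and> (\<forall>s\<in>S. \<exists>e\<in>T s. c e \<noteq> h e)}"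
  have fin: "finite U" "finite (T s)"
    using insert.prems(1,2) assms(1) finite_subset by (blast, metis insertI1 finite_subset)
  have disj: "T s \<inter> T t = {}" if "t \<in> S" for t
    using disjoint_family_onD[OF insert.prems(3)] insert.hyps(2) that by (metis insertCI)
  have "measure_pmf.prob ?M (?E U (insert s S)) = measure_pmf.prob ?M (?E U S - ?E (U \<union> T s) S)"
    by (intro arg_cong[where f = "measure_pmf.prob ?M"]) auto
  also have "\<dots> = measure_pmf.prob ?M (?E U S) - measure_pmf.prob ?M (?E (U \<union> T s) S)"
    by (intro measure_pmf.finite_measure_Diff) auto
  also have "measure_pmf.prob ?M (?E U S) = prod ?v U * (\<Prod>s\<in>S. 1 - prod ?v (T s))"
    using insert.prems by (intro insert.IH) (auto intro: disjoint_family_on_mono)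
  also have "measure_pmf.prob ?M (?E (U \<union> T s) S) =
      prod ?v (U \<union> T s) * (\<Prod>s\<in>S. 1 - prod ?v (T s))"
  proof (intro insert.IH)
    fix t assume "t \<in> S"
    then show "T t \<inter> (U \<union> T s) = {}" "T t \<subseteq> A" using disj[of t] insert.prems(2,4) by blast+
  qed (use insert.prems in \<open>auto intro: disjoint_family_on_mono\<close>)
  also have "prod ?v (U \<union> T s) = prod ?v U * prod ?v (T s)"
    using fin insert.prems(4) by (intro prod.union_disjoint) auto
  finally show ?case using insert.hyps by (simp add: algebra_simps)
qed

lemma prob_mono_support:
  assumes "\<And>c. c \<in> set_pmf M \<Longrightarrow> c \<in> A \<Longrightarrow> c \<in> B"
  shows "measure_pmf.prob M A \<le> measure_pmf.prob M B"
proof -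
  have "measure_pmf.prob M (A \<inter> set_pmf M) \<le> measure_pmf.prob M B"
    by (rule measure_pmf.finite_measure_mono) (use assms in auto)
  then show ?thesis by (simp add: measure_Int_set_pmf)
qed

section \<open>The random graph as a family of coins\<close>

definition vpairs :: "nat \<Rightarrow> (nat \<times> nat) set" where
  "vpairs n = {(i, j). 1 \<le> i \<and> i < j \<and> j \<le> n}"

definition coins :: "(nat \<Rightarrow> real) \<Rightarrow> nat \<Rightarrow> (nat \<times> nat \<Rightarrow> bool) pmf" where
  "coins p n = Pi_pmf (vpairs n) False (\<lambda>e. bernoulli_pmf (p (snd e - fst e)))"

definition coin_rel :: "(nat \<times> nat \<Rightarrow> bool) \<Rightarrow> nat rel" where
  "coin_rel c = {(i, j). c (i, j) \<or> c (j, i)}"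

lemma finite_vpairs [simp]: "finite (vpairs n)"
  by (rule finite_subset[of _ "{1..n} \<times> {1..n}"]) (auto simp: vpairs_def)

lemma random_graph_eq: "random_graph p n = map_pmf coin_rel (coins p n)"
  unfolding random_graph_def coins_def vpairs_def coin_rel_def
  by (simp add: case_prod_beta')

lemma prob_models_eq: "prob_models p \<psi> n = measure_pmf.prob (coins p n) {c. models {1..n} (coin_rel c) \<psi>}"
  by (simp add: prob_models_def random_graph_eq vimage_def)

text \<open>Lets the deterministic arguments ignore sample points of probability zero, such as those
  with a head outside \<open>vpairs n\<close>.\<close>

lemma coins_support:
  assumes "c \<in> set_pmf (coins p n)" "c (i, j)" "\<And>l. l \<ge> 1 \<Longrightarrow> 0 \<le> p l \<and> p l \<le> 1"
  shows "(i, j) \<in> vpairs n" "0 < p (j - i)"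
proof -
  have c: "c \<in> PiE_dflt (vpairs n) False (\<lambda>e. set_pmf (bernoulli_pmf (p (snd e - fst e))))"
    using assms(1) set_Pi_pmf_subset[OF finite_vpairs] unfolding coins_def by (auto simp: o_def set_Pi_pmf)
  show ij: "(i, j) \<in> vpairs n" using c assms(2) by (auto simp: PiE_dflt_def)
  then have "c (i, j) \<in> set_pmf (bernoulli_pmf (p (j - i)))"
    using c by (force simp: PiE_dflt_def)
  moreover have "0 \<le> p (j - i)" "p (j - i) \<le> 1" using assms(3)[of "j - i"] ij by (auto simp: vpairs_def)
  ultimately show "0 < p (j - i)"
    using assms(2) by (cases "p (j - i) = 0") (auto simp: set_pmf_iff)
qed

lemma distance_graph_coin_rel:
  assumes "c \<in> set_pmf (coins p n)" "\<And>l. l \<ge> 1 \<Longrightarrow> 0 \<le> p l \<and> p l \<le> 1"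
  shows "distance_graph {l. l \<ge> 1 \<and> p l > 0} {1..n} (coin_rel c)"
  using coins_support[OF assms(1) _ assms(2)]
  unfolding distance_graph_def coin_rel_def sym_def irrefl_def vpairs_def by fastforce

lemma prob_coins_cylinder:
  assumes "T \<subseteq> vpairs n" "\<And>l. l \<ge> 1 \<Longrightarrow> 0 \<le> p l \<and> p l \<le> 1"
  shows "measure_pmf.prob (coins p n) {c. \<forall>e\<in>T. c e = h e} =
    (\<Prod>e\<in>T. if h e then p (snd e - fst e) else 1 - p (snd e - fst e))"
  unfolding coins_def
  by (rule prob_Pi_pmf_cylinder[OF finite_vpairs assms(1)]) (use assms(2) in \<open>auto simp: vpairs_def\<close>)

text \<open>The pattern \<open>T\<close> lives on \<open>{1..m}\<close>. Since \<open>j\<close>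
  ranges over all vertices, the condition also forbids every edge leaving the block.\<close>

definition isolated_copy :: "nat \<Rightarrow> nat rel \<Rightarrow> nat \<Rightarrow> nat rel \<Rightarrow> nat \<Rightarrow> bool" where
  "isolated_copy m T n R a \<longleftrightarrow> a + m \<le> n \<and>
    (\<forall>i\<in>{a + 1..a + m}. \<forall>j\<in>{1..n}. (i, j) \<in> R \<longleftrightarrow> (i, j) \<in> shift_rel a T)"

lemma prod_mono_subset:
  fixes f :: "'b \<Rightarrow> real"
  assumes "finite B" "A \<subseteq> B" "\<And>x. x \<in> B \<Longrightarrow> 0 \<le> f x \<and> f x \<le> 1"
  shows "prod f B \<le> prod f A"
proof -
  have "prod f B = prod f A * prod f (B - A)"
    using prod.subset_diff[OF assms(2,1), of f] by (simp add: mult.commute)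
  also have "\<dots> \<le> prod f A * 1"
    using assms(2,3) by (intro mult_left_mono prod_le_1 prod_nonneg) auto
  finally show ?thesis by simp
qed

text \<open>Consider \<open>r\<close> blocks of \<open>m\<close> consecutive vertices with spacing \<open>b\<close>. Unless there is an edge between
  two blocks (first summand), it suffices that some block looks right to itself and to the vertices
  outside all blocks, and these events are independent.\<close>

lemma isolated_copy_prob_blocks:
  fixes p :: "nat \<Rightarrow> real"
  assumes p: "\<And>l. l \<ge> 1 \<Longrightarrow> 0 \<le> p l \<and> p l < 1"
    and T: "distance_graph {l. l \<ge> 1 \<and> p l > 0} {1..m} T"
    and b: "m \<le> b" "r * b \<le> n"
  shows "measure_pmf.prob (coins p n) {c. \<nexists>a. isolated_copy m T n (coin_rel c) a} \<le>
    (\<Sum>s<r. \<Sum>t\<in>{s<..<r}. \<Sum>i=1..m. \<Sum>j=1..m. p ((t * b + j) - (s * b + i))) +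
    (1 - (\<Prod>(i, j)\<in>vpairs m. if (i, j) \<in> T then p (j - i) else 1 - p (j - i)) *
      (\<Prod>l=1..n. 1 - p l) ^ (2 * m)) ^ r"
proof -
  let ?M = "coins p n"
  define I where "I s = {s * b + 1..s * b + m}" for s
  define J where "J = (\<Union>s<r. I s)"
  define h where "h e \<longleftrightarrow> (\<exists>s<r. fst e \<in> I s \<and> snd e \<in> I s \<and> e \<in> shift_rel (s * b) T)" for e
  \<comment> \<open>\<open>C s\<close>, \<open>O1 s\<close> and \<open>O2 s\<close> hold the pairs
    inside block \<open>s\<close> and those joining it to vertices outside all blocks, on the right
    and on the left; they are disjoint for different \<open>s\<close>. \<open>X\<close> holds the
    pairs joining two blocks, which are left to a union bound.\<close>
  define C where "C s = {(i, j). (i, j) \<in> vpairs n \<and> i \<in> I s \<and> j \<in> I s}" for s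
  define O1 where "O1 s = {(i, j). (i, j) \<in> vpairs n \<and> i \<in> I s \<and> j \<notin> J}" for s
  define O2 where "O2 s = {(i, j). (i, j) \<in> vpairs n \<and> i \<notin> J \<and> j \<in> I s}" for s
  define X where "X = {(i, j). (i, j) \<in> vpairs n \<and> (\<exists>s t. s < t \<and> t < r \<and> i \<in> I s \<and> j \<in> I t)}"
  let ?v = "\<lambda>e. if h e then p (snd e - fst e) else 1 - p (snd e - fst e)"
  let ?c = "\<Prod>(i, j)\<in>vpairs m. if (i, j) \<in> T then p (j - i) else 1 - p (j - i)"
  let ?P = "\<Prod>l=1..n. 1 - p l"
  have I_le: "i < j" if "i \<in> I s" "j \<in> I t" "s < t" for i j s t
  proof -
    have "s * b + b \<le> t * b" using mult_le_mono1[of "Suc s" t b] that(3) by simp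
    then show ?thesis using that b(1) by (auto simp: I_def)
  qed
  have I_disj: "s = t" if "i \<in> I s" "i \<in> I t" for i s t
    using I_le[of i s i t] I_le[of i t i s] that by (metis less_irrefl linorder_neqE_nat)
  have I_n: "I s \<subseteq> {1..n}" if "s < r" for s
  proof -
    have "s * b + b \<le> r * b" using mult_le_mono1[of "Suc s" r b] that by simp
    then show ?thesis using b by (auto simp: I_def)
  qed
  have J: "I s \<subseteq> J" if "s < r" for s using that by (auto simp: J_def)
  have p01: "l \<ge> 1 \<Longrightarrow> 0 \<le> p l \<and> p l \<le> 1" for l using p[of l] by simp
  have v01: "0 \<le> ?v e \<and> ?v e \<le> 1" if "e \<in> vpairs n" for e
    using that p01[of "snd e - fst e"] by (auto simp: vpairs_def)
  have h_in: "h (i, j) \<longleftrightarrow> (i, j) \<in> shift_rel (s * b) T" if "s < r" "i \<in> I s" "j \<in> I s" for i j s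
    using that I_disj unfolding h_def by auto
  have h_out: "\<not> h (i, j)" if "i \<notin> J \<or> j \<notin> J" for i j
    using that unfolding h_def J_def by auto
  have copy: "\<exists>a. isolated_copy m T n (coin_rel c) a"
    if c: "c \<in> set_pmf ?M" and cX: "\<forall>e\<in>X. \<not> c e" and s: "s < r"
      and cs: "\<forall>e\<in>C s \<union> O1 s \<union> O2 s. c e = h e" for c s
  proof -
    have symT: "(i, j) \<in> shift_rel (s * b) T \<longleftrightarrow> (j, i) \<in> shift_rel (s * b) T" for i j
      using T unfolding distance_graph_def sym_def shift_rel_def by auto
    have shift_in: "i \<in> I s \<and> j \<in> I s" if "(i, j) \<in> shift_rel (s * b) T" for i j
      using that T unfolding distance_graph_def shift_rel_def I_def by auto
    have c0: "\<not> c e" if "e \<notin> vpairs n" for e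
      using coins_support(1)[OF c, of "fst e" "snd e"] p01 that by auto
    have key: "c (i, j) \<longleftrightarrow> (i, j) \<in> shift_rel (s * b) T"
      if ij: "(i, j) \<in> vpairs n" "i \<in> I s \<or> j \<in> I s" for i j
    proof (cases "i \<in> I s \<and> j \<in> I s")
      case True
      then have "(i, j) \<in> C s" using ij by (simp add: C_def)
      then show ?thesis using cs h_in[OF s] True by auto
    next
      case False
      then have ns: "(i, j) \<notin> shift_rel (s * b) T" using shift_in by blast
      have "\<not> c (i, j)"
      proof (cases "i \<in> J \<and> j \<in> J")
        case True
        then obtain t u where tu: "t < r" "u < r" "i \<in> I t" "j \<in> I u" by (auto simp: J_def)
        have "t \<noteq> u" using tu False ij(2) I_disj by metis
        moreover have "\<not> u < t" using I_le[OF tu(4,3)] ij(1) by (auto simp: vpairs_def)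
        ultimately have "t < u" by linarith
        then have "(i, j) \<in> X" unfolding X_def using tu ij(1) by blast
        then show ?thesis using cX by auto
      next
        case out: False
        then have "(i, j) \<in> O1 s \<union> O2 s" using ij J[OF s] by (auto simp: O1_def O2_def)
        then show ?thesis using cs h_out out by blast
      qed
      with ns show ?thesis by simp
    qed
    have "isolated_copy m T n (coin_rel c) (s * b)"
      unfolding isolated_copy_def
    proof (intro conjI ballI)
      have "s * b + b \<le> r * b" using mult_le_mono1[of "Suc s" r b] s by simp
      then show "s * b + m \<le> n" using b by simp
      fix i j assume i: "i \<in> {s * b + 1..s * b + m}" and j: "j \<in> {1..n}"
      then have iI: "i \<in> I s" by (simp add: I_def)
      then have "i \<in> {1..n}" using I_n[OF s] by auto
      consider "i < j" | "j < i" | "i = j" by linarith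
      then show "(i, j) \<in> coin_rel c \<longleftrightarrow> (i, j) \<in> shift_rel (s * b) T"
      proof cases
        case 1
        then have "(i, j) \<in> vpairs n" "(j, i) \<notin> vpairs n" using j \<open>i \<in> {1..n}\<close> by (auto simp: vpairs_def)
        then show ?thesis using key[of i j] c0 iI by (auto simp: coin_rel_def)
      next
        case 2
        then have "(j, i) \<in> vpairs n" "(i, j) \<notin> vpairs n" using j \<open>i \<in> {1..n}\<close> by (auto simp: vpairs_def)
        then show ?thesis using key[of j i] c0 iI symT by (auto simp: coin_rel_def)
      next
        case 3
        have "(i, i) \<notin> shift_rel (s * b) T"
          using T unfolding distance_graph_def irrefl_def shift_rel_def by auto
        then show ?thesis using c0[of "(i, i)"] 3 by (auto simp: coin_rel_def vpairs_def)
      qed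
    qed
    then show ?thesis by blast
  qed
  let ?X = "{c. \<exists>e\<in>X. c e}"
    and ?N = "{c. (\<forall>e\<in>{}. c e = h e) \<and> (\<forall>s\<in>{..<r}. \<exists>e\<in>C s \<union> O1 s \<union> O2 s. c e \<noteq> h e)}"
  have "measure_pmf.prob ?M {c. \<nexists>a. isolated_copy m T n (coin_rel c) a} \<le> measure_pmf.prob ?M (?X \<union> ?N)"
    by (rule prob_mono_support) (use copy in blast)
  also have "\<dots> \<le> measure_pmf.prob ?M ?X + measure_pmf.prob ?M ?N"
    by (rule measure_Un_le) auto
  finally have "measure_pmf.prob ?M {c. \<nexists>a. isolated_copy m T n (coin_rel c) a} \<le>
    measure_pmf.prob ?M ?X + measure_pmf.prob ?M ?N" .
  moreover have "measure_pmf.prob ?M ?X \<le>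
    (\<Sum>s<r. \<Sum>t\<in>{s<..<r}. \<Sum>i=1..m. \<Sum>j=1..m. p ((t * b + j) - (s * b + i)))"
  proof -
    have finX: "finite X" by (rule finite_subset[OF _ finite_vpairs[of n]]) (auto simp: X_def)
    have "?X = (\<Union>e\<in>X. {c. c e})" by auto
    then have "measure_pmf.prob ?M ?X \<le> (\<Sum>e\<in>X. measure_pmf.prob ?M {c. c e})"
      using measure_pmf.finite_measure_subadditive_finite[OF finX, of "\<lambda>e. {c. c e}" ?M] by simp
    also have "\<dots> = (\<Sum>e\<in>X. p (snd e - fst e))"
    proof (rule sum.cong)
      fix e assume "e \<in> X"
      then have "{e} \<subseteq> vpairs n" by (auto simp: X_def)
      from prob_coins_cylinder[OF this, of p "\<lambda>_. True"] p01
      show "measure_pmf.prob ?M {c. c e} = p (snd e - fst e)" by simp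
    qed simp
    also have "\<dots> \<le> (\<Sum>e\<in>(\<lambda>(s, t, i, j). (s * b + i, t * b + j)) `
        (SIGMA s:{..<r}. SIGMA t:{s<..<r}. {1..m} \<times> {1..m}). p (snd e - fst e))"
    proof (rule sum_mono2)
      show "X \<subseteq> (\<lambda>(s, t, i, j). (s * b + i, t * b + j)) `
        (SIGMA s:{..<r}. SIGMA t:{s<..<r}. {1..m} \<times> {1..m})"
      proof
        fix e assume "e \<in> X"
        then obtain s t i j where e: "e = (i, j)" "s < t" "t < r" "i \<in> I s" "j \<in> I t"
          by (auto simp: X_def)
        then have "e = (\<lambda>(s, t, i, j). (s * b + i, t * b + j)) (s, t, i - s * b, j - t * b)"
          "(s, t, i - s * b, j - t * b) \<in> (SIGMA s:{..<r}. SIGMA t:{s<..<r}. {1..m} \<times> {1..m})"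
          by (auto simp: I_def)
        then show "e \<in> (\<lambda>(s, t, i, j). (s * b + i, t * b + j)) `
          (SIGMA s:{..<r}. SIGMA t:{s<..<r}. {1..m} \<times> {1..m})" by (rule image_eqI)
      qed
      fix e assume "e \<in> (\<lambda>(s, t, i, j). (s * b + i, t * b + j)) `
        (SIGMA s:{..<r}. SIGMA t:{s<..<r}. {1..m} \<times> {1..m}) - X"
      then obtain s t i j where e: "e = (s * b + i, t * b + j)" "s < t" "i \<in> {1..m}" "j \<in> {1..m}"
        by auto
      have "s * b + i < t * b + j"
        by (rule I_le[OF _ _ e(2)]) (use e in \<open>auto simp: I_def\<close>)
      then show "0 \<le> p (snd e - fst e)" using p01[of "snd e - fst e"] e by auto
    qed auto
    also have "\<dots> \<le> (\<Sum>(s, t, i, j)\<in>(SIGMA s:{..<r}. SIGMA t:{s<..<r}. {1..m} \<times> {1..m}).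
        p ((t * b + j) - (s * b + i)))"
    proof -
      have "sum (\<lambda>e. p (snd e - fst e)) (f ` S) \<le> sum ((\<lambda>e. p (snd e - fst e)) \<circ> f) S"
        if "finite S" "\<And>x. x \<in> S \<Longrightarrow> 0 \<le> p (snd (f x) - fst (f x))" for f and S :: "(nat \<times> nat \<times> nat \<times> nat) set"
        using that by (intro sum_image_le) (auto simp: o_def)
      note * = this[where f = "\<lambda>(s, t, i, j). (s * b + i, t * b + j)"]
      show ?thesis
      proof (rule order_trans[OF *])
        fix x assume "x \<in> (SIGMA s:{..<r}. SIGMA t:{s<..<r}. {1..m} \<times> {1..m})"
        then obtain s t i j where e: "x = (s, t, i, j)" "s < t" "i \<in> {1..m}" "j \<in> {1..m}" by auto
        have "s * b + i < t * b + j"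
          by (rule I_le[OF _ _ e(2)]) (use e in \<open>auto simp: I_def\<close>)
        then show "0 \<le> p (snd (case x of (s, t, i, j) \<Rightarrow> (s * b + i, t * b + j)) -
            fst (case x of (s, t, i, j) \<Rightarrow> (s * b + i, t * b + j)))"
          using p01[of "(t * b + j) - (s * b + i)"] e by auto
      qed (auto simp: o_def case_prod_beta')
    qed
    also have "\<dots> = (\<Sum>s<r. \<Sum>t\<in>{s<..<r}. \<Sum>i=1..m. \<Sum>j=1..m. p ((t * b + j) - (s * b + i)))"
      by (simp add: sum.cartesian_product sum.Sigma)
    finally show ?thesis .
  qed
  moreover have "measure_pmf.prob ?M ?N \<le> (1 - ?c * ?P ^ (2 * m)) ^ r"
  proof -
    let ?T = "\<lambda>s. C s \<union> O1 s \<union> O2 s"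
    have T_sub: "?T s \<subseteq> vpairs n" for s by (auto simp: C_def O1_def O2_def)
    have "measure_pmf.prob ?M ?N = (\<Prod>s<r. 1 - prod ?v (?T s))"
      unfolding coins_def
    proof (subst prob_Pi_pmf_cylinder_avoid[OF finite_vpairs])
      show "disjoint_family_on ?T {..<r}"
        unfolding disjoint_family_on_def
      proof (intro ballI impI)
        fix s t assume "s \<in> {..<r}" "t \<in> {..<r}" "s \<noteq> t"
        then show "?T s \<inter> ?T t = {}"
          using I_disj J[of s] J[of t] by (auto simp: C_def O1_def O2_def)
      qed
    qed (use T_sub p01 in \<open>auto simp: vpairs_def\<close>)
    also have "\<dots> \<le> (\<Prod>s<r. 1 - ?c * ?P ^ (2 * m))"
    proof (rule prod_mono, intro conjI)
      fix s assume "s \<in> {..<r}"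
      then have s: "s < r" by simp
      have "prod ?v (?T s) \<le> 1" using T_sub[of s] v01 by (intro prod_le_1) blast
      then show "0 \<le> 1 - prod ?v (?T s)" by simp
      have fin: "finite (C s)" "finite (O1 s)" "finite (O2 s)"
        using T_sub[of s] finite_subset[OF _ finite_vpairs[of n]] by auto
      have eq: "prod ?v (?T s) = prod ?v (C s) * prod ?v (O1 s) * prod ?v (O2 s)"
        using J[OF s] fin by (subst prod.union_disjoint, (auto simp: C_def O1_def O2_def)[3])+ simp
      have C: "prod ?v (C s) = ?c"
      proof -
        have "C s = (\<lambda>(i, j). (s * b + i, s * b + j)) ` vpairs m"
        proof (intro equalityI subsetI)
          fix e assume "e \<in> C s"
          then have "e = (\<lambda>(i, j). (s * b + i, s * b + j)) (fst e - s * b, snd e - s * b)"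
            "(fst e - s * b, snd e - s * b) \<in> vpairs m"
            by (auto simp: C_def I_def vpairs_def)
          then show "e \<in> (\<lambda>(i, j). (s * b + i, s * b + j)) ` vpairs m" by (rule image_eqI)
        next
          fix e assume "e \<in> (\<lambda>(i, j). (s * b + i, s * b + j)) ` vpairs m"
          then obtain i j where e: "e = (s * b + i, s * b + j)" "1 \<le> i" "i < j" "j \<le> m"
            by (auto simp: vpairs_def)
          then have "s * b + i \<in> I s" "s * b + j \<in> I s" by (auto simp: I_def)
          moreover have "s * b + j \<le> n" using calculation I_n[OF s] by auto
          ultimately show "e \<in> C s" using e by (auto simp: C_def vpairs_def)
        qed
        moreover have "inj_on (\<lambda>(i, j). (s * b + i, s * b + j)) (vpairs m)"
          by (auto simp: inj_on_def)
        ultimately have "prod ?v (C s) = prod (?v \<circ> (\<lambda>(i, j). (s * b + i, s * b + j))) (vpairs m)"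
          by (simp only: prod.reindex)
        also have "\<dots> = ?c"
        proof (rule prod.cong[OF refl])
          fix e assume "e \<in> vpairs m"
          then obtain i j where e: "e = (i, j)" "1 \<le> i" "i < j" "j \<le> m" by (auto simp: vpairs_def)
          then have "h (s * b + i, s * b + j) \<longleftrightarrow> (i, j) \<in> T"
            using h_in[OF s, of "s * b + i" "s * b + j"] by (auto simp: I_def)
          then show "(?v \<circ> (\<lambda>(i, j). (s * b + i, s * b + j))) e =
            (case e of (i, j) \<Rightarrow> if (i, j) \<in> T then p (j - i) else 1 - p (j - i))"
            by (simp add: e(1))
        qed
        finally show ?thesis .
      qed
      have f01: "0 \<le> (case z of (i, l) \<Rightarrow> 1 - p l) \<and> (case z of (i, l) \<Rightarrow> 1 - p l) \<le> 1"
        if "z \<in> I s \<times> {1..n}" for z :: "nat \<times> nat"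
        using that p01 by auto
      \<comment> \<open>For a fixed block vertex \<open>i\<close>, the pairs of \<open>O1 s\<close>
        starting at \<open>i\<close> have distinct lengths in \<open>{1..n}\<close>, so their
        factors multiply to at least the full product. The \<open>m\<close> vertices and two sides
        give the exponent \<open>2 * m\<close>.\<close>
      have grid: "(\<Prod>(i, l)\<in>I s \<times> {1..n}. 1 - p l) = ?P ^ m"
        by (simp add: prod.cartesian_product[symmetric] I_def)
      have O1: "?P ^ m \<le> prod ?v (O1 s)"
      proof -
        have "(\<Prod>(i, l)\<in>I s \<times> {1..n}. 1 - p l) \<le> (\<Prod>(i, l)\<in>(\<lambda>(i, j). (i, j - i)) ` O1 s. 1 - p l)"
          by (rule prod_mono_subset) (use f01 in \<open>auto simp: I_def O1_def vpairs_def\<close>)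
        also have "\<dots> = (\<Prod>(i, j)\<in>O1 s. 1 - p (j - i))"
          by (subst prod.reindex) (auto simp: inj_on_def O1_def vpairs_def case_prod_beta' o_def)
        also have "\<dots> = prod ?v (O1 s)"
          by (rule prod.cong) (auto simp: O1_def h_out)
        finally show ?thesis using grid by simp
      qed
      have O2: "?P ^ m \<le> prod ?v (O2 s)"
      proof -
        have "(\<Prod>(i, l)\<in>I s \<times> {1..n}. 1 - p l) \<le> (\<Prod>(i, l)\<in>(\<lambda>(i, j). (j, j - i)) ` O2 s. 1 - p l)"
          by (rule prod_mono_subset) (use f01 in \<open>auto simp: I_def O2_def vpairs_def\<close>)
        also have "\<dots> = (\<Prod>(i, j)\<in>O2 s. 1 - p (j - i))"
          by (subst prod.reindex) (auto simp: inj_on_def O2_def vpairs_def case_prod_beta' o_def)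
        also have "\<dots> = prod ?v (O2 s)"
          by (rule prod.cong) (auto simp: O2_def h_out)
        finally show ?thesis using grid by simp
      qed
      have P0: "0 \<le> ?P" using p01 by (intro prod_nonneg) auto
      have c0: "0 \<le> ?c" using p01 by (intro prod_nonneg) (auto simp: vpairs_def)
      have "?c * ?P ^ (2 * m) = ?c * ?P ^ m * ?P ^ m" by (simp add: power_add mult_2)
      also have "\<dots> \<le> ?c * prod ?v (O1 s) * prod ?v (O2 s)"
        using O1 O2 P0 c0 by (intro mult_mono mult_nonneg_nonneg) (auto intro: order_trans[OF _ O1])
      also have "\<dots> = prod ?v (?T s)" using eq C by simp
      finally show "1 - prod ?v (?T s) \<le> 1 - ?c * ?P ^ (2 * m)" by simp
    qed
    finally show ?thesis by simp
  qed
  ultimately show ?thesis by linarith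
qed

lemma sum_swap_le:
  fixes G :: "'a \<Rightarrow> 'b \<Rightarrow> real"
  assumes "\<And>s. s \<in> S \<Longrightarrow> (\<Sum>b\<in>B. G s b) \<le> K"
  shows "(\<Sum>b\<in>B. \<Sum>s\<in>S. G s b) \<le> real (card S) * K"
  using sum_bounded_above[OF assms] by (subst sum.swap) simp

text \<open>Averaging over the spacing \<open>b \<in> {B..<2 * B}\<close> finds one for which edges between the
  \<open>r\<close> blocks are unlikely.\<close>

lemma isolated_copy_prob_bound:
  fixes p :: "nat \<Rightarrow> real"
  assumes p: "\<And>l. l \<ge> 1 \<Longrightarrow> 0 \<le> p l \<and> p l < 1"
    and T: "distance_graph {l. l \<ge> 1 \<and> p l > 0} {1..m} T"
    and B: "m \<le> B" "0 < B" "2 * B * r \<le> n"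
  shows "measure_pmf.prob (coins p n) {c. \<nexists>a. isolated_copy m T n (coin_rel c) a} \<le>
    (real r * real m)\<^sup>2 * (\<Sum>l=1..n. p l) / real B +
    (1 - (\<Prod>(i, j)\<in>vpairs m. if (i, j) \<in> T then p (j - i) else 1 - p (j - i)) *
      (\<Prod>l=1..n. 1 - p l) ^ (2 * m)) ^ r"
proof -
  define F where "F b = (\<Sum>s<r. \<Sum>t\<in>{s<..<r}. \<Sum>i=1..m. \<Sum>j=1..m. p ((t * b + j) - (s * b + i)))" for b
  let ?L = "\<Sum>l=1..n. p l"
  have L0: "0 \<le> ?L" using p by (intro sum_nonneg) (auto intro: less_imp_le)
  \<comment> \<open>The distance \<open>(t - s) * b + j - i\<close> is strictly increasing in
    \<open>b\<close>, so the sum over all spacings meets each length at most once. The bound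
    \<open>m <= B\<close> keeps the distance positive.\<close>
  have one: "(\<Sum>b\<in>{B..<2 * B}. p ((t * b + j) - (s * b + i))) \<le> ?L"
    if st: "s < t" "t < r" and ij: "i \<in> {1..m}" "j \<in> {1..m}" for s t i j
  proof -
    let ?g = "\<lambda>b. (t * b + j) - (s * b + i)"
    obtain u where u: "t = s + u" "u > 0" using st(1) less_imp_add_positive by blast
    have g: "int (?g b) = int u * int b + int j - int i" "1 \<le> ?g b" "?g b \<le> n" if b: "b \<in> {B..<2 * B}" for b
    proof -
      have ub: "b \<le> u * b" using u by simp
      have gb: "?g b = u * b + j - i" using u by (simp add: algebra_simps)
      have "i \<le> b" using b ij B by simp
      then have "i \<le> u * b" using ub by (rule order_trans)
      then have "i < u * b + j" using ij by simp
      then show "int (?g b) = int u * int b + int j - int i" "1 \<le> ?g b" unfolding gb by auto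
      have "j \<le> b" using b ij B by simp
      then have "?g b \<le> Suc u * b" unfolding gb by simp
      also have "\<dots> \<le> r * (2 * B)" using u st b by (intro mult_mono) auto
      finally show "?g b \<le> n" using B(3) by (simp add: mult.commute mult.assoc)
    qed
    have "inj_on ?g {B..<2 * B}"
    proof (rule inj_onI)
      fix x y assume xy: "x \<in> {B..<2 * B}" "y \<in> {B..<2 * B}" "?g x = ?g y"
      then have "int u * int x = int u * int y" using g(1)[of x] g(1)[of y] by linarith
      then show "x = y" using u by simp
    qed
    then have "(\<Sum>b\<in>{B..<2 * B}. p (?g b)) = (\<Sum>l\<in>?g ` {B..<2 * B}. p l)"
      by (simp add: sum.reindex)
    also have "\<dots> \<le> ?L"
      by (rule sum_mono2) (use g p in \<open>auto intro: less_imp_le\<close>)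
    finally show ?thesis .
  qed
  have "(\<Sum>b\<in>{B..<2 * B}. F b) \<le> real (card {..<r}) * (real r * (real (card {1..m}) * (real (card {1..m}) * ?L)))"
    unfolding F_def
  proof (rule sum_swap_le)
    fix s assume "s \<in> {..<r}"
    have "(\<Sum>b\<in>{B..<2 * B}. \<Sum>t\<in>{s<..<r}. \<Sum>i=1..m. \<Sum>j=1..m. p ((t * b + j) - (s * b + i))) \<le>
      real (card {s<..<r}) * (real (card {1..m}) * (real (card {1..m}) * ?L))"
      by (intro sum_swap_le one) auto
    also have "\<dots> \<le> real r * (real (card {1..m}) * (real (card {1..m}) * ?L))"
      using L0 by (intro mult_right_mono) auto
    finally show "(\<Sum>b\<in>{B..<2 * B}. \<Sum>t\<in>{s<..<r}. \<Sum>i=1..m. \<Sum>j=1..m. p ((t * b + j) - (s * b + i))) \<le>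
      real r * (real (card {1..m}) * (real (card {1..m}) * ?L))" .
  qed
  also have "\<dots> = (real r * real m)\<^sup>2 * ?L" by (simp add: power2_eq_square)
  finally have avg: "(\<Sum>b\<in>{B..<2 * B}. F b) \<le> (real r * real m)\<^sup>2 * ?L" .
  have "\<exists>b\<in>{B..<2 * B}. F b \<le> (real r * real m)\<^sup>2 * ?L / real B"
  proof (rule ccontr)
    assume "\<not> ?thesis"
    then have *: "\<And>b. b \<in> {B..<2 * B} \<Longrightarrow> (real r * real m)\<^sup>2 * ?L / real B < F b"
      by (meson not_le)
    have "(\<Sum>b\<in>{B..<2 * B}. (real r * real m)\<^sup>2 * ?L / real B) < (\<Sum>b\<in>{B..<2 * B}. F b)"
      by (rule sum_strict_mono) (use * B(2) in auto)
    moreover have "(\<Sum>b\<in>{B..<2 * B}. (real r * real m)\<^sup>2 * ?L / real B) = (real r * real m)\<^sup>2 * ?L"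
      using B(2) by simp
    ultimately show False using avg by linarith
  qed
  then obtain b where b: "B \<le> b" "b < 2 * B" "F b \<le> (real r * real m)\<^sup>2 * ?L / real B" by auto
  have "r * b \<le> r * (2 * B)" using b by (intro mult_le_mono) auto
  also have "\<dots> = 2 * B * r" by simp
  finally have "r * b \<le> n" using B(3) by (rule order_trans)
  then show ?thesis
    using isolated_copy_prob_blocks[OF p T, of b r n] b B unfolding F_def by simp
qed

text \<open>This is \<open>ln (1 - x) <= - x\<close> termwise. Under the limit condition it makes
  the expected number of edges to one side of a vertex grow more slowly than
  \<open>ln n\<close>.\<close>

lemma sum_le_neg_ln_prod:
  fixes p :: "nat \<Rightarrow> real"
  assumes "\<And>l. l \<ge> 1 \<Longrightarrow> 0 \<le> p l \<and> p l < 1"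
  shows "(\<Sum>l=1..n. p l) \<le> - ln (\<Prod>l=1..n. 1 - p l)"
proof -
  have "ln (\<Prod>l=1..n. 1 - p l) = (\<Sum>l=1..n. ln (1 - p l))"
  proof (rule ln_prod)
    show "1 - p i \<noteq> 0" if "i \<in> {1..n}" for i using assms[of i] that by auto
  qed simp
  also have "\<dots> \<le> (\<Sum>l=1..n. - p l)"
  proof (rule sum_mono)
    fix l assume "l \<in> {1..n}"
    then show "ln (1 - p l) \<le> - p l" using ln_le_minus_one[of "1 - p l"] assms[of l] by simp
  qed
  finally show ?thesis by (simp add: sum_negf)
qed

lemma isolated_copy_tendsto:
  fixes p :: "nat \<Rightarrow> real"
  assumes p: "\<And>l. l \<ge> 1 \<Longrightarrow> 0 \<le> p l \<and> p l < 1"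
    and lim: "(\<lambda>n. ln (\<Prod>l=1..n. 1 - p l) / ln (real n)) \<longlonglongrightarrow> 0"
    and m: "m \<ge> 1" and T: "distance_graph {l. l \<ge> 1 \<and> p l > 0} {1..m} T"
  shows "(\<lambda>n. measure_pmf.prob (coins p n) {c. \<exists>a. isolated_copy m T n (coin_rel c) a}) \<longlonglongrightarrow> 1"
proof -
  define P where "P n = (\<Prod>l=1..n. 1 - p l)" for n
  \<comment> \<open>There are \<open>r\<close> blocks, and the spacing parameter will be
    \<open>B = r ^ 3\<close>. Then \<open>2 * B * r\<close> is of order
    \<open>n powr (4 / 5)\<close> and fits into \<open>n\<close>; the first error term is
    \<open>m ^ 2 / r\<close> times a sum of lower order than \<open>ln n\<close>; and
    \<open>r\<close> still exceeds the isolation cost \<open>n powr (1 / 10)\<close> by a power of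
    \<open>n\<close>.\<close>
  define r where "r n = nat \<lfloor>real n powr (1 / 5)\<rfloor>" for n :: nat
  define c where "c = (\<Prod>(i, j)\<in>vpairs m. if (i, j) \<in> T then p (j - i) else 1 - p (j - i))"
  have P: "0 < P n" "P n \<le> 1" for n
  proof -
    have *: "0 < 1 - p l" "0 \<le> 1 - p l \<and> 1 - p l \<le> 1" if "l \<in> {1..n}" for l using p[of l] that by auto
    show "0 < P n" unfolding P_def by (rule prod_pos) (use * in blast)
    show "P n \<le> 1" unfolding P_def by (rule prod_le_1) (use * in blast)
  qed
  have c: "0 < c"
    unfolding c_def
  proof (rule prod_pos)
    fix e assume "e \<in> vpairs m"
    then obtain i j where e: "e = (i, j)" "1 \<le> i" "i < j" by (auto simp: vpairs_def)
    then have "(i, j) \<in> T \<Longrightarrow> p (j - i) > 0" using T by (auto simp: distance_graph_def)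
    then show "0 < (case e of (i, j) \<Rightarrow> if (i, j) \<in> T then p (j - i) else 1 - p (j - i))"
      using e p[of "j - i"] by auto
  qed
  have lim0: "(\<lambda>n. ln (P n) / ln (real n)) \<longlonglongrightarrow> 0" using lim by (simp add: P_def)
  have first: "(\<lambda>n. - (real m)\<^sup>2 * (ln (P n) / ln (real n)) * (ln (real n) / real (r n))) \<longlonglongrightarrow> 0"
  proof -
    have "(\<lambda>n. ln (real n) / real (r n)) \<longlonglongrightarrow> 0" unfolding r_def by real_asymp
    from tendsto_mult[OF tendsto_mult[OF tendsto_const[of "- (real m)\<^sup>2"] lim0] this]
    show ?thesis by (simp only: mult_zero_right)
  qed
  have second: "(\<lambda>n. exp (- (c * (real (r n) * real n powr (- 1 / 10))))) \<longlonglongrightarrow> 0"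
    unfolding r_def using c by real_asymp
  \<comment> \<open>The threshold \<open>1 / (20 * m)\<close> is the target exponent
    \<open>1 / 10\<close> divided by the power \<open>2 * m\<close>.\<close>
  have Pn: "\<forall>\<^sub>F n in sequentially. real n powr (- 1 / 10) \<le> P n ^ (2 * m)"
  proof -
    have "\<forall>\<^sub>F n in sequentially. ln (P n) / ln (real n) > - (1 / (20 * real m))"
      using order_tendstoD(1)[OF lim0, of "- (1 / (20 * real m))"] m by simp
    moreover have "\<forall>\<^sub>F n in sequentially. n > (1 :: nat)" by (rule eventually_gt_at_top)
    ultimately show ?thesis
    proof eventually_elim
      case (elim n)
      then have "- (1 / (20 * real m)) * ln (real n) < ln (P n)" by (simp add: field_simps)
      then have "real (2 * m) * (- (1 / (20 * real m)) * ln (real n)) \<le> real (2 * m) * ln (P n)"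
        by (intro mult_left_mono) auto
      then have "- 1 / 10 * ln (real n) \<le> real (2 * m) * ln (P n)" using m by simp
      then have "exp (- 1 / 10 * ln (real n)) \<le> exp (real (2 * m) * ln (P n))" by simp
      also have "\<dots> = P n ^ (2 * m)" using exp_of_nat_mult[of "2 * m" "ln (P n)"] P by simp
      finally show ?case using elim by (simp add: powr_def)
    qed
  qed
  have r_large: "\<forall>\<^sub>F n in sequentially. m \<le> r n ^ 3 \<and> 0 < r n"
  proof -
    have "filterlim (\<lambda>n. real (r n)) at_top sequentially" unfolding r_def by real_asymp
    then have "\<forall>\<^sub>F n in sequentially. real (r n) \<ge> real m"
      unfolding filterlim_at_top by blast
    then show ?thesis
    proof eventually_elim
      case (elim n)
      then have "m \<le> r n" by simp
      moreover have "r n \<le> r n ^ 3" using calculation m by (intro self_le_power) auto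
      ultimately show ?case using m by auto
    qed
  qed
  have r_small: "\<forall>\<^sub>F n in sequentially. 2 * r n ^ 3 * r n \<le> n"
  proof -
    have "\<forall>\<^sub>F n in sequentially. 2 * real (r n) ^ 3 * real (r n) \<le> real n"
      unfolding r_def by real_asymp
    then show ?thesis
    proof eventually_elim
      case (elim n)
      then have "real (2 * r n ^ 3 * r n) \<le> real n" by simp
      then show ?case by (simp only: of_nat_le_iff)
    qed
  qed
  have bound: "\<forall>\<^sub>F n in sequentially.
    measure_pmf.prob (coins p n) {c. \<nexists>a. isolated_copy m T n (coin_rel c) a} \<le>
    - (real m)\<^sup>2 * (ln (P n) / ln (real n)) * (ln (real n) / real (r n)) +
    exp (- (c * (real (r n) * real n powr (- 1 / 10))))"
    using Pn r_large r_small eventually_gt_at_top[of "1 :: nat"]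
  proof eventually_elim
    case (elim n)
    let ?r = "real (r n)"
    have r0: "?r > 0" using elim by simp
    have "measure_pmf.prob (coins p n) {c. \<nexists>a. isolated_copy m T n (coin_rel c) a} \<le>
      (?r * real m)\<^sup>2 * (\<Sum>l=1..n. p l) / real (r n ^ 3) + (1 - c * P n ^ (2 * m)) ^ r n"
      unfolding c_def P_def
      by (rule isolated_copy_prob_bound[OF p T]) (use elim in auto)
    also have "(?r * real m)\<^sup>2 * (\<Sum>l=1..n. p l) / real (r n ^ 3) \<le> (?r * real m)\<^sup>2 * (- ln (P n)) / real (r n ^ 3)"
      unfolding P_def using sum_le_neg_ln_prod[of p n, OF p]
      by (intro divide_right_mono mult_left_mono) auto
    also have "\<dots> = - (real m)\<^sup>2 * (ln (P n) / ln (real n)) * (ln (real n) / ?r)"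
      using r0 elim by (simp add: field_simps power2_eq_square power3_eq_cube)
    also have "(1 - c * P n ^ (2 * m)) ^ r n \<le> exp (- (c * P n ^ (2 * m))) ^ r n"
    proof (rule power_mono)
      show "1 - c * P n ^ (2 * m) \<le> exp (- (c * P n ^ (2 * m)))"
        using exp_ge_add_one_self[of "- (c * P n ^ (2 * m))"] by simp
      have "c \<le> 1" unfolding c_def
      proof (rule prod_le_1)
        fix e assume "e \<in> vpairs m"
        then obtain i j where e: "e = (i, j)" "1 \<le> i" "i < j" by (auto simp: vpairs_def)
        then have "j - i \<ge> 1" by simp
        from p[OF this] have "0 \<le> p (j - i)" "p (j - i) \<le> 1" by auto
        then show "0 \<le> (case e of (i, j) \<Rightarrow> if (i, j) \<in> T then p (j - i) else 1 - p (j - i)) \<and>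
          (case e of (i, j) \<Rightarrow> if (i, j) \<in> T then p (j - i) else 1 - p (j - i)) \<le> 1"
          using e(1) by simp
      qed
      then have "c * P n ^ (2 * m) \<le> 1 * 1" using c P[of n]
        by (intro mult_mono power_le_one) (auto intro: less_imp_le)
      then show "0 \<le> 1 - c * P n ^ (2 * m)" by simp
    qed
    also have "\<dots> = exp (- (c * (?r * P n ^ (2 * m))))"
      by (simp add: exp_of_nat_mult[symmetric] algebra_simps)
    also have "\<dots> \<le> exp (- (c * (?r * real n powr (- 1 / 10))))"
      using elim(1) c by (simp add: mult_left_mono)
    finally show ?case by simp
  qed
  have "(\<lambda>n. measure_pmf.prob (coins p n) {c. \<nexists>a. isolated_copy m T n (coin_rel c) a}) \<longlonglongrightarrow> 0"
    by (rule tendsto_sandwich[OF _ bound tendsto_const])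
      (use tendsto_add[OF first second] in \<open>simp_all only: add_0_left measure_nonneg eventually_True\<close>)
  then have "(\<lambda>n. 1 - measure_pmf.prob (coins p n) {c. \<nexists>a. isolated_copy m T n (coin_rel c) a}) \<longlonglongrightarrow> 1 - 0"
    by (intro tendsto_diff tendsto_const)
  moreover have "1 - measure_pmf.prob M {c. \<nexists>a. Q c a} = measure_pmf.prob M {c. \<exists>a. Q c a}"
    for M and Q :: "(nat \<times> nat \<Rightarrow> bool) \<Rightarrow> nat \<Rightarrow> bool"
    using measure_pmf.prob_compl[of "{c. \<nexists>a. Q c a}" M] by (simp add: Compl_eq_Diff_UNIV[symmetric] Collect_neg_eq[symmetric])
  ultimately show ?thesis by simp
qed

section \<open>From isolated copies to the 0-1 law\<close>

lemma shift_rel_shift_rel: "shift_rel a (shift_rel b R) = shift_rel (a + b) R"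
  by (auto simp: shift_rel_def image_image map_prod_def add.assoc case_prod_beta' intro!: image_eqI)

text \<open>Vertices of \<open>H\<close> may start at \<open>0\<close>, those of the random graph
  start at \<open>1\<close>; hence the offset \<open>a + 1\<close>. A block vertex not covered by
  the copy has no edges and goes to \<open>V\<close>.\<close>

lemma isolated_copy_decomposition:
  assumes iso: "isolated_copy m (shift_rel 1 T) n R a"
    and R: "distance_graph D {1..n} R" and H: "H \<subseteq> {..<m}" "T \<subseteq> H \<times> H"
  defines "V \<equiv> {1..n} - (+) (a + 1) ` H"
  shows "{1..n} = (+) (a + 1) ` H \<union> V" "R = shift_rel (a + 1) T \<union> (R \<inter> V \<times> V)"
proof -
  have am: "a + m \<le> n" and eq: "i \<in> {a + 1..a + m} \<Longrightarrow> j \<in> {1..n} \<Longrightarrow>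
      (i, j) \<in> R \<longleftrightarrow> (i, j) \<in> shift_rel (a + 1) T" for i j
    using iso unfolding isolated_copy_def shift_rel_shift_rel by blast+
  have H_sub: "(+) (a + 1) ` H \<subseteq> {a + 1..a + m}" using H by auto
  then show "{1..n} = (+) (a + 1) ` H \<union> V" unfolding V_def using am by auto
  have symR: "(i, j) \<in> R \<Longrightarrow> (j, i) \<in> R" for i j using R by (auto simp: distance_graph_def sym_def)
  have R_sub: "i \<in> {1..n} \<and> j \<in> {1..n}" if "(i, j) \<in> R" for i j
    using R that by (auto simp: distance_graph_def)
  have T_sub: "i \<in> (+) (a + 1) ` H \<and> j \<in> (+) (a + 1) ` H" if "(i, j) \<in> shift_rel (a + 1) T" for i j
    using that H(2) by (auto simp: shift_rel_def)
  have TR: "(i, j) \<in> R" if "(i, j) \<in> shift_rel (a + 1) T" for i j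
  proof -
    have "i \<in> {a + 1..a + m}" "j \<in> {a + 1..a + m}" using T_sub[OF that] H_sub by blast+
    then show ?thesis using eq[of i j] that am by auto
  qed
  have RT: "(i, j) \<in> shift_rel (a + 1) T \<or> i \<in> V \<and> j \<in> V" if ij: "(i, j) \<in> R" for i j
  proof (cases "i \<in> V \<and> j \<in> V")
    case False
    then have "i \<in> (+) (a + 1) ` H \<or> j \<in> (+) (a + 1) ` H" using R_sub[OF ij] by (auto simp: V_def)
    then show ?thesis
    proof
      assume "i \<in> (+) (a + 1) ` H"
      then show ?thesis using eq[of i j] H_sub R_sub[OF ij] ij by blast
    next
      \<comment> \<open>\<open>isolated_copy\<close> controls only pairs whose first entry lies in
        the block, so symmetry has to bring \<open>j\<close> to the front.\<close>
      assume j: "j \<in> (+) (a + 1) ` H"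
      then have "(j, i) \<in> shift_rel (a + 1) T" using eq[of j i] H_sub R_sub[OF ij] symR[OF ij] by blast
      then have "i \<in> (+) (a + 1) ` H" using T_sub by blast
      then show ?thesis using eq[of i j] H_sub R_sub[OF ij] ij by blast
    qed
  qed simp
  show "R = shift_rel (a + 1) T \<union> (R \<inter> V \<times> V)" using TR RT by auto
qed

text \<open>The limit is the truth value of \<open>\<psi>\<close> in \<open>H\<close>, a graph
  chosen before \<open>n\<close> from the rank of \<open>\<psi>\<close> and the lengths of positive
  probability. On the likely event that an isolated copy of \<open>H\<close> occurs, whatever
  surrounds it is absorbed.\<close>

lemma zero_one_law_if:
  fixes p :: "nat \<Rightarrow> real"
  assumes p: "\<And>l. l \<ge> 1 \<Longrightarrow> 0 \<le> p l \<and> p l < 1"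
    and lim: "(\<lambda>n. ln (\<Prod>l=1..n. 1 - p l) / ln (real n)) \<longlonglongrightarrow> 0"
  shows "zero_one_law p"
  unfolding zero_one_law_def
proof (intro allI impI)
  fix \<psi> assume \<psi>: "sentence \<psi>"
  let ?D = "{l. l \<ge> 1 \<and> p l > 0}" and ?k = "qrank \<psi>"
  obtain H T where HT: "distance_graph ?D H T"
    and univ: "\<And>a V R. distance_graph ?D V R \<Longrightarrow> (+) a ` H \<inter> V = {} \<Longrightarrow>
      tp ?k ((+) a ` H \<union> V) (shift_rel a T \<union> R) [] = tp ?k H T []"
    using universal_distance_graph by blast
  have H: "finite H" "T \<subseteq> H \<times> H" using HT by (auto simp: distance_graph_def)
  obtain m0 where "H \<subseteq> {..<m0}" using H(1) finite_nat_iff_bounded by auto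
  then obtain m where m: "H \<subseteq> {..<m}" "m \<ge> 1" by (intro that[of "Suc m0"]) auto
  have T1: "distance_graph ?D {1..m} (shift_rel 1 T)"
  proof -
    have "distance_graph ?D ((+) 1 ` H) (shift_rel 1 T)" by (rule distance_graph_shift[OF HT])
    moreover have "(+) 1 ` H \<subseteq> {1..m}" using m by auto
    ultimately show ?thesis unfolding distance_graph_def by blast
  qed
  define E where "E n = {c. \<exists>a. isolated_copy m (shift_rel 1 T) n (coin_rel c) a}" for n
  have E: "(\<lambda>n. measure_pmf.prob (coins p n) (E n)) \<longlonglongrightarrow> 1"
    unfolding E_def by (rule isolated_copy_tendsto[OF p lim m(2) T1])
  have models: "models {1..n} (coin_rel c) \<psi> \<longleftrightarrow> models H T \<psi>"
    if c: "c \<in> set_pmf (coins p n)" "c \<in> E n" for n c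
  proof -
    have G: "distance_graph ?D {1..n} (coin_rel c)"
      using distance_graph_coin_rel[OF c(1)] p by (metis less_eq_real_def)
    obtain a where "isolated_copy m (shift_rel 1 T) n (coin_rel c) a" using c(2) by (auto simp: E_def)
    note dec = isolated_copy_decomposition[OF this G m(1) H(2)]
    let ?V = "{1..n} - (+) (a + 1) ` H"
    have "distance_graph ?D ?V (coin_rel c \<inter> ?V \<times> ?V)"
      using G by (auto simp: distance_graph_def sym_def irrefl_def)
    from univ[OF this, of "a + 1"] have "tp ?k {1..n} (coin_rel c) [] = tp ?k H T []"
      using dec by auto
    then show ?thesis by (intro tp_eq_imp_models_iff[OF \<psi>]) (use H in auto)
  qed
  show "\<exists>z\<in>{0, 1}. prob_models p \<psi> \<longlonglongrightarrow> z"
  proof (cases "models H T \<psi>")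
    case True
    have "prob_models p \<psi> \<longlonglongrightarrow> 1"
    proof (rule tendsto_sandwich[OF _ _ E tendsto_const])
      show "\<forall>\<^sub>F n in sequentially. measure_pmf.prob (coins p n) (E n) \<le> prob_models p \<psi> n"
        unfolding prob_models_eq using models True
        by (intro always_eventually allI prob_mono_support) auto
    qed (simp add: prob_models_def)
    then show ?thesis by auto
  next
    case False
    have "prob_models p \<psi> \<longlonglongrightarrow> 0"
    proof (rule tendsto_sandwich[OF _ _ tendsto_const])
      show "(\<lambda>n. 1 - measure_pmf.prob (coins p n) (E n)) \<longlonglongrightarrow> 0"
        using tendsto_diff[OF tendsto_const[of 1] E] by simp
      show "\<forall>\<^sub>F n in sequentially. prob_models p \<psi> n \<le> 1 - measure_pmf.prob (coins p n) (E n)"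
      proof (intro always_eventually allI)
        fix n
        have "prob_models p \<psi> n \<le> measure_pmf.prob (coins p n) (- E n)"
          unfolding prob_models_eq using models False by (intro prob_mono_support) auto
        then show "prob_models p \<psi> n \<le> 1 - measure_pmf.prob (coins p n) (E n)"
          using measure_pmf.prob_compl[of "E n" "coins p n"] by (simp add: Compl_eq_Diff_UNIV)
      qed
    qed (simp add: prob_models_def)
    then show ?thesis by auto
  qed
qed

section \<open>The star sentence\<close>

text \<open>The syntax has no constant for truth, and \<open>Equal 0 0\<close> takes its place. This
  makes variable \<open>0\<close> free, which the outer quantifiers of the star sentence bind
  anyway.\<close>

fun conj_list :: "fol list \<Rightarrow> fol" where
  "conj_list [] = Equal 0 0"
| "conj_list (\<phi> # \<phi>s) = Conj \<phi> (conj_list \<phi>s)"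

lemma sat_conj_list [simp]: "sat V R s (conj_list \<phi>s) \<longleftrightarrow> (\<forall>\<phi>\<in>set \<phi>s. sat V R s \<phi>)"
  by (induction \<phi>s) auto

lemma free_vars_conj_list: "free_vars (conj_list \<phi>s) = insert 0 (\<Union>\<phi>\<in>set \<phi>s. free_vars \<phi>)"
  by (induction \<phi>s) auto

fun exists_below :: "nat \<Rightarrow> fol \<Rightarrow> fol" where
  "exists_below 0 \<phi> = \<phi>"
| "exists_below (Suc n) \<phi> = Exists n (exists_below n \<phi>)"

lemma free_vars_exists_below: "free_vars (exists_below n \<phi>) = free_vars \<phi> - {..<n}"
proof (induction n)
  case (Suc n)
  have "free_vars \<phi> - {..<n} - {n} = free_vars \<phi> - {..<Suc n}" by fastforce
  then show ?case by (simp only: exists_below.simps free_vars.simps Suc)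
qed simp

lemma sat_exists_below:
  "sat V R s (exists_below n \<phi>) \<longleftrightarrow>
    (\<exists>g. (\<forall>i<n. g i \<in> V) \<and> sat V R (\<lambda>i. if i < n then g i else s i) \<phi>)"
proof (induction n arbitrary: s)
  case 0
  then show ?case by simp
next
  case (Suc n)
  have "sat V R s (exists_below (Suc n) \<phi>) \<longleftrightarrow>
    (\<exists>a\<in>V. \<exists>g. (\<forall>i<n. g i \<in> V) \<and> sat V R (\<lambda>i. if i < n then g i else (s(n := a)) i) \<phi>)"
    by (simp add: Suc)
  also have "\<dots> \<longleftrightarrow> (\<exists>g. (\<forall>i<Suc n. g i \<in> V) \<and> sat V R (\<lambda>i. if i < Suc n then g i else s i) \<phi>)"
  proof safe
    fix a g assume g: "a \<in> V" "\<forall>i<n. g i \<in> V" "sat V R (\<lambda>i. if i < n then g i else (s(n := a)) i) \<phi>"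
    have "(\<lambda>i. if i < n then g i else (s(n := a)) i) = (\<lambda>i. if i < Suc n then (g(n := a)) i else s i)"
      by (auto simp: fun_eq_iff less_Suc_eq)
    then show "\<exists>g. (\<forall>i<Suc n. g i \<in> V) \<and> sat V R (\<lambda>i. if i < Suc n then g i else s i) \<phi>"
      using g by (intro exI[of _ "g(n := a)"]) (auto simp: less_Suc_eq)
  next
    fix g assume g: "\<forall>i<Suc n. g i \<in> V" "sat V R (\<lambda>i. if i < Suc n then g i else s i) \<phi>"
    have "(\<lambda>i. if i < n then g i else (s(n := g n)) i) = (\<lambda>i. if i < Suc n then g i else s i)"
      by (auto simp: fun_eq_iff less_Suc_eq)
    then show "\<exists>a\<in>V. \<exists>h. (\<forall>i<n. h i \<in> V) \<and> sat V R (\<lambda>i. if i < n then h i else (s(n := a)) i) \<phi>"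
      using g by (intro bexI[of _ "g n"] exI[of _ g]) auto
  qed
  finally show ?case .
qed

definition pendant :: "'a set \<Rightarrow> 'a rel \<Rightarrow> 'a \<Rightarrow> 'a \<Rightarrow> bool" where
  "pendant V R x u \<longleftrightarrow> (x, u) \<in> R \<and> (\<forall>y\<in>V. (y, u) \<in> R \<longrightarrow> y = x)"

text \<open>Variable \<open>0\<close> is the centre, the variables \<open>1, \<dots>, K\<close> are the leaves.\<close>

definition star_sentence :: "nat \<Rightarrow> fol" where
  "star_sentence K = exists_below (Suc K) (conj_list (
     [Neg (Equal i j). i \<leftarrow> [1..<Suc K], j \<leftarrow> [1..<i]] @
     [Adj 0 i. i \<leftarrow> [1..<Suc K]] @
     [Neg (Exists (Suc K) (Conj (Adj (Suc K) i) (Neg (Equal (Suc K) 0)))). i \<leftarrow> [1..<Suc K]]))"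

lemma sentence_star_sentence: "sentence (star_sentence K)"
  by (auto simp: sentence_def star_sentence_def free_vars_exists_below free_vars_conj_list)

lemma models_star_sentence:
  "models V R (star_sentence K) \<longleftrightarrow> (\<exists>x\<in>V. \<exists>S\<subseteq>V. finite S \<and> card S = K \<and> (\<forall>u\<in>S. pendant V R x u))"
proof -
  have "sat V R s (star_sentence K) \<longleftrightarrow>
    (\<exists>x\<in>V. \<exists>S\<subseteq>V. finite S \<and> card S = K \<and> (\<forall>u\<in>S. pendant V R x u))" for s
  proof -
    have "sat V R s (star_sentence K) \<longleftrightarrow> (\<exists>g. (\<forall>i<Suc K. g i \<in> V) \<and>
      (\<forall>i\<in>{1..K}. \<forall>j\<in>{1..<i}. g i \<noteq> g j) \<and> (\<forall>i\<in>{1..K}. pendant V R (g 0) (g i)))"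
    proof -
      let ?t = "\<lambda>g i. if i < Suc K then g i else s i"
      have 1: "(\<forall>\<phi>\<in>set [Neg (Equal i j). i \<leftarrow> [1..<Suc K], j \<leftarrow> [1..<i]]. sat V R (?t g) \<phi>) \<longleftrightarrow>
        (\<forall>i\<in>{1..K}. \<forall>j\<in>{1..<i}. g i \<noteq> g j)" for g
        by (simp del: upt_Suc add: ball_UN atLeastLessThanSuc_atLeastAtMost)
      have 2: "(\<forall>\<phi>\<in>set [Adj 0 i. i \<leftarrow> [1..<Suc K]]. sat V R (?t g) \<phi>) \<longleftrightarrow>
        (\<forall>i\<in>{1..K}. (g 0, g i) \<in> R)" for g
        by (simp del: upt_Suc add: atLeastLessThanSuc_atLeastAtMost)
      have 3: "(\<forall>\<phi>\<in>set [Neg (Exists (Suc K) (Conj (Adj (Suc K) i) (Neg (Equal (Suc K) 0)))).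
          i \<leftarrow> [1..<Suc K]]. sat V R (?t g) \<phi>) \<longleftrightarrow>
        (\<forall>i\<in>{1..K}. \<forall>y\<in>V. (y, g i) \<in> R \<longrightarrow> y = g 0)" for g
        by (simp del: upt_Suc add: atLeastLessThanSuc_atLeastAtMost)
      show ?thesis
        unfolding star_sentence_def sat_exists_below pendant_def sat_conj_list set_append ball_Un 1 2 3
        by blast
    qed
    also have "\<dots> \<longleftrightarrow> (\<exists>x\<in>V. \<exists>S\<subseteq>V. finite S \<and> card S = K \<and> (\<forall>u\<in>S. pendant V R x u))"
    proof safe
      fix g assume g: "\<forall>i<Suc K. g i \<in> V" "\<forall>i\<in>{1..K}. \<forall>j\<in>{1..<i}. g i \<noteq> g j"
        "\<forall>i\<in>{1..K}. pendant V R (g 0) (g i)"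
      have "inj_on g {1..K}"
      proof (rule inj_onI)
        fix i j assume ij: "i \<in> {1..K}" "j \<in> {1..K}" "g i = g j"
        show "i = j"
        proof (rule linorder_cases[of i j])
          assume "i < j"
          then show ?thesis using g(2)[rule_format, of j i] ij by auto
        next
          assume "j < i"
          then show ?thesis using g(2)[rule_format, of i j] ij by auto
        qed
      qed
      then have "card (g ` {1..K}) = K" by (simp add: card_image)
      then show "\<exists>x\<in>V. \<exists>S\<subseteq>V. finite S \<and> card S = K \<and> (\<forall>u\<in>S. pendant V R x u)"
        using g by (intro bexI[of _ "g 0"] exI[of _ "g ` {1..K}"]) auto
    next
      fix x S assume S: "x \<in> V" "S \<subseteq> V" "finite S" "\<forall>u\<in>S. pendant V R x u" "K = card S"
      then obtain h where h: "bij_betw h {1..K} S"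
        using ex_bij_betw_nat_finite_1 by blast
      let ?g = "h(0 := x)"
      have "\<forall>i\<in>{1..K}. h i \<in> S" using h bij_betwE by blast
      moreover have "h i \<noteq> h j" if "i \<in> {1..K}" "j \<in> {1..<i}" for i j
        using h that inj_onD[of h "{1..K}" i j] by (auto simp: bij_betw_def)
      ultimately show "\<exists>g. (\<forall>i<Suc (card S). g i \<in> V) \<and>
        (\<forall>i\<in>{1..card S}. \<forall>j\<in>{1..<i}. g i \<noteq> g j) \<and> (\<forall>i\<in>{1..card S}. pendant V R (g 0) (g i))"
        using S by (intro exI[of _ ?g]) (auto simp: less_Suc_eq_le)
    qed
    finally show ?thesis .
  qed
  then show ?thesis unfolding models_def by blast
qed

section \<open>The star sentence for finitely supported sequences\<close>

lemma finite_support_lim: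
  fixes p :: "nat \<Rightarrow> real"
  assumes "\<And>l. l > M \<Longrightarrow> p l = 0"
  shows "(\<lambda>n. ln (\<Prod>l=1..n. 1 - p l) / ln (real n)) \<longlonglongrightarrow> 0"
proof -
  have "(\<lambda>n. C / ln (real n)) \<longlonglongrightarrow> 0" for C :: real by real_asymp
  note lim = this[of "ln (\<Prod>l=1..M. 1 - p l)"]
  have ev: "\<forall>\<^sub>F n in sequentially.
    ln (\<Prod>l=1..n. 1 - p l) / ln (real n) = ln (\<Prod>l=1..M. 1 - p l) / ln (real n)"
    using eventually_ge_at_top[of M]
  proof eventually_elim
    case (elim n)
    have "(\<Prod>l=1..n. 1 - p l) = (\<Prod>l=1..M. 1 - p l)"
      by (rule prod.mono_neutral_right) (use elim assms in auto)
    then show ?case by simp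
  qed
  show ?thesis using lim tendsto_cong[OF ev] by blast
qed

text \<open>The star with centre \<open>1\<close> and leaves \<open>1 + d\<close> for
  \<open>d \<in> S\<close> uses only lengths of positive probability and fits into
  \<open>Suc M\<close> vertices. It occurs as an isolated copy with high probability, and isolation
  gives its leaves degree one.\<close>

lemma star_sentence_tendsto_1:
  fixes p :: "nat \<Rightarrow> real"
  assumes p: "\<And>l. l \<ge> 1 \<Longrightarrow> 0 \<le> p l \<and> p l < 1" and supp: "\<And>l. l > M \<Longrightarrow> p l = 0"
    and S: "finite S" "S \<subseteq> {l. l \<ge> 1 \<and> p l > 0}" "K = card S"
  shows "prob_models p (star_sentence K) \<longlonglongrightarrow> 1"
proof -
  define T :: "nat rel" where "T = (\<lambda>d. (1, 1 + d)) ` S \<union> (\<lambda>d. (1 + d, 1)) ` S"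
  have SM: "S \<subseteq> {1..M}"
  proof
    fix d assume "d \<in> S"
    then have "1 \<le> d" "p d \<noteq> 0" using S(2) by auto
    then show "d \<in> {1..M}" using supp[of d] by (cases "M < d") auto
  qed
  have T: "distance_graph {l. l \<ge> 1 \<and> p l > 0} {1..Suc M} T"
    using S(2) SM unfolding distance_graph_def T_def sym_def irrefl_def by auto
  have lim: "(\<lambda>n. measure_pmf.prob (coins p n) {c. \<exists>a. isolated_copy (Suc M) T n (coin_rel c) a}) \<longlonglongrightarrow> 1"
    by (rule isolated_copy_tendsto[OF p finite_support_lim[OF supp] _ T]) auto
  have star: "models {1..n} (coin_rel c) (star_sentence K)"
    if iso: "isolated_copy (Suc M) T n (coin_rel c) a" for n c a
    unfolding models_star_sentence
  proof (intro bexI exI conjI ballI)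
    have am: "a + Suc M \<le> n" using iso by (simp add: isolated_copy_def)
    show "a + 1 \<in> {1..n}" using am by auto
    show "(\<lambda>d. a + 1 + d) ` S \<subseteq> {1..n}" using am SM by auto
    show "card ((\<lambda>d. a + 1 + d) ` S) = K"
      using S(3) by (subst card_image) (auto simp: inj_on_def)
    fix u assume "u \<in> (\<lambda>d. a + 1 + d) ` S"
    then obtain d where d: "u = a + (1 + d)" "d \<in> S" by auto
    have u: "u \<in> {a + 1..a + Suc M}" using d SM by auto
    have nb: "(y, u) \<in> coin_rel c \<longleftrightarrow> (y, u) \<in> shift_rel a T" if "y \<in> {1..n}" for y
    proof -
      have "(u, y) \<in> coin_rel c \<longleftrightarrow> (u, y) \<in> shift_rel a T"
        using iso u that by (simp add: isolated_copy_def)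
      moreover have "(u, y) \<in> shift_rel a T \<longleftrightarrow> (y, u) \<in> shift_rel a T"
        using T unfolding distance_graph_def sym_def shift_rel_def by auto
      ultimately show ?thesis by (auto simp: coin_rel_def)
    qed
    have edge: "(a + 1, u) \<in> shift_rel a T" unfolding d in_shift_rel_iff using d(2) by (auto simp: T_def)
    have only: "y = a + 1" if "(y, u) \<in> shift_rel a T" for y
      using that d SM by (auto simp: shift_rel_def T_def)
    show "pendant {1..n} (coin_rel c) (a + 1) u"
      unfolding pendant_def
    proof (intro conjI ballI impI)
      show "(a + 1, u) \<in> coin_rel c" using nb[of "a + 1"] edge am by simp
      show "y = a + 1" if "y \<in> {1..n}" "(y, u) \<in> coin_rel c" for y
        using only nb[OF that(1)] that(2) by blast
    qed
  qed (use S in auto)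
  show ?thesis
  proof (rule tendsto_sandwich[OF _ _ lim tendsto_const])
    show "\<forall>\<^sub>F n in sequentially. measure_pmf.prob (coins p n)
      {c. \<exists>a. isolated_copy (Suc M) T n (coin_rel c) a} \<le> prob_models p (star_sentence K) n"
      unfolding prob_models_eq
    proof (intro always_eventually allI prob_mono_support)
      fix n c assume "c \<in> {c. \<exists>a. isolated_copy (Suc M) T n (coin_rel c) a}"
      then obtain a where "isolated_copy (Suc M) T n (coin_rel c) a" by blast
      from star[OF this] show "c \<in> {c. models {1..n} (coin_rel c) (star_sentence K)}"
        by simp
    qed
  qed (simp add: prob_models_def)
qed

section \<open>The star sentence when the product is small\<close>

definition opair :: "nat \<Rightarrow> nat \<Rightarrow> nat \<times> nat" where
  "opair x y = (min x y, max x y)"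

text \<open>Subtraction on \<open>nat\<close> truncates, so the larger end comes first. Likewise
  \<open>opair\<close> sorts the ends because coins are indexed by increasing pairs.\<close>

definition ndist :: "nat \<Rightarrow> nat \<Rightarrow> nat" where
  "ndist x y = max x y - min x y"

text \<open>Every distance occurs at most once on each side of \<open>x\<close>; hence the factor
  \<open>2\<close>.\<close>

lemma sum_ndist_le:
  fixes p :: "nat \<Rightarrow> real"
  assumes p: "\<And>l. l \<ge> 1 \<Longrightarrow> 0 \<le> p l" and x: "x \<in> {1..N}" and U: "U \<subseteq> {1..N} - {x}"
  shows "(\<Sum>u\<in>U. p (ndist u x)) \<le> 2 * (\<Sum>l=1..N. p l)"
proof -
  have "(\<Sum>u\<in>U. p (ndist u x)) \<le> (\<Sum>u\<in>{1..<x} \<union> {x<..N}. p (ndist u x))"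
    by (rule sum_mono2) (use U x p in \<open>auto simp: ndist_def\<close>)
  also have "\<dots> = (\<Sum>u\<in>{1..<x}. p (ndist u x)) + (\<Sum>u\<in>{x<..N}. p (ndist u x))"
    by (rule sum.union_disjoint) auto
  also have "(\<Sum>u\<in>{1..<x}. p (ndist u x)) = (\<Sum>l\<in>(\<lambda>u. x - u) ` {1..<x}. p l)"
    by (subst sum.reindex) (auto simp: inj_on_def ndist_def)
  also have "\<dots> \<le> (\<Sum>l=1..N. p l)"
    by (rule sum_mono2) (use x p in auto)
  also have "(\<Sum>u\<in>{x<..N}. p (ndist u x)) = (\<Sum>l\<in>(\<lambda>u. u - x) ` {x<..N}. p l)"
    by (subst sum.reindex) (auto simp: inj_on_def ndist_def)
  also have "\<dots> \<le> (\<Sum>l=1..N. p l)"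
    by (rule sum_mono2) (use x p in auto)
  finally show ?thesis by simp
qed

text \<open>Here \<open>nb u l\<close> is the vertex at distance \<open>l\<close> from \<open>u\<close> on a fixed side of \<open>u\<close>, so that the pairs
  \<open>{u, nb u l}\<close> are distinct for distinct \<open>u\<close> and the events of being pendant are bounded by
  independent ones. A distance \<open>d\<close> with \<open>1 - p d\<close> small could make a leaf cheap, but there is at
  most one such distance, hence at most two such leaves.\<close>

lemma pendant_prob_bound:
  fixes p :: "nat \<Rightarrow> real"
  assumes p: "\<And>l. l \<ge> 1 \<Longrightarrow> 0 \<le> p l \<and> p l < 1" and zero: "\<And>l. n < l \<Longrightarrow> l \<le> 2 * n \<Longrightarrow> p l = 0"
    and x: "x \<in> {1..2 * n}" and U: "U \<subseteq> {1..2 * n}"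
    and nb: "\<And>u l. u \<in> U \<Longrightarrow> l \<in> {1..n} \<Longrightarrow> nb u l \<in> {1..2 * n} \<and> ndist u (nb u l) = l"
    and nb_inj: "\<And>u v l l'. u \<in> U \<Longrightarrow> v \<in> U \<Longrightarrow> l \<in> {1..n} \<Longrightarrow> l' \<in> {1..n} \<Longrightarrow>
      opair u (nb u l) = opair v (nb v l') \<Longrightarrow> u = v"
  defines "P \<equiv> \<Prod>l=1..n. 1 - p l"
  shows "measure_pmf.prob (coins p (2 * n))
      {c. \<exists>S\<subseteq>U. card S = k + 2 \<and> (\<forall>u\<in>S. pendant {1..2 * n} (coin_rel c) x u)} \<le>
    (8 * P powr (1 / 4)) ^ k"
proof -
  let ?M = "coins p (2 * n)" and ?V = "{1..2 * n}"
  \<comment> \<open>If \<open>x\<close> is itself \<open>nb u d\<close>, the factor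
    \<open>1 - p d\<close> is missing from the price of the leaf \<open>u\<close>. For
    \<open>u \<in> W\<close> that factor is at least \<open>sqrt P\<close>, so the remaining ones
    still multiply to at most \<open>sqrt P\<close>.\<close>
  define W where "W = {u \<in> U - {x}. sqrt P \<le> 1 - p (ndist u x)}"
  \<comment> \<open>One prescription for all leaves at once: heads exactly on the pairs containing
    \<open>x\<close>. It is consistent because \<open>L u\<close> omits the distance at which
    \<open>nb u l\<close> would be \<open>x\<close>.\<close>
  define h where "h e \<longleftrightarrow> fst e = x \<or> snd e = x" for e :: "nat \<times> nat"
  define L where "L u = {l \<in> {1..n}. nb u l \<noteq> x}" for u
  define T where "T u = insert (opair u x) ((\<lambda>l. opair u (nb u l)) ` L u)" for u
  define v where "v e = (if h e then p (snd e - fst e) else 1 - p (snd e - fst e))" for e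
  define w where "w u = p (ndist u x) * sqrt P" for u
  have p01: "0 \<le> p l" "p l \<le> 1" if "l \<ge> 1" for l using p[OF that] by auto
  have P: "0 < P" "P \<le> 1"
  proof -
    have *: "0 < 1 - p l" "0 \<le> 1 - p l \<and> 1 - p l \<le> 1" if "l \<in> {1..n}" for l using p[of l] that by auto
    show "0 < P" unfolding P_def by (rule prod_pos) (use * in blast)
    show "P \<le> 1" unfolding P_def by (rule prod_le_1) (use * in blast)
  qed
  have sqrtP: "P = sqrt P * sqrt P" "0 < sqrt P" "sqrt P \<le> 1" "P \<le> sqrt P"
  proof -
    show s: "P = sqrt P * sqrt P" "0 < sqrt P" "sqrt P \<le> 1" using P by auto
    show "P \<le> sqrt P" using s mult_left_le[of "sqrt P" "sqrt P"] by simp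
  qed
  have ndist_pos: "1 \<le> ndist u x" if "u \<noteq> x" for u using that by (auto simp: ndist_def)
  have finW: "finite W" by (rule finite_subset[of _ ?V]) (use U in \<open>auto simp: W_def\<close>)
  have T_sub: "T u \<subseteq> vpairs (2 * n)" if "u \<in> W" for u
    using that U x nb[of u] by (fastforce simp: T_def L_def W_def vpairs_def opair_def ndist_def)
  have T_disj: "T u \<inter> T u' = {}" if u: "u \<in> W" "u' \<in> W" "u \<noteq> u'" for u u'
  proof -
    have "opair u x \<noteq> opair u' x" using u(3) by (auto simp: opair_def min_def max_def split: if_splits)
    moreover have "opair a x \<noteq> opair b (nb b l)" if "b \<in> W" "l \<in> L b" for a b l
      using that by (auto simp: opair_def min_def max_def W_def L_def split: if_splits)
    moreover have "opair u (nb u l) \<noteq> opair u' (nb u' l')" if "l \<in> L u" "l' \<in> L u'" for l l'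
      using nb_inj[of u u' l l'] that u by (auto simp: W_def L_def)
    ultimately show ?thesis using u(1,2) unfolding T_def by (auto, metis+)
  qed
  have v_T: "prod v (T u) \<le> w u" "0 \<le> prod v (T u)" if u: "u \<in> W" for u
  proof -
    have ux: "u \<noteq> x" "u \<in> U" using u by (auto simp: W_def)
    have v1: "v (opair u x) = p (ndist u x)"
      by (auto simp: v_def h_def opair_def ndist_def min_def max_def)
    have v2: "v (opair u (nb u l)) = 1 - p l" if l: "l \<in> L u" for l
    proof -
      have "\<not> h (opair u (nb u l))" using l ux by (auto simp: h_def opair_def L_def min_def max_def)
      moreover have "ndist u (nb u l) = l" using nb[OF ux(2)] l by (auto simp: L_def)
      ultimately show ?thesis by (simp add: v_def opair_def ndist_def)
    qed
    have inj: "inj_on (\<lambda>l. opair u (nb u l)) (L u)"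
    proof (rule inj_onI)
      fix l l' assume l: "l \<in> L u" "l' \<in> L u" "opair u (nb u l) = opair u (nb u l')"
      then have "ndist u (nb u l) = ndist u (nb u l')" by (simp add: opair_def ndist_def)
      then show "l = l'" using nb[OF ux(2)] l by (auto simp: L_def)
    qed
    have "opair u x \<notin> (\<lambda>l. opair u (nb u l)) ` L u"
      using ux by (auto simp: opair_def min_def max_def L_def split: if_splits)
    then have eq: "prod v (T u) = p (ndist u x) * (\<Prod>l\<in>L u. 1 - p l)"
      unfolding T_def using inj v1 v2 by (simp add: L_def prod.reindex)
    have L1: "0 \<le> (\<Prod>l\<in>L u. 1 - p l)"
      using p01 by (intro prod_nonneg) (auto simp: L_def)
    have "(\<Prod>l\<in>L u. 1 - p l) \<le> sqrt P"
    proof (cases "L u = {1..n}")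
      case True
      then show ?thesis using sqrtP(4) by (simp add: P_def)
    next
      case False
      then obtain d where d: "d \<in> {1..n}" "nb u d = x" unfolding L_def by blast
      have dd: "ndist u x = d" using nb[OF ux(2) d(1)] d by auto
      have "l = d" if l: "l \<in> {1..n}" "nb u l = x" for l
        using nb[OF ux(2) l(1)] unfolding l(2) dd by simp
      then have "L u = {1..n} - {d}" using d unfolding L_def by blast
      then have "P = (1 - p d) * (\<Prod>l\<in>L u. 1 - p l)"
        unfolding P_def using prod.remove[of "{1..n}" d "\<lambda>l. 1 - p l"] d(1) by simp
      moreover have "sqrt P \<le> 1 - p d" using u dd by (simp add: W_def)
      ultimately have "sqrt P * (\<Prod>l\<in>L u. 1 - p l) \<le> sqrt P * sqrt P"
        using L1 sqrtP(1) mult_right_mono by metis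
      then show ?thesis by (rule mult_left_le_imp_le[OF _ sqrtP(2)])
    qed
    then show "prod v (T u) \<le> w u"
      unfolding eq w_def using p01(1)[OF ndist_pos[OF ux(1)]] by (intro mult_left_mono) auto
    show "0 \<le> prod v (T u)"
      unfolding eq using L1 p01(1)[OF ndist_pos[OF ux(1)]] by simp
  qed
  \<comment> \<open>The union bound runs over lists of \<open>k\<close> distinct leaves in
    \<open>W\<close>; distinct leaves inspect disjoint sets of coins, so their prices
    multiply.\<close>
  let ?G = "{g \<in> {..<k} \<rightarrow>\<^sub>E W. inj_on g {..<k}}"
  let ?E = "\<lambda>g. {c. \<forall>e\<in>(\<Union>i<k. T (g i)). c e = h e}"
  have finPi: "finite ({..<k} \<rightarrow>\<^sub>E W)" using finW by (intro finite_PiE) auto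
  have cover: "\<exists>g\<in>?G. c \<in> ?E g"
    if c: "c \<in> set_pmf ?M" and S: "S \<subseteq> U" "card S = k + 2" "\<forall>u\<in>S. pendant ?V (coin_rel c) x u" for c S
  proof -
    have c0: "\<not> c e" if "e \<notin> vpairs (2 * n)" for e
      using coins_support(1)[OF c, of "fst e" "snd e"] p01 that by auto
    have leaf: "c e = h e" if u: "u \<in> S" "u \<in> W" and e: "e \<in> T u" for u e
    proof -
      have pu: "pendant ?V (coin_rel c) x u" using S(3) u(1) by blast
      have uU: "u \<in> U" "u \<noteq> x" using u(2) by (auto simp: W_def)
      have rel: "(y, u) \<in> coin_rel c \<longleftrightarrow> c (opair u y)" for y
        using c0[of "(u, y)"] c0[of "(y, u)"]
        by (auto simp: coin_rel_def opair_def vpairs_def min_def max_def)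
      from e consider "e = opair u x" | l where "l \<in> L u" "e = opair u (nb u l)"
        by (auto simp: T_def)
      then show ?thesis
      proof cases
        case 1
        have "h e" by (auto simp: 1 h_def opair_def min_def max_def)
        then show ?thesis using rel[of x] pu by (simp add: 1 pendant_def)
      next
        case 2
        then have nbV: "nb u l \<in> ?V" "nb u l \<noteq> x" using nb[OF uU(1)] by (auto simp: L_def)
        then have "\<not> c e" using rel[of "nb u l"] pu 2 by (auto simp: pendant_def)
        moreover have "\<not> h e" using 2 nbV uU by (auto simp: h_def opair_def min_def max_def)
        ultimately show ?thesis by simp
      qed
    qed
    have finS: "finite S" using S(2) card.infinite by fastforce
    have xS: "x \<notin> S"
    proof
      assume "x \<in> S"
      then have "(x, x) \<in> coin_rel c" using S(3) by (auto simp: pendant_def)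
      then show False using c0[of "(x, x)"] by (auto simp: coin_rel_def vpairs_def)
    qed
    have "card (S - W) \<le> 2"
    proof (cases "S - W = {}")
      case False
      then obtain u0 where u0: "u0 \<in> S - W" by blast
      have small: "1 - p (ndist u x) < sqrt P" "ndist u x \<in> {1..n}" if u: "u \<in> S - W" for u
      proof -
        have ux: "u \<noteq> x" "u \<in> U" using u xS S(1) by auto
        then show lt: "1 - p (ndist u x) < sqrt P" using u by (auto simp: W_def)
        have "u \<in> {1..2 * n}" using ux(2) U by blast
        then have "ndist u x \<le> 2 * n" using x by (auto simp: ndist_def)
        moreover have "p (ndist u x) \<noteq> 0" using lt sqrtP(3) by auto
        ultimately show "ndist u x \<in> {1..n}"
          using ndist_pos[OF ux(1)] zero[of "ndist u x"] by (auto simp: not_less[symmetric])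
      qed
      have same: "ndist u x = ndist u0 x" if u: "u \<in> S - W" for u
      proof (rule ccontr)
        assume ne: "ndist u x \<noteq> ndist u0 x"
        have "P \<le> (\<Prod>l\<in>{ndist u x, ndist u0 x}. 1 - p l)"
          unfolding P_def
        proof (rule prod_mono_subset)
          show "0 \<le> 1 - p l \<and> 1 - p l \<le> 1" if "l \<in> {1..n}" for l using p01[of l] that by auto
        qed (use small u u0 in auto)
        also have "\<dots> = (1 - p (ndist u x)) * (1 - p (ndist u0 x))" using ne by simp
        also have "\<dots> < sqrt P * sqrt P"
        proof (rule mult_strict_mono)
          show "0 \<le> 1 - p (ndist u0 x)" using p01(2)[of "ndist u0 x"] small(2)[OF u0] by simp
        qed (use small u u0 sqrtP(2) in auto)
        finally show False using sqrtP(1) by simp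
      qed
      have "S - W \<subseteq> {x + ndist u0 x, x - ndist u0 x}"
        using same by (force simp: ndist_def min_def max_def split: if_splits)
      then have "card (S - W) \<le> card {x + ndist u0 x, x - ndist u0 x}" by (intro card_mono) auto
      also have "\<dots> \<le> 2" by (simp add: card_insert_if)
      finally show ?thesis .
    next
      case True
      show ?thesis unfolding True by simp
    qed
    moreover have "card S = card (S \<inter> W) + card (S - W)"
      using finS by (metis card_Int_Diff)
    ultimately have "k \<le> card (S \<inter> W)" using S(2) by simp
    then obtain g where g: "inj_on g {..<k}" "g ` {..<k} \<subseteq> S \<inter> W"
      using card_le_inj[of "{..<k}" "S \<inter> W"] finS by auto
    have "restrict g {..<k} \<in> ?G" using g by (auto simp: inj_on_restrict_eq)
    moreover have "c \<in> ?E (restrict g {..<k})"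
    proof (intro CollectI ballI)
      fix e assume "e \<in> (\<Union>i<k. T (restrict g {..<k} i))"
      then obtain i where i: "i < k" "e \<in> T (g i)" by auto
      then have "g i \<in> S" "g i \<in> W" using g(2) by auto
      then show "c e = h e" using i(2) by (rule leaf)
    qed
    ultimately show ?thesis by blast
  qed
  have "measure_pmf.prob ?M {c. \<exists>S\<subseteq>U. card S = k + 2 \<and> (\<forall>u\<in>S. pendant ?V (coin_rel c) x u)} \<le>
      measure_pmf.prob ?M (\<Union>g\<in>?G. ?E g)"
  proof (rule prob_mono_support)
    fix c assume c: "c \<in> set_pmf ?M"
      and "c \<in> {c. \<exists>S\<subseteq>U. card S = k + 2 \<and> (\<forall>u\<in>S. pendant ?V (coin_rel c) x u)}"
    then obtain S where S: "S \<subseteq> U" "card S = k + 2" "\<forall>u\<in>S. pendant ?V (coin_rel c) x u" by blast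
    show "c \<in> (\<Union>g\<in>?G. ?E g)" unfolding UN_iff by (rule cover[OF c S])
  qed
  also have "\<dots> \<le> (\<Sum>g\<in>?G. measure_pmf.prob ?M (?E g))"
    by (rule measure_pmf.finite_measure_subadditive_finite) (use finPi in auto)
  also have "\<dots> \<le> (\<Sum>g\<in>?G. \<Prod>i<k. w (g i))"
  proof (rule sum_mono)
    fix g assume g: "g \<in> ?G"
    then have gW: "g i \<in> W" if "i < k" for i using that by auto
    have "measure_pmf.prob ?M (?E g) = prod v (\<Union>i<k. T (g i))"
      unfolding v_def by (rule prob_coins_cylinder) (use T_sub gW p01 in blast)+
    also have "\<dots> = (\<Prod>i<k. prod v (T (g i)))"
    proof (rule prod.UNION_disjoint)
      show "\<forall>i\<in>{..<k}. \<forall>j\<in>{..<k}. i \<noteq> j \<longrightarrow> T (g i) \<inter> T (g j) = {}"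
      proof (intro ballI impI)
        fix i j assume ij: "i \<in> {..<k}" "j \<in> {..<k}" "i \<noteq> j"
        then have "g i \<noteq> g j" using g inj_onD[of g "{..<k}" i j] by blast
        then show "T (g i) \<inter> T (g j) = {}" using ij gW by (intro T_disj) auto
      qed
      show "\<forall>i\<in>{..<k}. finite (T (g i))" by (simp add: T_def L_def)
    qed simp
    also have "\<dots> \<le> (\<Prod>i<k. w (g i))" by (rule prod_mono) (use v_T gW in auto)
    finally show "measure_pmf.prob ?M (?E g) \<le> (\<Prod>i<k. w (g i))" .
  qed
  \<comment> \<open>Dropping injectivity adds only nonnegative terms and turns the sum over lists
    into a \<open>k\<close>-th power.\<close>
  also have "\<dots> \<le> (\<Sum>g\<in>{..<k} \<rightarrow>\<^sub>E W. \<Prod>i<k. w (g i))"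
  proof (rule sum_mono2[OF finPi])
    have w0: "0 \<le> w u" if "u \<in> W" for u
      using v_T[OF that] by linarith
    show "0 \<le> (\<Prod>i<k. w (g i))" if "g \<in> ({..<k} \<rightarrow>\<^sub>E W) - ?G" for g
      using that w0 by (intro prod_nonneg) auto
  qed auto
  also have "\<dots> = (\<Sum>u\<in>W. w u) ^ k"
    by (subst prod_sum_PiE[symmetric]) (use finW in auto)
  also have "\<dots> \<le> (8 * P powr (1 / 4)) ^ k"
  proof (rule power_mono)
    show "0 \<le> (\<Sum>u\<in>W. w u)"
    proof (rule sum_nonneg)
      fix u assume "u \<in> W"
      then show "0 \<le> w u" using v_T[of u] by linarith
    qed
    have "(\<Sum>u\<in>W. w u) = (\<Sum>u\<in>W. p (ndist u x)) * sqrt P" by (simp add: w_def sum_distrib_right)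
    also have "\<dots> \<le> 2 * (\<Sum>l=1..2 * n. p l) * sqrt P"
      using U x p01(1) sqrtP by (intro mult_right_mono sum_ndist_le) (auto simp: W_def)
    also have "(\<Sum>l=1..2 * n. p l) = (\<Sum>l=1..n. p l)"
      by (rule sum.mono_neutral_right) (use zero in auto)
    also have "2 * (\<Sum>l=1..n. p l) * sqrt P \<le> 2 * (- ln P) * sqrt P"
      unfolding P_def[symmetric] using sum_le_neg_ln_prod[of p n, OF p] sqrtP(2)
      by (intro mult_right_mono) (auto simp: P_def)
    also have "\<dots> \<le> 8 * P powr (1 / 4)"
    proof -
      \<comment> \<open>Here \<open>exp (- 2 * ?y) = sqrt P\<close> and
        \<open>exp (- ?y) = P powr (1 / 4)\<close>, so \<open>?y <= exp ?y\<close> gives up half of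
        the exponent to absorb the logarithm. The constant \<open>8\<close> is
        \<open>2 * 4\<close>.\<close>
      let ?y = "- ln P / 4"
      have "?y \<le> exp ?y" using exp_ge_add_one_self[of ?y] by linarith
      then have "?y * exp (- 2 * ?y) \<le> exp ?y * exp (- 2 * ?y)" by (rule mult_right_mono) simp
      also have "\<dots> = exp (- ?y)" by (simp add: exp_add[symmetric])
      also have "exp (- ?y) = P powr (1 / 4)" using P by (simp add: powr_def)
      finally have "?y * exp (- 2 * ?y) \<le> P powr (1 / 4)" .
      moreover have "exp (- 2 * ?y) = sqrt P"
        using P by (simp add: powr_half_sqrt[symmetric] powr_def)
      ultimately have "?y * sqrt P \<le> P powr (1 / 4)" by (simp only:)
      moreover have "2 * (- ln P) * sqrt P = 8 * (?y * sqrt P)" by simp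
      ultimately show ?thesis by linarith
    qed
    finally show "(\<Sum>u\<in>W. w u) \<le> 8 * P powr (1 / 4)" .
  qed
  finally show ?thesis .
qed

text \<open>A vertex \<open>u <= n\<close> has a vertex at each distance \<open>l <= n\<close> to
  its right, and one with \<open>u > n\<close> has them to its left. Of \<open>2 * k + 4\<close>
  leaves, one half of the vertices contains at least \<open>k + 2\<close>. The factor
  \<open>4 * n\<close> counts the centres and the two halves.\<close>

lemma star_sentence_prob_bound:
  fixes p :: "nat \<Rightarrow> real"
  assumes p: "\<And>l. l \<ge> 1 \<Longrightarrow> 0 \<le> p l \<and> p l < 1" and zero: "\<And>l. n < l \<Longrightarrow> l \<le> 2 * n \<Longrightarrow> p l = 0"
  shows "prob_models p (star_sentence (2 * k + 4)) (2 * n) \<le>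
    4 * real n * (8 * (\<Prod>l=1..n. 1 - p l) powr (1 / 4)) ^ k"
proof -
  let ?M = "coins p (2 * n)" and ?V = "{1..2 * n}"
  let ?b = "(8 * (\<Prod>l=1..n. 1 - p l) powr (1 / 4)) ^ k"
  let ?E = "\<lambda>U x. {c. \<exists>S\<subseteq>U. card S = k + 2 \<and> (\<forall>u\<in>S. pendant ?V (coin_rel c) x u)}"
  have right: "measure_pmf.prob ?M (?E {1..n} x) \<le> ?b" if "x \<in> ?V" for x
    by (rule pendant_prob_bound[OF p zero that, where nb = "\<lambda>u l. u + l"])
      (auto simp: ndist_def opair_def)
  have left: "measure_pmf.prob ?M (?E {n<..2 * n} x) \<le> ?b" if "x \<in> ?V" for x
    by (rule pendant_prob_bound[OF p zero that, where nb = "\<lambda>u l. u - l"])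
      (auto simp: ndist_def opair_def min_def max_def split: if_splits)
  have split: "\<exists>x\<in>?V. c \<in> ?E {1..n} x \<union> ?E {n<..2 * n} x"
    if "models ?V (coin_rel c) (star_sentence (2 * k + 4))" for c
  proof -
    from that obtain x S where S: "x \<in> ?V" "S \<subseteq> ?V" "finite S" "card S = 2 * k + 4"
      "\<forall>u\<in>S. pendant ?V (coin_rel c) x u"
      unfolding models_star_sentence by blast
    have sub: "\<exists>S'\<subseteq>A. card S' = k + 2 \<and> (\<forall>u\<in>S'. pendant ?V (coin_rel c) x u)"
      if A: "k + 2 \<le> card (S \<inter> A)" for A
    proof -
      obtain S' where "S' \<subseteq> S \<inter> A" "card S' = k + 2"
        by (rule obtain_subset_with_card_n[OF A]) (rule that)
      then show ?thesis using S(5) by (intro exI[of _ S']) auto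
    qed
    have "S = (S \<inter> {1..n}) \<union> (S \<inter> {n<..2 * n})" using S(2) by auto
    then have "card S \<le> card (S \<inter> {1..n}) + card (S \<inter> {n<..2 * n})" by (metis card_Un_le)
    then have "k + 2 \<le> card (S \<inter> {1..n}) \<or> k + 2 \<le> card (S \<inter> {n<..2 * n})" using S(4) by linarith
    then have "c \<in> ?E {1..n} x \<or> c \<in> ?E {n<..2 * n} x"
    proof
      assume "k + 2 \<le> card (S \<inter> {1..n})"
      from sub[OF this] show ?thesis by simp
    next
      assume "k + 2 \<le> card (S \<inter> {n<..2 * n})"
      from sub[OF this] show ?thesis by simp
    qed
    then show ?thesis using S(1) by (intro bexI[of _ x]) (simp_all only: Un_iff)
  qed
  have "prob_models p (star_sentence (2 * k + 4)) (2 * n) \<le>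
      measure_pmf.prob ?M (\<Union>x\<in>?V. ?E {1..n} x \<union> ?E {n<..2 * n} x)"
    unfolding prob_models_eq
  proof (rule prob_mono_support)
    fix c assume "c \<in> {c. models ?V (coin_rel c) (star_sentence (2 * k + 4))}"
    then show "c \<in> (\<Union>x\<in>?V. ?E {1..n} x \<union> ?E {n<..2 * n} x)"
      using split[of c] by (simp only: UN_iff mem_Collect_eq)
  qed
  also have "\<dots> \<le> (\<Sum>x\<in>?V. measure_pmf.prob ?M (?E {1..n} x \<union> ?E {n<..2 * n} x))"
    by (rule measure_pmf.finite_measure_subadditive_finite) auto
  also have "\<dots> \<le> (\<Sum>x\<in>?V. ?b + ?b)"
  proof (rule sum_mono)
    fix x assume x: "x \<in> ?V"
    have "measure_pmf.prob ?M (?E {1..n} x \<union> ?E {n<..2 * n} x) \<le>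
      measure_pmf.prob ?M (?E {1..n} x) + measure_pmf.prob ?M (?E {n<..2 * n} x)"
      by (rule measure_Un_le) auto
    then show "measure_pmf.prob ?M (?E {1..n} x \<union> ?E {n<..2 * n} x) \<le> ?b + ?b"
      using right[OF x] left[OF x] by linarith
  qed
  also have "\<dots> = 4 * real n * ?b" by simp
  finally show ?thesis .
qed

section \<open>Oscillation\<close>

text \<open>A prefix of the sequence decides the probability, so later choices in the construction
  cannot disturb what was achieved at smaller sizes.\<close>

lemma prob_models_cong:
  assumes "\<And>l. 1 \<le> l \<Longrightarrow> l \<le> n \<Longrightarrow> p l = q l"
  shows "prob_models p \<psi> n = prob_models q \<psi> n"
proof -
  have "coins p n = coins q n"
    unfolding coins_def by (rule Pi_pmf_cong) (use assms in \<open>auto simp: vpairs_def\<close>)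
  then show ?thesis by (simp add: prob_models_eq)
qed

lemma limsup_ge_ereal:
  assumes "\<And>\<epsilon>. \<epsilon> > 0 \<Longrightarrow> \<exists>\<^sub>F n in sequentially. x - \<epsilon> \<le> X n"
  shows "ereal x \<le> limsup (\<lambda>n. ereal (X n))"
proof (rule ccontr)
  assume "\<not> ?thesis"
  then obtain z where z: "limsup (\<lambda>n. ereal (X n)) < ereal z" "ereal z < ereal x"
    using ereal_dense2[of "limsup (\<lambda>n. ereal (X n))" "ereal x"] by (auto simp: not_le)
  then have "\<forall>\<^sub>F n in sequentially. ereal (X n) < ereal z" by (intro Limsup_lessD)
  then have "\<forall>\<^sub>F n in sequentially. \<not> x - (x - z) \<le> X n" by (rule eventually_mono) simp
  moreover have "\<exists>\<^sub>F n in sequentially. x - (x - z) \<le> X n" using z(2) by (intro assms) simp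
  ultimately show False unfolding frequently_def by blast
qed

lemma liminf_le_ereal:
  assumes "\<And>\<epsilon>. \<epsilon> > 0 \<Longrightarrow> \<exists>\<^sub>F n in sequentially. X n \<le> x + \<epsilon>"
  shows "liminf (\<lambda>n. ereal (X n)) \<le> ereal x"
proof (rule ccontr)
  assume "\<not> ?thesis"
  then obtain z where z: "ereal z < liminf (\<lambda>n. ereal (X n))" "ereal x < ereal z"
    using ereal_dense2[of "ereal x" "liminf (\<lambda>n. ereal (X n))"] by (auto simp: not_le)
  then have "\<forall>\<^sub>F n in sequentially. ereal z < ereal (X n)" by (intro less_LiminfD)
  then have "\<forall>\<^sub>F n in sequentially. \<not> X n \<le> x + (z - x)" by (rule eventually_mono) simp
  moreover have "\<exists>\<^sub>F n in sequentially. X n \<le> x + (z - x)" using z(2) by (intro assms) simp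
  ultimately show False unfolding frequently_def by blast
qed

lemma not_weak_convergence_lawI:
  assumes "sentence \<psi>"
    and "\<And>\<epsilon>. \<epsilon> > 0 \<Longrightarrow> \<exists>\<^sub>F n in sequentially. 1 - \<epsilon> \<le> prob_models p \<psi> n"
    and "\<And>\<epsilon>. \<epsilon> > 0 \<Longrightarrow> \<exists>\<^sub>F n in sequentially. prob_models p \<psi> n \<le> \<epsilon>"
  shows "\<not> weak_convergence_law p"
proof
  assume "weak_convergence_law p"
  then have *: "limsup (\<lambda>n. ereal (prob_models p \<psi> n)) - liminf (\<lambda>n. ereal (prob_models p \<psi> n)) < 1"
    using assms(1) by (simp add: weak_convergence_law_def)
  have "ereal 1 - ereal 0 \<le>
      limsup (\<lambda>n. ereal (prob_models p \<psi> n)) - liminf (\<lambda>n. ereal (prob_models p \<psi> n))"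
    by (intro ereal_minus_mono limsup_ge_ereal liminf_le_ereal) (use assms in auto)
  also note *
  finally show False by (simp add: one_ereal_def)
qed

lemma zero_one_law_imp_convergence_law: "zero_one_law p \<Longrightarrow> convergence_law p"
  unfolding zero_one_law_def convergence_law_def convergent_def by blast

lemma convergence_law_imp_weak_convergence_law:
  assumes "convergence_law p"
  shows "weak_convergence_law p"
  unfolding weak_convergence_law_def
proof (intro allI impI)
  fix \<psi> assume "sentence \<psi>"
  then obtain x where "prob_models p \<psi> \<longlonglongrightarrow> x"
    using assms by (auto simp: convergence_law_def convergent_def)
  then have "(\<lambda>n. ereal (prob_models p \<psi> n)) \<longlonglongrightarrow> ereal x" by simp
  then have "limsup (\<lambda>n. ereal (prob_models p \<psi> n)) = ereal x" "liminf (\<lambda>n. ereal (prob_models p \<psi> n)) = ereal x"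
    by (simp_all add: lim_imp_Limsup lim_imp_Liminf)
  then show "limsup (\<lambda>n. ereal (prob_models p \<psi> n)) - liminf (\<lambda>n. ereal (prob_models p \<psi> n)) < 1"
    by (simp add: one_ereal_def)
qed

lemma frequently_of_subseq:
  assumes "\<And>j :: nat. j \<le> g j" "\<And>j. j \<ge> j0 \<Longrightarrow> Q (g j)"
  shows "\<exists>\<^sub>F n in sequentially. Q n"
  unfolding frequently_sequentially
proof
  fix N
  show "\<exists>n\<ge>N. Q n"
    using assms(1)[of "max N j0"] assms(2)[of "max N j0"] by (intro exI[of _ "g (max N j0)"]) auto
qed

text \<open>\<open>Q A\<close> is the sequence with active positions \<open>A\<close>. Alternating long inactive stretches, where the
  prefix behaves like a finitely supported sequence, with stretches that make the product small
  forces the star sentence to oscillate.\<close>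

lemma oscillation:
  fixes Q :: "nat set \<Rightarrow> nat \<Rightarrow> real"
  assumes Q01: "\<And>A l. l \<ge> 1 \<Longrightarrow> 0 \<le> Q A l \<and> Q A l < 1"
    and local: "\<And>A B l. A \<inter> {1..l} = B \<inter> {1..l} \<Longrightarrow> Q A l = Q B l"
    and inactive: "\<And>A l. l \<notin> A \<Longrightarrow> Q A l = 0"
    and eps: "\<epsilon> > 0"
    and small: "\<And>A M. A \<subseteq> {1..M} \<Longrightarrow>
      \<exists>m>M. (\<Prod>l=1..m. 1 - Q (A \<union> {M<..m}) l) \<le> real m powr - \<epsilon>"
    and start: "\<And>K. \<exists>A m S. A \<subseteq> {1..m} \<and> S \<subseteq> {1..m} \<and> card S = K \<and> (\<forall>l\<in>S. Q A l > 0)"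
  shows "\<exists>A. infinite A \<and> 0 \<notin> A \<and> \<not> weak_convergence_law (Q A)"
proof -
  \<comment> \<open>This gives \<open>\<epsilon> / 4 * k >= 2\<close>, so the upper bound at product
    length \<open>m\<close> is at most a constant times \<open>m * m powr (- 2)\<close>, which tends
    to \<open>0\<close>.\<close>
  obtain k :: nat where k: "8 / \<epsilon> \<le> real k" using real_arch_simple by blast
  let ?K = "2 * k + 4"
  let ?\<psi> = "star_sentence ?K"
  obtain A0 m0 S where A0: "A0 \<subseteq> {1..m0}" "S \<subseteq> {1..m0}" "card S = ?K" "\<forall>l\<in>S. Q A0 l > 0"
    using start[of ?K] by (elim exE conjE) (rule that; assumption)
  \<comment> \<open>A state consists of the active set chosen so far and the length up to which it
    is decided. Freezing \<open>A0\<close> keeps the lengths in \<open>S\<close> available for the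
    star.\<close>
  define I where "I st \<longleftrightarrow> (case st of (A, m) \<Rightarrow> m0 \<le> m \<and> A \<subseteq> {1..m} \<and> A \<inter> {1..m0} = A0)" for st :: "nat set \<times> nat"
  \<comment> \<open>The star is likely at \<open>N\<close> and the product is small at
    \<open>m'\<close>. The gap \<open>2 * m < N\<close> leaves the positions in
    \<open>{m<..2 * m}\<close> inactive, as the upper bound at size \<open>2 * m\<close> for the
    preceding stage requires.\<close>
  define Rel where "Rel j st st' \<longleftrightarrow> (case st of (A, m) \<Rightarrow> case st' of (A', m') \<Rightarrow>
    \<exists>N. 2 * m < N \<and> j \<le> N \<and> N < m' \<and> A' = A \<union> {N<..m'} \<and> 1 - 1 / real (Suc j) \<le> prob_models (Q A) ?\<psi> N \<and>
      (\<Prod>l=1..m'. 1 - Q A' l) \<le> real m' powr - \<epsilon>)" for j :: nat and st st'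
  have start': "\<exists>st. I st" using A0 by (intro exI[of _ "(A0, m0)"]) (auto simp: I_def)
  have step: "\<exists>st'. I st' \<and> Rel j st st'" if "I st" for st j
  proof -
    obtain A m where st: "st = (A, m)" by (cases st)
    have Am: "m0 \<le> m" "A \<subseteq> {1..m}" "A \<inter> {1..m0} = A0" using that by (auto simp: I_def st)
    have "prob_models (Q A) ?\<psi> \<longlonglongrightarrow> 1"
    proof (rule star_sentence_tendsto_1[where M = m and S = S])
      show "0 \<le> Q A l \<and> Q A l < 1" if "l \<ge> 1" for l using Q01 that .
      show "Q A l = 0" if "l > m" for l using Am(2) that by (intro inactive) auto
      show "S \<subseteq> {l. 1 \<le> l \<and> 0 < Q A l}"
      proof
        fix l assume l: "l \<in> S"
        then have "l \<in> {1..m0}" using A0(2) by blast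
        moreover have "Q A l = Q A0 l"
          using Am(3) calculation by (intro local) auto
        ultimately show "l \<in> {l. 1 \<le> l \<and> 0 < Q A l}" using A0(4) l by auto
      qed
    qed (use A0 in \<open>auto intro: finite_subset\<close>)
    then have "\<forall>\<^sub>F N in sequentially. 1 - 1 / real (Suc j) < prob_models (Q A) ?\<psi> N"
      by (rule order_tendstoD) simp
    moreover have "\<forall>\<^sub>F N in sequentially. 2 * m + j < N" by (rule eventually_gt_at_top)
    ultimately have "\<forall>\<^sub>F N in sequentially. 1 - 1 / real (Suc j) < prob_models (Q A) ?\<psi> N \<and> 2 * m + j < N"
      by (rule eventually_conj)
    then obtain N where N: "1 - 1 / real (Suc j) < prob_models (Q A) ?\<psi> N" "2 * m + j < N"
      using eventually_happens'[OF sequentially_bot] by blast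
    have AN: "A \<subseteq> {1..N}" using Am(2) N(2) by auto
    obtain m' where m': "N < m'" "(\<Prod>l=1..m'. 1 - Q (A \<union> {N<..m'}) l) \<le> real m' powr - \<epsilon>"
      using small[OF AN] by blast
    have "I (A \<union> {N<..m'}, m')" using Am N m' by (auto simp: I_def)
    moreover have "Rel j st (A \<union> {N<..m'}, m')"
      unfolding Rel_def st prod.case using N m' by (intro exI[of _ N]) auto
    ultimately show ?thesis by blast
  qed
  obtain f where f: "\<And>j. I (f j)" "\<And>j. Rel j (f j) (f (Suc j))"
    using dependent_nat_choice[of "\<lambda>_. I" Rel] start' step by metis
  define B where "B j = fst (f j)" for j
  define m where "m j = snd (f j)" for j
  have "\<exists>N. \<forall>j. 2 * m j < N j \<and> j \<le> N j \<and> N j < m (Suc j) \<and> B (Suc j) = B j \<union> {N j<..m (Suc j)} \<and>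
      1 - 1 / real (Suc j) \<le> prob_models (Q (B j)) ?\<psi> (N j) \<and>
      (\<Prod>l=1..m (Suc j). 1 - Q (B (Suc j)) l) \<le> real (m (Suc j)) powr - \<epsilon>"
    using f(2) unfolding Rel_def B_def m_def case_prod_beta' by (intro choice) blast
  then obtain N where N: "\<And>j. 2 * m j < N j" "\<And>j. j \<le> N j" "\<And>j. N j < m (Suc j)"
    "\<And>j. B (Suc j) = B j \<union> {N j<..m (Suc j)}"
    "\<And>j. 1 - 1 / real (Suc j) \<le> prob_models (Q (B j)) ?\<psi> (N j)"
    "\<And>j. (\<Prod>l=1..m (Suc j). 1 - Q (B (Suc j)) l) \<le> real (m (Suc j)) powr - \<epsilon>" by blast
  define A where "A = (\<Union>j. B j)"
  have Bm: "B j \<subseteq> {1..m j}" for j using f(1)[of j] by (auto simp: I_def B_def m_def case_prod_beta')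
  have N_mono: "N j \<le> N (j + i)" for i j
  proof (induction i)
    case (Suc i)
    have "N (j + i) < m (Suc (j + i))" by (rule N(3))
    also have "\<dots> \<le> 2 * m (Suc (j + i))" by simp
    also have "\<dots> < N (Suc (j + i))" by (rule N(1))
    finally have "N (j + i) < N (Suc (j + i))" .
    then show ?case using Suc unfolding add_Suc_right by linarith
  qed simp
  have later: "B (j + i) \<inter> {1..N j} = B j \<inter> {1..N j}" for i j
  proof (induction i)
    case (Suc i)
    have "{N (j + i)<..m (Suc (j + i))} \<inter> {1..N j} = {}" using N_mono[of j i] by auto
    then show ?case unfolding add_Suc_right N(4)[of "j + i"] Int_Un_distrib2 Suc by simp
  qed simp
  have B_mono: "B i \<subseteq> B (i + d)" for i d by (induction d) (auto simp: N(4))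
  have A_B: "A \<inter> {1..N j} = B j \<inter> {1..N j}" for j
  proof
    show "A \<inter> {1..N j} \<subseteq> B j \<inter> {1..N j}"
    proof
      fix l assume "l \<in> A \<inter> {1..N j}"
      then obtain i where i: "l \<in> B i" "l \<in> {1..N j}" by (auto simp: A_def)
      show "l \<in> B j \<inter> {1..N j}"
      proof (cases "i \<le> j")
        case True
        then have "i + (j - i) = j" by simp
        then have "B i \<subseteq> B j" using B_mono[of i "j - i"] by simp
        then show ?thesis using i by blast
      next
        case False
        then have "j + (i - j) = i" by simp
        then have "B i \<inter> {1..N j} = B j \<inter> {1..N j}" using later[of j "i - j"] by simp
        then show ?thesis using i by blast
      qed
    qed
  qed (auto simp: A_def)
  have QA: "Q A l = Q (B j) l" if "1 \<le> l" "l \<le> N j" for l j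
  proof (rule local)
    have "{1..l} = {1..N j} \<inter> {1..l}" using that by auto
    then show "A \<inter> {1..l} = B j \<inter> {1..l}" using A_B[of j] by (metis Int_assoc)
  qed
  have j_m: "j \<le> m j" for j
  proof (cases j)
    case (Suc i)
    then show ?thesis using N(2,3)[of i] by simp
  qed simp
  have "infinite A"
  proof
    assume "finite A"
    then obtain b where b: "A \<subseteq> {..<b}" using finite_nat_iff_bounded by auto
    have "m (Suc b) \<in> A" using N(3,4)[of b] by (auto simp: A_def)
    then show False using b j_m[of "Suc b"] by auto
  qed
  moreover have "0 \<notin> A" using Bm by (force simp: A_def)
  moreover have "\<not> weak_convergence_law (Q A)"
  proof (rule not_weak_convergence_lawI[OF sentence_star_sentence])
    fix e :: real assume e: "e > 0"
    obtain j0 :: nat where j0: "1 / e \<le> real j0" using real_arch_simple by blast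
    show "\<exists>\<^sub>F n in sequentially. 1 - e \<le> prob_models (Q A) ?\<psi> n"
    proof (rule frequently_of_subseq[of N j0])
      fix j assume "j0 \<le> j"
      then have "1 / e \<le> real (Suc j)" using j0 by linarith
      then have "1 / real (Suc j) \<le> e" using e by (simp add: field_simps)
      moreover have "prob_models (Q A) ?\<psi> (N j) = prob_models (Q (B j)) ?\<psi> (N j)"
        by (rule prob_models_cong) (use QA in auto)
      ultimately show "1 - e \<le> prob_models (Q A) ?\<psi> (N j)" using N(5)[of j] by linarith
    qed (rule N(2))
  next
    fix e :: real assume e: "e > 0"
    obtain j0 :: nat where j0: "4 * 8 ^ k / e \<le> real j0" using real_arch_simple by blast
    show "\<exists>\<^sub>F n in sequentially. prob_models (Q A) ?\<psi> n \<le> e"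
    proof (rule frequently_of_subseq[of "\<lambda>j. 2 * m (Suc j)" j0])
      show "j \<le> 2 * m (Suc j)" for j using j_m[of "Suc j"] by linarith
    next
      fix j assume j: "j0 \<le> j"
      let ?m = "m (Suc j)" and ?q = "Q (B (Suc j))"
      let ?P = "\<Prod>l=1..?m. 1 - ?q l"
      have m1: "real ?m \<ge> 1" using j_m[of "Suc j"] by simp
      have P0: "0 \<le> ?P" using Q01 by (intro prod_nonneg) (auto intro: less_imp_le)
      have "prob_models (Q A) ?\<psi> (2 * ?m) = prob_models ?q ?\<psi> (2 * ?m)"
        by (rule prob_models_cong) (use QA N(1)[of "Suc j"] in auto)
      also have "\<dots> \<le> 4 * real ?m * (8 * ?P powr (1 / 4)) ^ k"
      proof (rule star_sentence_prob_bound)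
        show "0 \<le> ?q l \<and> ?q l < 1" if "l \<ge> 1" for l using Q01 that .
        show "?q l = 0" if "?m < l" for l using Bm[of "Suc j"] that by (intro inactive) auto
      qed
      also have "\<dots> \<le> 4 * real ?m * (8 * (real ?m powr - \<epsilon>) powr (1 / 4)) ^ k"
        using N(6)[of j] P0 by (intro mult_left_mono power_mono powr_mono2) auto
      also have "\<dots> = 4 * 8 ^ k * (real ?m * real ?m powr (- (\<epsilon> / 4 * real k)))"
        using m1 by (simp add: power_mult_distrib powr_powr powr_realpow[symmetric])
      also have "\<dots> \<le> 4 * 8 ^ k * (real ?m * real ?m powr (- 2))"
      proof (intro mult_left_mono powr_mono)
        have "8 \<le> \<epsilon> * real k" using k eps by (simp add: field_simps)
        then show "- (\<epsilon> / 4 * real k) \<le> - 2" by simp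
      qed (use m1 in auto)
      also have "real ?m * real ?m powr (- 2) = 1 / real ?m"
        using m1 by (simp add: powr_minus powr_numeral field_simps power2_eq_square)
      also have "4 * 8 ^ k * (1 / real ?m) \<le> e"
      proof -
        have "4 * 8 ^ k / e \<le> real ?m" using j0 j j_m[of "Suc j"] by linarith
        then show ?thesis using e m1 by (simp add: field_simps)
      qed
      finally show "prob_models (Q A) ?\<psi> (2 * ?m) \<le> e" .
    qed
  qed
  ultimately show ?thesis by blast
qed

section \<open>Oscillating members of the generated families\<close>

text \<open>For \<open>n > 1\<close> the quotient is never positive, so failing to tend to
  \<open>0\<close> means being at most \<open>- \<epsilon>\<close> infinitely often for some
  \<open>\<epsilon> > 0\<close>.\<close>

lemma frequently_small_product:
  fixes p :: "nat \<Rightarrow> real"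
  assumes p: "\<And>l. l \<ge> 1 \<Longrightarrow> 0 \<le> p l \<and> p l < 1"
    and lim: "\<not> (\<lambda>n. ln (\<Prod>l=1..n. 1 - p l) / ln (real n)) \<longlonglongrightarrow> 0"
  obtains \<epsilon> where "\<epsilon> > 0" "\<exists>\<^sub>F n in sequentially. (\<Prod>l=1..n. 1 - p l) \<le> real n powr - \<epsilon>"
proof -
  let ?P = "\<lambda>n. \<Prod>l=1..n. 1 - p l"
  obtain \<epsilon> where e: "\<epsilon> > 0" "\<exists>\<^sub>F n in sequentially. \<not> dist (ln (?P n) / ln (real n)) 0 < \<epsilon>"
    using lim unfolding tendsto_iff by (auto simp: frequently_def)
  have ev: "\<forall>\<^sub>F n in sequentially. n > (1 :: nat)" by (rule eventually_gt_at_top)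
  have "\<exists>\<^sub>F n in sequentially. ?P n \<le> real n powr - \<epsilon>"
    using frequently_eventually_conj[OF e(2) ev]
  proof (rule frequently_elim1)
    fix n :: nat assume n: "n > 1 \<and> \<not> dist (ln (?P n) / ln (real n)) 0 < \<epsilon>"
    have *: "0 < 1 - p l" "0 \<le> 1 - p l \<and> 1 - p l \<le> 1" if "l \<in> {1..n}" for l using p[of l] that by auto
    have P: "0 < ?P n" by (rule prod_pos) (use * in blast)
    have "?P n \<le> 1" by (rule prod_le_1) (use * in blast)
    then have "ln (?P n) \<le> 0" using P by simp
    moreover have l: "ln (real n) > 0" using n by simp
    ultimately have "\<bar>ln (?P n) / ln (real n)\<bar> = - ln (?P n) / ln (real n)" by (simp add: abs_div)
    moreover have "\<not> \<bar>ln (?P n) / ln (real n)\<bar> < \<epsilon>" using n unfolding dist_real_def diff_0_right by blast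
    ultimately have "\<epsilon> \<le> - ln (?P n) / ln (real n)" by linarith
    then have "ln (?P n) \<le> - \<epsilon> * ln (real n)" using l by (simp add: field_simps)
    then have "exp (ln (?P n)) \<le> exp (- \<epsilon> * ln (real n))" by (simp only: exp_le_cancel_iff)
    then have "?P n \<le> exp (- \<epsilon> * ln (real n))" unfolding exp_ln[OF P] .
    then show "?P n \<le> real n powr - \<epsilon>" using n by (simp add: powr_def)
  qed
  then show thesis using that e(1) by blast
qed

text \<open>With only finitely many positive terms the sequence would have finite support, and the
  limit would be \<open>0\<close>. The set \<open>S\<close> supplies the lengths of the first
  star.\<close>

lemma many_positive:
  fixes p :: "nat \<Rightarrow> real"
  assumes p: "\<And>l. l \<ge> 1 \<Longrightarrow> 0 \<le> p l \<and> p l < 1"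
    and lim: "\<not> (\<lambda>n. ln (\<Prod>l=1..n. 1 - p l) / ln (real n)) \<longlonglongrightarrow> 0"
  shows "\<exists>m. \<exists>S\<subseteq>{1..m}. card S = K \<and> (\<forall>l\<in>S. p l > 0)"
proof -
  have "infinite {l. l \<ge> 1 \<and> p l > 0}"
  proof
    assume "finite {l. l \<ge> 1 \<and> p l > 0}"
    then obtain M where M: "{l. l \<ge> 1 \<and> p l > 0} \<subseteq> {..<M}" using finite_nat_iff_bounded by auto
    have "(\<lambda>n. ln (\<Prod>l=1..n. 1 - p l) / ln (real n)) \<longlonglongrightarrow> 0"
    proof (rule finite_support_lim[where M = M])
      fix l assume l: "M < l"
      have "l \<notin> {l. l \<ge> 1 \<and> p l > 0}"
      proof
        assume "l \<in> {l. l \<ge> 1 \<and> p l > 0}"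
        then have "l \<in> {..<M}" using M by blast
        then show False using l by simp
      qed
      then show "p l = 0" using p[of l] l by auto
    qed
    with lim show False by blast
  qed
  then obtain S where S: "S \<subseteq> {l. l \<ge> 1 \<and> p l > 0}" "finite S" "card S = K"
    using infinite_arbitrarily_large by blast
  then obtain m where "S \<subseteq> {..<m}" using finite_nat_iff_bounded by auto
  then have "l \<in> {1..m}" if "l \<in> S" for l
    using subsetD[OF S(1) that] subsetD[of S "{..<m}" l] that by simp
  then have "S \<subseteq> {1..m}" by blast
  then show ?thesis using S by blast
qed

lemma not_weak_Gen3:
  fixes p :: "nat \<Rightarrow> real"
  assumes p: "\<And>l. l \<ge> 1 \<Longrightarrow> 0 \<le> p l \<and> p l < 1"
    and lim: "\<not> (\<lambda>n. ln (\<Prod>l=1..n. 1 - p l) / ln (real n)) \<longlonglongrightarrow> 0"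
  shows "\<exists>q\<in>Gen3 p. \<not> weak_convergence_law q"
proof -
  define Q where "Q A l = (if l \<in> A \<and> l \<ge> 1 then p l else 0)" for A :: "nat set" and l
  let ?P = "\<lambda>n. \<Prod>l=1..n. 1 - p l"
  obtain \<epsilon> where eps: "\<epsilon> > 0" and freq: "\<exists>\<^sub>F n in sequentially. ?P n \<le> real n powr - \<epsilon>"
    using frequently_small_product[of p, OF p lim] by blast
  have "\<exists>A. infinite A \<and> 0 \<notin> A \<and> \<not> weak_convergence_law (Q A)"
  proof (rule oscillation[where \<epsilon> = "\<epsilon> / 2"])
    fix A M assume A: "A \<subseteq> {1..M :: nat}"
    have P_pos: "0 < ?P M"
    proof (rule prod_pos)
      show "0 < 1 - p l" if "l \<in> {1..M}" for l using p[of l] that by auto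
    qed
    \<comment> \<open>Activating everything after \<open>M\<close> loses at most the factor
      \<open>?P M\<close>, a positive constant as \<open>n\<close> grows; half of the exponent
      absorbs it.\<close>
    have "\<forall>\<^sub>F n in sequentially. real n powr - (\<epsilon> / 2) < ?P M"
    proof (rule order_tendstoD)
      show "(\<lambda>n. real n powr - (\<epsilon> / 2)) \<longlonglongrightarrow> 0" using eps by real_asymp
    qed (rule P_pos)
    then have "\<forall>\<^sub>F n in sequentially. real n powr - (\<epsilon> / 2) < ?P M \<and> M < n"
      using eventually_gt_at_top by (rule eventually_conj)
    from frequently_eventually_conj[OF freq this]
    obtain m where m: "?P m \<le> real m powr - \<epsilon>" "real m powr - (\<epsilon> / 2) < ?P M" "M < m"
      using frequently_ex by blast
    let ?A = "A \<union> {M<..m}"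
    have "(\<Prod>l=1..m. 1 - Q ?A l) \<le> (\<Prod>l\<in>{M<..m}. 1 - Q ?A l)"
    proof (rule prod_mono_subset)
      show "0 \<le> 1 - Q ?A l \<and> 1 - Q ?A l \<le> 1" if "l \<in> {1..m}" for l
        using p[of l] that by (auto simp: Q_def)
    qed auto
    also have "\<dots> = (\<Prod>l\<in>{M<..m}. 1 - p l)" by (rule prod.cong) (auto simp: Q_def)
    also have "\<dots> = ?P m / ?P M"
    proof -
      have "{1..m} = {1..M} \<union> {M<..m}" using m(3) by auto
      then have "?P m = ?P M * (\<Prod>l\<in>{M<..m}. 1 - p l)"
        by (simp only:) (rule prod.union_disjoint, auto)
      then have "(\<Prod>l\<in>{M<..m}. 1 - p l) * ?P M = ?P m" by (simp only: mult.commute)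
      moreover have "?P M \<noteq> 0" using P_pos by linarith
      ultimately show ?thesis by (intro eq_divide_imp)
    qed
    also have "\<dots> \<le> real m powr - \<epsilon> / real m powr - (\<epsilon> / 2)"
      using m P_pos by (intro frac_le) auto
    also have "\<dots> = real m powr - (\<epsilon> / 2)" by (simp add: powr_diff[symmetric])
    finally show "\<exists>m>M. (\<Prod>l=1..m. 1 - Q (A \<union> {M<..m}) l) \<le> real m powr - (\<epsilon> / 2)"
      using m(3) by blast
  next
    fix K
    obtain m S where S: "S \<subseteq> {1..m}" "card S = K" "\<forall>l\<in>S. p l > 0"
      using many_positive[of p, OF p lim] by blast
    then show "\<exists>A m S. A \<subseteq> {1..m} \<and> S \<subseteq> {1..m} \<and> card S = K \<and> (\<forall>l\<in>S. Q A l > 0)"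
      by (intro exI[of _ "{1..m}"] exI[of _ m] exI[of _ S]) (auto simp: Q_def)
  next
    fix A B :: "nat set" and l
    assume AB: "A \<inter> {1..l} = B \<inter> {1..l}"
    have "l \<in> A \<and> l \<ge> 1 \<longleftrightarrow> l \<in> A \<inter> {1..l}" "l \<in> B \<and> l \<ge> 1 \<longleftrightarrow> l \<in> B \<inter> {1..l}" by auto
    then show "Q A l = Q B l" unfolding Q_def AB by simp
  qed (use p eps in \<open>auto simp: Q_def\<close>)
  moreover have "Q A \<in> Gen3 p" for A by (auto simp: Gen3_def Q_def)
  ultimately show ?thesis by blast
qed

text \<open>Listed in increasing order, the elements of \<open>A\<close> up to \<open>m\<close> have
  ranks \<open>1, 2, ...\<close> without gaps, so reading \<open>g\<close> by rank yields an initial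
  product.\<close>

lemma prod_rank:
  fixes g :: "nat \<Rightarrow> real" and A :: "nat set" and m :: nat
  shows "(\<Prod>l=1..m. if l \<in> A then g (card (A \<inter> {1..l})) else 1) = (\<Prod>i=1..card (A \<inter> {1..m}). g i)"
proof (induction m)
  case (Suc m)
  have "A \<inter> {1..Suc m} = (if Suc m \<in> A then insert (Suc m) (A \<inter> {1..m}) else A \<inter> {1..m})"
    by (auto simp: atLeastAtMostSuc_conv)
  then have "card (A \<inter> {1..Suc m}) = (if Suc m \<in> A then Suc (card (A \<inter> {1..m})) else card (A \<inter> {1..m}))"
    by simp
  then show ?case using Suc by simp
qed simp

lemma not_weak_Gen1:
  fixes p :: "nat \<Rightarrow> real"
  assumes p: "\<And>l. l \<ge> 1 \<Longrightarrow> 0 \<le> p l \<and> p l < 1"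
    and lim: "\<not> (\<lambda>n. ln (\<Prod>l=1..n. 1 - p l) / ln (real n)) \<longlonglongrightarrow> 0"
  shows "\<exists>q\<in>Gen1 p. \<not> weak_convergence_law q"
proof -
  \<comment> \<open>The element of \<open>A\<close> of rank \<open>i\<close> receives
    \<open>p i\<close>, which is \<open>p\<close> with zeros inserted off \<open>A\<close>. The rank
    of \<open>l\<close> depends only on \<open>A\<close> up to \<open>l\<close>, as the locality
    condition demands.\<close>
  define Q where "Q A l = (if l \<in> A \<and> l \<ge> 1 then p (card (A \<inter> {1..l})) else 0)" for A :: "nat set" and l
  let ?P = "\<lambda>n. \<Prod>l=1..n. 1 - p l"
  obtain \<epsilon> where eps: "\<epsilon> > 0" and freq: "\<exists>\<^sub>F n in sequentially. ?P n \<le> real n powr - \<epsilon>"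
    using frequently_small_product[of p, OF p lim] by blast
  have card_pos: "1 \<le> card (A \<inter> {1..l})" if "l \<in> A" "1 \<le> l" for A and l :: nat
    using that by (auto simp: Suc_le_eq card_gt_0_iff)
  have "\<exists>A. infinite A \<and> 0 \<notin> A \<and> \<not> weak_convergence_law (Q A)"
  proof (rule oscillation[where \<epsilon> = "\<epsilon> / 2"])
    fix A M assume A: "A \<subseteq> {1..M :: nat}"
    have "\<forall>\<^sub>F n in sequentially. n > M + 4" by (rule eventually_gt_at_top)
    from frequently_eventually_conj[OF freq this]
    obtain n where n: "?P n \<le> real n powr - \<epsilon>" "M + 4 < n" using frequently_ex by blast
    have cA: "card A \<le> M" using card_mono[OF _ A] by simp
    \<comment> \<open>Chosen so that \<open>A \<union> {M<..m}\<close> has exactly \<open>n\<close>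
      elements, which then carry \<open>p 1, ..., p n\<close>. Since
      \<open>m <= 2 * n <= n ^ 2\<close>, halving the exponent pays for replacing \<open>n\<close>
      by \<open>m\<close>.\<close>
    define m where "m = n + M - card A"
    have m: "M < m" "m \<le> 2 * n" "4 \<le> m" using cA n by (auto simp: m_def)
    let ?A = "A \<union> {M<..m}"
    have "?A \<inter> {1..m} = ?A" using A m by auto
    moreover have "card ?A = card A + card {M<..m}"
      using A finite_subset[OF A] by (intro card_Un_disjoint) auto
    ultimately have card_A: "card (?A \<inter> {1..m}) = n" using m cA by (simp add: m_def)
    have "(\<Prod>l=1..m. 1 - Q ?A l) = (\<Prod>l=1..m. if l \<in> ?A then 1 - p (card (?A \<inter> {1..l})) else 1)"
      by (rule prod.cong) (auto simp: Q_def)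
    also have "\<dots> = ?P n" using prod_rank[of ?A "\<lambda>i. 1 - p i" m] unfolding card_A .
    also have "\<dots> \<le> real n powr - \<epsilon>" by (rule n(1))
    also have "\<dots> \<le> real m powr - (\<epsilon> / 2)"
    proof -
      have "sqrt (real m) \<le> real n"
      proof (rule real_le_lsqrt)
        have "real m \<le> 2 * real n" using m(2) by linarith
        also have "\<dots> \<le> real n * real n" using n(2) by (intro mult_right_mono) auto
        finally show "real m \<le> (real n)\<^sup>2" by (simp add: power2_eq_square)
      qed auto
      then have "real n powr - \<epsilon> \<le> sqrt (real m) powr - \<epsilon>"
        using m eps by (intro powr_mono2') auto
      also have "\<dots> = real m powr - (\<epsilon> / 2)"
        using m by (simp add: powr_half_sqrt[symmetric] powr_powr)
      finally show ?thesis .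
    qed
    finally show "\<exists>m>M. (\<Prod>l=1..m. 1 - Q (A \<union> {M<..m}) l) \<le> real m powr - (\<epsilon> / 2)"
      using m(1) by blast
  next
    fix K
    obtain m S where S: "S \<subseteq> {1..m}" "card S = K" "\<forall>l\<in>S. p l > 0"
      using many_positive[of p, OF p lim] by blast
    have "Q {1..m} l = p l" if "l \<in> S" for l
    proof -
      have l: "1 \<le> l" "l \<le> m" using S(1) that by auto
      then have "{1..m} \<inter> {1..l} = {1..l}" by auto
      then show ?thesis using l by (simp add: Q_def)
    qed
    then show "\<exists>A m S. A \<subseteq> {1..m} \<and> S \<subseteq> {1..m} \<and> card S = K \<and> (\<forall>l\<in>S. Q A l > 0)"
      using S by (intro exI[of _ "{1..m}"] exI[of _ m] exI[of _ S]) auto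
  next
    fix A B :: "nat set" and l
    assume AB: "A \<inter> {1..l} = B \<inter> {1..l}"
    have "l \<in> A \<and> l \<ge> 1 \<longleftrightarrow> l \<in> A \<inter> {1..l}" "l \<in> B \<and> l \<ge> 1 \<longleftrightarrow> l \<in> B \<inter> {1..l}" by auto
    then show "Q A l = Q B l" unfolding Q_def AB by simp
  next
    fix A and l :: nat assume "l \<ge> 1"
    then show "0 \<le> Q A l \<and> Q A l < 1" using p card_pos by (auto simp: Q_def)
  qed (use eps in \<open>auto simp: Q_def\<close>)
  then obtain A where A: "infinite A" "0 \<notin> A" "\<not> weak_convergence_law (Q A)" by blast
  \<comment> \<open>\<open>enumerate\<close> counts from \<open>0\<close> while sequences start at
    \<open>1\<close>; hence the index \<open>i - 1\<close>. Infinity of \<open>A\<close> makes the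
    enumeration total, so every \<open>p i\<close> is placed.\<close>
  have "Q A \<in> Gen1 p"
    unfolding Gen1_def mem_Collect_eq
  proof (intro exI[of _ "\<lambda>i. enumerate A (i - 1)"] conjI allI impI)
    have in_A: "enumerate A i \<in> A" for i by (rule enumerate_in_set[OF A(1)])
    have pos: "1 \<le> enumerate A i" for i using in_A[of i] A(2) by (cases "enumerate A i") auto
    show "(\<lambda>i. enumerate A (i - 1)) ` {1..} \<subseteq> {1..}" using pos by auto
    show "strict_mono_on {1..} (\<lambda>i. enumerate A (i - 1))"
      using A(1) by (auto simp: strict_mono_on_def intro!: enumerate_mono)
    fix l :: nat
    show "Q A (enumerate A (l - 1)) = p l" if l: "1 \<le> l"
    proof -
      have "A \<inter> {1..enumerate A (l - 1)} = enumerate A ` {..l - 1}"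
      proof (intro equalityI subsetI)
        fix x assume x: "x \<in> A \<inter> {1..enumerate A (l - 1)}"
        then obtain i where i: "x = enumerate A i" using enumerate_Ex[of A x] A(1) by blast
        then have "i \<le> l - 1" using x A(1) enumerate_mono[of "l - 1" i A] by (force simp: not_le[symmetric])
        then show "x \<in> enumerate A ` {..l - 1}" using i by auto
      next
        fix x assume "x \<in> enumerate A ` {..l - 1}"
        then obtain i where i: "x = enumerate A i" "i \<le> l - 1" by auto
        have "enumerate A i \<le> enumerate A (l - 1)"
          using i(2) enumerate_mono[of i "l - 1" A] A(1) by (cases "i = l - 1") auto
        then show "x \<in> A \<inter> {1..enumerate A (l - 1)}" using i in_A pos by auto
      qed
      moreover have "inj (enumerate A)" using A(1) by (simp add: strict_mono_enumerate strict_mono_imp_inj_on)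
      ultimately have "card (A \<inter> {1..enumerate A (l - 1)}) = l"
        using l by (simp add: card_image inj_on_subset)
      then show ?thesis using in_A pos by (simp add: Q_def)
    qed
    show "Q A l = 0" if "1 \<le> l" "l \<notin> (\<lambda>i. enumerate A (i - 1)) ` {1..}"
    proof -
      have "l \<notin> A"
      proof
        assume "l \<in> A"
        then obtain i where "l = enumerate A i" using enumerate_Ex[of A l] A(1) by blast
        then have "l = (\<lambda>i. enumerate A (i - 1)) (Suc i)" by simp
        then show False using that(2) by (metis atLeast_iff image_eqI le_add1 plus_1_eq_Suc)
      qed
      then show ?thesis by (simp add: Q_def)
    qed
  qed
  then show ?thesis using A(3) by blast
qed

section \<open>Heredity of the limit condition and the equivalences\<close>

text \<open>Inserting zeros moves \<open>p i\<close> to a position \<open>f i >= i\<close>, so the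
  first \<open>n\<close> places of \<open>q\<close> hold, apart from zeros, only values among
  \<open>p 1, ..., p n\<close>. Omitting or lowering values can only raise the product, and this
  carries the limit condition from \<open>p\<close> to \<open>q\<close>.\<close>

lemma Gen_inherit:
  fixes p :: "nat \<Rightarrow> real"
  assumes p: "\<And>l. l \<ge> 1 \<Longrightarrow> 0 \<le> p l \<and> p l < 1"
    and Gen: "Gen \<in> {Gen1, Gen2, Gen3}" and q: "q \<in> Gen p"
  shows "\<And>l. l \<ge> 1 \<Longrightarrow> 0 \<le> q l \<and> q l < 1"
    and "(\<Prod>l=1..n. 1 - p l) \<le> (\<Prod>l=1..n. 1 - q l)"
proof -
  have 23: "(\<forall>l\<ge>1. 0 \<le> q l \<and> q l < 1) \<and> (\<Prod>l=1..n. 1 - p l) \<le> (\<Prod>l=1..n. 1 - q l)" if "q \<in> Gen2 p"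
  proof -
    have q: "0 \<le> q l" "q l \<le> p l" if "l \<ge> 1" for l using \<open>q \<in> Gen2 p\<close> that by (auto simp: Gen2_def)
    have "q l < 1" if "l \<ge> 1" for l using q(2)[OF that] p[OF that] by linarith
    moreover have "0 \<le> 1 - p l \<and> 1 - p l \<le> 1 - q l" if "l \<in> {1..n}" for l using q[of l] p[of l] that by auto
    then have "(\<Prod>l=1..n. 1 - p l) \<le> (\<Prod>l=1..n. 1 - q l)" by (intro prod_mono) blast
    ultimately show ?thesis using q by blast
  qed
  have 1: "(\<forall>l\<ge>1. 0 \<le> q l \<and> q l < 1) \<and> (\<Prod>l=1..n. 1 - p l) \<le> (\<Prod>l=1..n. 1 - q l)" if g1: "q \<in> Gen1 p"
  proof -
    obtain f where "f ` {1..} \<subseteq> {1..} \<and> strict_mono_on {1..} f \<and> (\<forall>i\<ge>1. q (f i) = p i) \<and>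
        (\<forall>l\<ge>1. l \<notin> f ` {1..} \<longrightarrow> q l = 0)"
      using g1 unfolding Gen1_def by blast
    then have f: "f ` {1..} \<subseteq> {1..}" "strict_mono_on {1..} f" "\<And>i. i \<ge> 1 \<Longrightarrow> q (f i) = p i"
      "\<And>l. l \<ge> 1 \<Longrightarrow> l \<notin> f ` {1..} \<Longrightarrow> q l = 0" by blast+
    have q01: "0 \<le> q l \<and> q l < 1" if "l \<ge> 1" for l
    proof (cases "l \<in> f ` {1..}")
      case True
      then obtain i where "l = f i" "i \<ge> 1" by auto
      then show ?thesis using f(3) p by simp
    next
      case False
      then show ?thesis using f(4) that by simp
    qed
    have f_ge: "i \<le> f i" if "i \<ge> 1" for i
      using that
    proof (induction i rule: dec_induct)
      case base
      then show ?case using f(1) by auto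
    next
      case (step i)
      have "f i < f (Suc i)" using f(2) step by (auto simp: strict_mono_on_def)
      then show ?case using step by linarith
    qed
    define I where "I = {i. i \<ge> 1 \<and> f i \<le> n}"
    have I: "I \<subseteq> {1..n}" using f_ge by (force simp: I_def)
    have inj: "inj_on f I" using strict_mono_on_imp_inj_on[OF f(2)] by (rule inj_on_subset) (auto simp: I_def)
    have "(\<Prod>l=1..n. 1 - p l) \<le> (\<Prod>i\<in>I. 1 - p i)"
    proof (rule prod_mono_subset[OF _ I])
      show "0 \<le> 1 - p l \<and> 1 - p l \<le> 1" if "l \<in> {1..n}" for l using p[of l] that by auto
    qed simp
    also have "\<dots> = (\<Prod>i\<in>I. 1 - q (f i))" by (rule prod.cong) (auto simp: I_def f(3))
    also have "\<dots> = (\<Prod>l\<in>f ` I. 1 - q l)" using inj by (simp add: prod.reindex)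
    also have "\<dots> = (\<Prod>l=1..n. 1 - q l)"
    proof (rule prod.mono_neutral_left)
      show "f ` I \<subseteq> {1..n}" using f(1) by (auto simp: I_def)
      show "\<forall>l\<in>{1..n} - f ` I. 1 - q l = 1"
      proof
        fix l assume l: "l \<in> {1..n} - f ` I"
        then have "l \<notin> f ` {1..}" by (auto simp: I_def)
        then show "1 - q l = 1" using f(4) l by simp
      qed
    qed simp
    finally show ?thesis using q01 by blast
  qed
  have "Gen3 p \<subseteq> Gen2 p" using p by (auto simp: Gen3_def Gen2_def)
  then have "(\<forall>l\<ge>1. 0 \<le> q l \<and> q l < 1) \<and> (\<Prod>l=1..n. 1 - p l) \<le> (\<Prod>l=1..n. 1 - q l)"
    using Gen q 1 23 by auto
  then show "\<And>l. l \<ge> 1 \<Longrightarrow> 0 \<le> q l \<and> q l < 1"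
    and "(\<Prod>l=1..n. 1 - p l) \<le> (\<Prod>l=1..n. 1 - q l)" by blast+
qed

lemma hereditarily_zero_one_law:
  fixes p :: "nat \<Rightarrow> real"
  assumes p: "\<And>l. l \<ge> 1 \<Longrightarrow> 0 \<le> p l \<and> p l < 1"
    and Gen: "Gen \<in> {Gen1, Gen2, Gen3}"
    and lim: "(\<lambda>n. ln (\<Prod>l=1..n. 1 - p l) / ln (real n)) \<longlonglongrightarrow> 0"
  shows "hereditarily Gen zero_one_law p"
  unfolding hereditarily_def
proof
  fix q assume q: "q \<in> Gen p"
  have q01: "0 \<le> q l \<and> q l < 1" if "l \<ge> 1" for l by (rule Gen_inherit(1)[of p Gen q, OF p Gen q that])
  show "zero_one_law q"
  proof (rule zero_one_law_if[of q, OF q01])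
    have bounds: "ln (\<Prod>l=1..n. 1 - p l) / ln (real n) \<le> ln (\<Prod>l=1..n. 1 - q l) / ln (real n)"
      "ln (\<Prod>l=1..n. 1 - q l) / ln (real n) \<le> 0" for n
    proof -
      have *: "0 < 1 - p l" "0 \<le> 1 - q l \<and> 1 - q l \<le> 1" if "l \<in> {1..n}" for l
        using p[of l] q01[of l] that by auto
      have pp: "0 < (\<Prod>l=1..n. 1 - p l)" by (rule prod_pos) (use * in blast)
      have le: "(\<Prod>l=1..n. 1 - p l) \<le> (\<Prod>l=1..n. 1 - q l)" by (rule Gen_inherit(2)[of p Gen q, OF p Gen q])
      have q1: "(\<Prod>l=1..n. 1 - q l) \<le> 1" by (rule prod_le_1) (use * in blast)
      \<comment> \<open>For \<open>n = 0\<close> this relies on \<open>ln 0 = 0\<close>; together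
        with division by zero being \<open>0\<close>, both bounds hold for all \<open>n\<close>
        rather than eventually.\<close>
      have ln0: "0 \<le> ln (real n)" by (cases "n = 0") auto
      show "ln (\<Prod>l=1..n. 1 - p l) / ln (real n) \<le> ln (\<Prod>l=1..n. 1 - q l) / ln (real n)"
        using pp le ln0 by (intro divide_right_mono) auto
      have "ln (\<Prod>l=1..n. 1 - q l) \<le> 0" using pp le q1 by (subst ln_le_zero_iff) linarith+
      then show "ln (\<Prod>l=1..n. 1 - q l) / ln (real n) \<le> 0" using ln0 by (rule divide_nonpos_nonneg)
    qed
    show "(\<lambda>n. ln (\<Prod>l=1..n. 1 - q l) / ln (real n)) \<longlonglongrightarrow> 0"
      by (rule tendsto_sandwich[OF _ _ lim tendsto_const]) (use bounds in auto)
  qed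
qed

text \<open>The oscillating member of \<open>Gen3 p\<close> also lies in \<open>Gen2 p\<close>, so
  only two constructions are needed for the three families.\<close>

lemma hereditarily_weak_imp_lim:
  fixes p :: "nat \<Rightarrow> real"
  assumes p: "\<And>l. l \<ge> 1 \<Longrightarrow> 0 \<le> p l \<and> p l < 1"
    and Gen: "Gen \<in> {Gen1, Gen2, Gen3}"
    and weak: "hereditarily Gen weak_convergence_law p"
  shows "(\<lambda>n. ln (\<Prod>l=1..n. 1 - p l) / ln (real n)) \<longlonglongrightarrow> 0"
proof (rule ccontr)
  assume lim: "\<not> ?thesis"
  have "Gen3 p \<subseteq> Gen2 p" using p by (auto simp: Gen3_def Gen2_def)
  then have "\<exists>q\<in>Gen p. \<not> weak_convergence_law q"
    using Gen not_weak_Gen1[of p, OF p lim] not_weak_Gen3[of p, OF p lim] by auto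
  then show False using weak by (auto simp: hereditarily_def)
qed

theorem theorem1p5:
  fixes p :: "nat \<Rightarrow> real"
    and Gen :: "(nat \<Rightarrow> real) \<Rightarrow> (nat \<Rightarrow> real) set"
  assumes "\<forall>i\<ge>1. 0 \<le> p i \<and> p i < 1"
    and "Gen \<in> {Gen1, Gen2, Gen3}"
  shows "(hereditarily Gen zero_one_law p \<longleftrightarrow>
            (\<lambda>n. ln (\<Prod>i=1..n. 1 - p i) / ln (real n)) \<longlonglongrightarrow> 0) \<and>
         (hereditarily Gen convergence_law p \<longleftrightarrow>
            (\<lambda>n. ln (\<Prod>i=1..n. 1 - p i) / ln (real n)) \<longlonglongrightarrow> 0) \<and>
         (hereditarily Gen weak_convergence_law p \<longleftrightarrow>
            (\<lambda>n. ln (\<Prod>i=1..n. 1 - p i) / ln (real n)) \<longlonglongrightarrow> 0)"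
proof -
  have p: "0 \<le> p l \<and> p l < 1" if "l \<ge> 1" for l using assms(1) that by blast
  \<comment> \<open>These implications close a cycle: the limit condition gives the hereditary 0-1
    law, which descends to the weak convergence law, and that returns the limit condition.\<close>
  have "hereditarily Gen zero_one_law p \<Longrightarrow> hereditarily Gen convergence_law p"
    "hereditarily Gen convergence_law p \<Longrightarrow> hereditarily Gen weak_convergence_law p"
    unfolding hereditarily_def
    using zero_one_law_imp_convergence_law convergence_law_imp_weak_convergence_law by blast+
  then show ?thesis
    using hereditarily_zero_one_law[of p Gen, OF p assms(2)]
      hereditarily_weak_imp_lim[of p Gen, OF p assms(2)] by blast
qed

end
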